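(* Let $d\geq 2$, let $\Omega$ be a set of equiangular lines in $\mathbb{R}^d$ with common angle $\kappa\in(0,1)$ that saturates the relative bound and the incoherence bound, and let $\Gamma\subseteq\Omega$ be an incoherent set of size $d$. If $d\geq 4$, suppose in addition that $$|S_{\alpha\beta}\cap S_{\eta\nu}|$$ is constant over all $4$-subsets $\{\alpha,\beta,\eta,\nu\}$ of $\Gamma$. Then $d=2,3,6,7$ or $23$ and $\Omega$ is isometric to the standard set $\Omega_d$ of equiangular lines described in the context.
   Context: Lines are lines through the origin of $\mathbb{R}^d$. A set of lines is equiangular with common angle $\kappa$ if, choosing a unit vector spanning each line, the inner product of any two unit vectors spanning distinct lines is $\pm\kappa$. A line is identified with a unit vector spanning it; $(\cdot,\cdot)$ is the Euclidean inner product. If $\kappa^2d<1$, such a set has at most $\frac{d-\kappa^2d}{1-\kappa^2d}$ lines (the relative bound); "$\Omega$ saturates the relative bound" means $\kappa^2d<1$ and $|\Omega|=\frac{d-\kappa^2d}{1-\kappa^2d}$. A set $\Gamma$ of equiangular lines is incoherent if $|\Gamma|\leq 2$ or $(\alpha_1,\alpha_2)(\alpha_1,\alpha_3)(\alpha_2,\alpha_3)>0$ for every $3$-subset $\{\alpha_1,\alpha_2,\alpha_3\}$ of $\Gamma$. $\operatorname{Inc}(\Omega)$ is the maximum size of an incoherent subset of $\Omega$; it is at most $d$, and $\Omega$ saturates the incoherence bound if $\operatorname{Inc}(\Omega)=d$. For distinct $\alpha,\beta\in\Omega$, $$S_{\alpha\beta}=\{\gamma\in\Omega\setminus\{\alpha,\beta\}\,:\,(\alpha,\beta)(\alpha,\gamma)(\beta,\gamma)<0\}.$$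 "Constant over all $4$-subsets" means that there is one number $c$ with $|S_{\alpha\beta}\cap S_{\eta\nu}|=c$ for all pairwise distinct $\alpha,\beta,\eta,\nu\in\Gamma$. Isometric means equal up to an orthogonal transformation. A quasi-symmetric $t$-$(d,k,\lambda;s_1,s_2)$ design is a pair $(\mathcal{P},\mathcal{B})$, $|\mathcal P|=d$, $\mathcal B$ a set of $k$-subsets of $\mathcal P$ (blocks), such that every $t$-subset of $\mathcal P$ lies in exactly $\lambda$ blocks and the set of intersection sizes of distinct blocks is exactly $\{s_1,s_2\}$. Standard sets $\Omega_d$: $\Omega_2$ is the set of $3$ lines through opposite vertices of a regular hexagon in $\mathbb{R}^2$ centred at the origin; $\Omega_3$ is the set of $6$ lines through opposite vertices of a regular icosahedron in $\mathbb{R}^3$ centred at the origin. For $d=6$ let $(\mathcal{P},\mathcal{B})$ be the (unique up to isomorphism) quasi-symmetric $2$-$(6,3,2;2,1)$ design on $\mathcal P=\{1,\dots,6\}$; for $d=7$ the $2$-$(7,2,1;1,0)$ design of all $2$-subsets of $\mathcal P=\{1,\dots,7\}$; for $d=23$ the (unique up to isomorphism) Steiner system $S(4,7,23)$ on $\mathcal P=\{1,\dots,23\}$, which is a quasi-symmetric $4$-$(23,7,1;3,1)$ design. With $k$ the block size and $s_1>s_2$ the intersection numbers, put $\Delta_1=k^2-\frac{d(s_1+s_2)}{2}$ and $\Delta_2=(k-s_1)+\frac{d(s_1-s_2)}{2}$. For $B\in\mathcal{B}$ let $v(B)\in\mathbb{R}^d$ have $j$th entry $d-k+\sqrt{\Delta_1}$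 if $j\in B$ and $-k+\sqrt{\Delta_1}$ if $j\notin B$. For $i\in\mathcal{P}$ let $v(i)\in\mathbb{R}^d$ have $j$th entry $(s_1-s_2)(d-1)-\sqrt{\Delta_2}$ if $j=i$ and $-(s_1-s_2)-\sqrt{\Delta_2}$ if $j\ne i$. Then $\Omega_d$ is the set of lines spanned by the vectors $v(B)$ ($B\in\mathcal{B}$) and $v(i)$ ($i\in\mathcal{P}$); it has $16$, $28$, $276$ lines for $d=6,7,23$ respectively. *)

theory Defs
  imports "HOL-Analysis.Analysis"
begin

section \<open>Equiangular lines\<close>

definition is_line :: "(real^'n) set \<Rightarrow> bool" where
  "is_line L \<longleftrightarrow> (\<exists>v. v \<noteq> 0 \<and> L = span {v})"

text \<open>A spanning unit vector of a line is unique only up to sign. All notions below are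
  invariant under changing the sign of the chosen vector.\<close>

definition unit_vec :: "(real^'n) set \<Rightarrow> real^'n" where
  "unit_vec L = (SOME u. norm u = 1 \<and> span {u} = L)"

definition equiangular :: "real \<Rightarrow> (real^'n) set set \<Rightarrow> bool" where
  "equiangular \<kappa> \<Omega> \<longleftrightarrow>
     (\<forall>\<alpha>\<in>\<Omega>. is_line \<alpha>) \<and>
     (\<forall>\<alpha>\<in>\<Omega>. \<forall>\<beta>\<in>\<Omega>. \<alpha> \<noteq> \<beta> \<longrightarrow> unit_vec \<alpha> \<bullet> unit_vec \<beta> \<in> {\<kappa>, - \<kappa>})"

definition triple_prod :: "(real^'n) set \<Rightarrow> (real^'n) set \<Rightarrow> (real^'n) set \<Rightarrow> real" where
  "triple_prod \<alpha> \<beta> \<gamma> =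
     (unit_vec \<alpha> \<bullet> unit_vec \<beta>) * (unit_vec \<alpha> \<bullet> unit_vec \<gamma>) * (unit_vec \<beta> \<bullet> unit_vec \<gamma>)"

text \<open>If \<open>\<kappa>\<^sup>2 d < 1\<close> and \<open>\<kappa> < 1\<close> the right-hand side is positive, so the second
  equation forces \<open>\<Omega>\<close> to be finite.\<close>

definition saturates_relative_bound :: "real \<Rightarrow> (real^'n) set set \<Rightarrow> bool" where
  "saturates_relative_bound \<kappa> \<Omega> \<longleftrightarrow>
     (let d = real CARD('n) in
        \<kappa>\<^sup>2 * d < 1 \<and> real (card \<Omega>) = (d - \<kappa>\<^sup>2 * d) / (1 - \<kappa>\<^sup>2 * d))"

definition incoherent :: "(real^'n) set set \<Rightarrow> bool" where
  "incoherent \<Gamma> \<longleftrightarrow>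
     (finite \<Gamma> \<and> card \<Gamma> \<le> 2) \<or>
     (\<forall>\<alpha>\<in>\<Gamma>. \<forall>\<beta>\<in>\<Gamma>. \<forall>\<gamma>\<in>\<Gamma>. distinct [\<alpha>, \<beta>, \<gamma>] \<longrightarrow> triple_prod \<alpha> \<beta> \<gamma> > 0)"

definition Inc :: "(real^'n) set set \<Rightarrow> nat" where
  "Inc \<Omega> = Max {card \<Gamma> | \<Gamma>. \<Gamma> \<subseteq> \<Omega> \<and> incoherent \<Gamma>}"

definition saturates_incoherence_bound :: "(real^'n) set set \<Rightarrow> bool" where
  "saturates_incoherence_bound \<Omega> \<longleftrightarrow> Inc \<Omega> = CARD('n)"

definition S :: "(real^'n) set set \<Rightarrow> (real^'n) set \<Rightarrow> (real^'n) set \<Rightarrow> (real^'n) set set" where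
  "S \<Omega> \<alpha> \<beta> = {\<gamma> \<in> \<Omega> - {\<alpha>, \<beta>}. triple_prod \<alpha> \<beta> \<gamma> < 0}"

text \<open>The library's \<^const>\<open>orthogonal_transformation\<close> only covers maps from a space to itself;
  here the domain and codomain may be copies of the same Euclidean space with different
  index types.\<close>

definition isometric :: "(real^'n) set set \<Rightarrow> (real^'m) set set \<Rightarrow> bool" where
  "isometric \<Omega> \<Omega>' \<longleftrightarrow>
     (\<exists>f :: real^'n \<Rightarrow> real^'m.
        linear f \<and> bij f \<and> (\<forall>v w. f v \<bullet> f w = v \<bullet> w) \<and> (\<lambda>L. f ` L) ` \<Omega> = \<Omega>')"


section \<open>Quasi-symmetric designs\<close>

definition quasi_symmetric_design ::
  "nat \<Rightarrow> nat \<Rightarrow> nat \<Rightarrow> nat \<Rightarrow> nat \<Rightarrow> nat \<Rightarrow> 'p set \<Rightarrow> 'p set set \<Rightarrow> bool" where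
  "quasi_symmetric_design t d k l s\<^sub>1 s\<^sub>2 P \<B> \<longleftrightarrow>
     finite P \<and> card P = d \<and>
     (\<forall>B\<in>\<B>. B \<subseteq> P \<and> card B = k) \<and>
     (\<forall>T. T \<subseteq> P \<and> card T = t \<longrightarrow> card {B \<in> \<B>. T \<subseteq> B} = l) \<and>
     {card (B \<inter> B') | B B'. B \<in> \<B> \<and> B' \<in> \<B> \<and> B \<noteq> B'} = {s\<^sub>1, s\<^sub>2}"


section \<open>The standard sets of equiangular lines\<close>

definition Omega2 :: "(real^2) set set" where
  "Omega2 = {span {vector [cos (real j * pi / 3), sin (real j * pi / 3)]} | j. j < 6}"

text \<open>The twelve vertices of a regular icosahedron are the cyclic permutations of
  \<open>(0, \<plusminus>1, \<plusminus>\<phi>)\<close>, where \<open>\<phi>\<close> is the golden ratio.\<close>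

definition icosahedron_vertices :: "(real^3) set" where
  "icosahedron_vertices =
     (let \<phi> = (1 + sqrt 5) / 2 in
        (\<Union>a\<in>{1, -1}. \<Union>b\<in>{\<phi>, - \<phi>}. {vector [0, a, b], vector [a, b, 0], vector [b, 0, a]}))"

definition Omega3 :: "(real^3) set set" where
  "Omega3 = {span {v} | v. v \<in> icosahedron_vertices}"

text \<open>In the vectors below the points of the design are the coordinate indices, so that
  \<open>d = CARD('n)\<close>, and \<open>s\<^sub>1 > s\<^sub>2\<close>.\<close>

definition block_vec :: "nat \<Rightarrow> nat \<Rightarrow> nat \<Rightarrow> 'n set \<Rightarrow> real^'n" where
  "block_vec k s\<^sub>1 s\<^sub>2 B =
     (let d = real CARD('n); \<Delta>\<^sub>1 = (real k)\<^sup>2 - d * (real s\<^sub>1 + real s\<^sub>2) / 2 in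
        \<chi> j. if j \<in> B then d - real k + sqrt \<Delta>\<^sub>1 else - real k + sqrt \<Delta>\<^sub>1)"

definition point_vec :: "nat \<Rightarrow> nat \<Rightarrow> nat \<Rightarrow> 'n \<Rightarrow> real^'n" where
  "point_vec k s\<^sub>1 s\<^sub>2 i =
     (let d = real CARD('n); \<Delta>\<^sub>2 = (real k - real s\<^sub>1) + d * (real s\<^sub>1 - real s\<^sub>2) / 2 in
        \<chi> j. if j = i then (real s\<^sub>1 - real s\<^sub>2) * (d - 1) - sqrt \<Delta>\<^sub>2
             else - (real s\<^sub>1 - real s\<^sub>2) - sqrt \<Delta>\<^sub>2)"

definition design_lines :: "nat \<Rightarrow> nat \<Rightarrow> nat \<Rightarrow> 'n set set \<Rightarrow> (real^'n) set set" where
  "design_lines k s\<^sub>1 s\<^sub>2 \<B> =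
     {span {block_vec k s\<^sub>1 s\<^sub>2 B} | B. B \<in> \<B>} \<union> {span {point_vec k s\<^sub>1 s\<^sub>2 i} | i. True}"

text \<open>The designs chosen for \<open>d = 6\<close> and \<open>d = 23\<close> exist and are unique up to isomorphism. An
  isomorphism of designs permutes the coordinates, so the resulting set of lines does not depend
  on the choice up to isometry. For \<open>d = 23\<close> the condition with \<open>t = 4\<close> and \<open>l = 1\<close> says that the
  design is a Steiner system \<open>S(4,7,23)\<close>.\<close>

definition blocks6 :: "6 set set" where
  "blocks6 = (SOME \<B>. quasi_symmetric_design 2 6 3 2 2 1 UNIV \<B>)"

definition blocks7 :: "7 set set" where
  "blocks7 = {B. card B = 2}"

definition blocks23 :: "23 set set" where
  "blocks23 = (SOME \<B>. quasi_symmetric_design 4 23 7 1 3 1 UNIV \<B>)"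

definition Omega6 :: "(real^6) set set" where
  "Omega6 = design_lines 3 2 1 blocks6"

definition Omega7 :: "(real^7) set set" where
  "Omega7 = design_lines 2 1 0 blocks7"

definition Omega23 :: "(real^23) set set" where
  "Omega23 = design_lines 7 3 1 blocks23"

end

theory Submission
  imports Defs "HOL-Library.Z2"
begin

text \<open>Let \<open>q = 1 / \<kappa>\<close>. The lines of \<open>\<Gamma>\<close> can be oriented so that all their inner products are
  \<open>1 / q\<close>; then they form a basis, and each other line of \<open>\<Omega>\<close> becomes, up to sign, a vector of
  \<open>d\<close> signs. Inverting the Gram matrix of the basis determines the square of the coordinate sum of
  these vectors and the two possible inner products between them. Saturation of the relative bound
  means that \<open>\<Omega>\<close> is a tight frame, so that all second moments of the sign vectors agree; by the
  hypothesis on quadruples so do all fourth moments. If the coordinate sum \<open>s\<close> is nonzero, the odd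
  moments agree as well, and comparing third moments gives \<open>d = q\<^sup>2 - 2\<close>. Counting the sign
  vectors that are positive at three given places then shows that \<open>q - 2\<close> divides \<open>4 s\<close>,
  whence \<open>q = 3\<close> or \<open>q = 5\<close>. If \<open>s = 0\<close>, comparing fourth moments gives \<open>q = 3\<close> and \<open>d = 6\<close>.

  For \<open>d = 2, 3, 6, 7\<close> all sign vectors with the right coordinate sum occur, which determines
  \<open>\<Omega>\<close>. For \<open>d = 23\<close> they form a Steiner system \<open>S(4,7,23)\<close>, and it remains to show that this
  system is unique. Any such system contains twelve blocks in a standard position, which span the
  binary Golay code up to parity extension. As that code is self-dual, and as a set of seven points
  meeting all blocks in an odd number of points is a block, the twelve blocks determine the system.\<close>

text \<open>The moment conditions become usable because a sum of products of signs over tuples of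
  distinct places depends only on the total sum of the signs. Weighting the columns by any sign
  vector thus turns a constant moment into an identity between the inner products of the rows with
  that vector. Two choices suffice: the all-one vector evaluates the constant, and a row brings in
  the two admissible inner products, together with the unknown number N of rows attaining the larger
  one. Odd moments come from even ones by multiplying with the constant row sum s, which is why s =
  0 is treated apart; there the two inner products are opposite, so that the even polynomial of the
  fourth moment does not see N. If s is nonzero, the first moment yields N. A priori q is just a
  real number, so its integrality precedes any divisibility argument. The standard sets for d = 6
  and d = 23 rest on designs picked by a choice operator, so their existence belongs to the proof:
  for d = 6 an explicit list is given, for d = 23 the system is read off from \<Omega>
  itself.\<close>

section \<open>Uniqueness of the Steiner system S(4,7,23)\<close>

text \<open>Points \<open>0\<close> and \<open>1\<close> are arbitrary; the others are points of the projective plane formed by the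
  blocks through both. There \<open>2, \<dots>, 6\<close> is a line, and \<open>7 + 4 i + j\<close> is the intersection of the
  \<open>i\<close>-th other line through \<open>2\<close> with the \<open>j\<close>-th other line through \<open>3\<close>. The first ten sets come
  from lines, the last two from hyperovals.\<close>

definition golay_generators :: "nat set set" where
  "golay_generators =
    {{0,1,2,7,8,9,10}, {0,1,2,11,12,13,14}, {0,1,2,15,16,17,18}, {0,1,2,3,4,5,6},
     {0,1,3,7,11,15,19}, {0,1,3,8,12,16,20}, {0,1,3,9,13,17,21},
     {0,1,7,12,17,22,4}, {0,1,7,13,18,20,5}, {0,1,7,14,16,21,6},
     {0,2,3,7,12,18,21}, {1,2,3,7,13,16,22}}"

text \<open>The second form reaches a repeated summand inside a right-nested sum, so that together
  with AC rewriting these rules settle linear identities over \<open>bit\<close>.\<close>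

lemma bit_add_cancel: "a + a = 0" "a + (a + b) = b" for a b :: bit
  by (simp_all only: add.assoc[symmetric] flip: mult_2) simp_all

text \<open>Gaussian elimination over the two-element field: the eleven places on the right-hand
  sides serve as parameters, and every solution is affine in them.\<close>

lemma golay_systematic:
  fixes c :: "nat \<Rightarrow> bit"
  assumes c: "\<forall>g \<in> golay_generators. sum c g = 1"
  shows "c 0 = c 13 + c 14 + c 16 + c 17 + c 20 + c 22 + 1"
    and "c 1 = c 12 + c 14 + c 17 + c 18 + c 20 + c 21 + 1"
    and "c 2 = c 12 + c 13 + c 16 + c 18 + c 19 + c 20 + 1"
    and "c 3 = c 10 + c 12 + c 13 + c 14 + c 16 + c 21 + 1"
    and "c 4 = c 10 + c 12 + c 18 + c 19 + c 21 + c 22 + 1"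
    and "c 5 = c 10 + c 13 + c 17 + c 19 + c 20 + c 21 + 1"
    and "c 6 = c 10 + c 14 + c 16 + c 17 + c 18 + c 19 + 1"
    and "c 7 = c 10 + c 12 + c 13 + c 16 + c 17 + c 19 + c 22"
    and "c 8 = c 10 + c 12 + c 14 + c 16 + c 18 + c 20 + c 22"
    and "c 9 = c 10 + c 13 + c 14 + c 17 + c 18 + c 21 + c 22"
    and "c 11 = c 12 + c 13 + c 14 + c 19 + c 20 + c 21 + c 22"
    and "c 15 = c 16 + c 17 + c 18 + c 19 + c 20 + c 21 + c 22"
proof -
  have gens: "c 0 + c 1 + c 2 + c 7 + c 8 + c 9 + c 10 = 1"
    "c 0 + c 1 + c 2 + c 11 + c 12 + c 13 + c 14 = 1"
    "c 0 + c 1 + c 2 + c 15 + c 16 + c 17 + c 18 = 1"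
    "c 0 + c 1 + c 2 + c 3 + c 4 + c 5 + c 6 = 1"
    "c 0 + c 1 + c 3 + c 7 + c 11 + c 15 + c 19 = 1"
    "c 0 + c 1 + c 3 + c 8 + c 12 + c 16 + c 20 = 1"
    "c 0 + c 1 + c 3 + c 9 + c 13 + c 17 + c 21 = 1"
    "c 0 + c 1 + c 7 + c 12 + c 17 + c 22 + c 4 = 1"
    "c 0 + c 1 + c 7 + c 13 + c 18 + c 20 + c 5 = 1"
    "c 0 + c 1 + c 7 + c 14 + c 16 + c 21 + c 6 = 1"
    "c 0 + c 2 + c 3 + c 7 + c 12 + c 18 + c 21 = 1"
    "c 1 + c 2 + c 3 + c 7 + c 13 + c 16 + c 22 = 1"
    using c by (simp_all add: golay_generators_def add.assoc del: add_bit_eq_xor)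
  \<comment> \<open>Each parenthesis but the last is the left-hand side of one equation of
    \<open>gens\<close>; the selection comes from elimination, and the last parenthesis cancels the
    parameters. The parity of the number of equations used is the constant term. The other eleven
    cases are alike.\<close>
  have "c 0 = (c 0 + c 1 + c 2 + c 3 + c 4 + c 5 + c 6) + (c 0 + c 1 + c 7 + c 12 + c 17
      + c 22 + c 4) + (c 0 + c 1 + c 7 + c 13 + c 18 + c 20 + c 5) + (c 0 + c 1 + c 7 + c 14
      + c 16 + c 21 + c 6) + (c 0 + c 2 + c 3 + c 7 + c 12 + c 18 + c 21) + (c 13 + c 14
      + c 16 + c 17 + c 20 + c 22)"
    by (simp only: ac_simps bit_add_cancel add_0_right add_0_left)
  also have "\<dots> = c 13 + c 14 + c 16 + c 17 + c 20 + c 22 + 1"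
    unfolding gens by (simp only: ac_simps bit_add_cancel add_0_right add_0_left)
  finally show "c 0 = c 13 + c 14 + c 16 + c 17 + c 20 + c 22 + 1" .
  have "c 1 = (c 0 + c 1 + c 2 + c 3 + c 4 + c 5 + c 6) + (c 0 + c 1 + c 7 + c 12 + c 17
      + c 22 + c 4) + (c 0 + c 1 + c 7 + c 13 + c 18 + c 20 + c 5) + (c 0 + c 1 + c 7 + c 14
      + c 16 + c 21 + c 6) + (c 1 + c 2 + c 3 + c 7 + c 13 + c 16 + c 22) + (c 12 + c 14
      + c 17 + c 18 + c 20 + c 21)"
    by (simp only: ac_simps bit_add_cancel add_0_right add_0_left)
  also have "\<dots> = c 12 + c 14 + c 17 + c 18 + c 20 + c 21 + 1"
    unfolding gens by (simp only: ac_simps bit_add_cancel add_0_right add_0_left)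
  finally show "c 1 = c 12 + c 14 + c 17 + c 18 + c 20 + c 21 + 1" .
  have "c 2 = (c 0 + c 1 + c 2 + c 11 + c 12 + c 13 + c 14) + (c 0 + c 1 + c 2 + c 15 + c 16
      + c 17 + c 18) + (c 0 + c 1 + c 2 + c 3 + c 4 + c 5 + c 6) + (c 0 + c 1 + c 3 + c 7
      + c 11 + c 15 + c 19) + (c 0 + c 1 + c 7 + c 12 + c 17 + c 22 + c 4) + (c 0 + c 1 + c 7
      + c 13 + c 18 + c 20 + c 5) + (c 0 + c 1 + c 7 + c 14 + c 16 + c 21 + c 6) + (c 0 + c 2
      + c 3 + c 7 + c 12 + c 18 + c 21) + (c 1 + c 2 + c 3 + c 7 + c 13 + c 16 + c 22)
      + (c 12 + c 13 + c 16 + c 18 + c 19 + c 20)"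
    by (simp only: ac_simps bit_add_cancel add_0_right add_0_left)
  also have "\<dots> = c 12 + c 13 + c 16 + c 18 + c 19 + c 20 + 1"
    unfolding gens by (simp only: ac_simps bit_add_cancel add_0_right add_0_left)
  finally show "c 2 = c 12 + c 13 + c 16 + c 18 + c 19 + c 20 + 1" .
  have "c 3 = (c 0 + c 1 + c 2 + c 7 + c 8 + c 9 + c 10) + (c 0 + c 1 + c 2 + c 3 + c 4 + c 5
      + c 6) + (c 0 + c 1 + c 3 + c 8 + c 12 + c 16 + c 20) + (c 0 + c 1 + c 3 + c 9 + c 13
      + c 17 + c 21) + (c 0 + c 1 + c 7 + c 12 + c 17 + c 22 + c 4) + (c 0 + c 1 + c 7 + c 13
      + c 18 + c 20 + c 5) + (c 0 + c 1 + c 7 + c 14 + c 16 + c 21 + c 6) + (c 0 + c 2 + c 3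
      + c 7 + c 12 + c 18 + c 21) + (c 1 + c 2 + c 3 + c 7 + c 13 + c 16 + c 22) + (c 10
      + c 12 + c 13 + c 14 + c 16 + c 21)"
    by (simp only: ac_simps bit_add_cancel add_0_right add_0_left)
  also have "\<dots> = c 10 + c 12 + c 13 + c 14 + c 16 + c 21 + 1"
    unfolding gens by (simp only: ac_simps bit_add_cancel add_0_right add_0_left)
  finally show "c 3 = c 10 + c 12 + c 13 + c 14 + c 16 + c 21 + 1" .
  have "c 4 = (c 0 + c 1 + c 2 + c 7 + c 8 + c 9 + c 10) + (c 0 + c 1 + c 2 + c 11 + c 12
      + c 13 + c 14) + (c 0 + c 1 + c 2 + c 15 + c 16 + c 17 + c 18) + (c 0 + c 1 + c 2 + c 3
      + c 4 + c 5 + c 6) + (c 0 + c 1 + c 3 + c 7 + c 11 + c 15 + c 19) + (c 0 + c 1 + c 3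
      + c 8 + c 12 + c 16 + c 20) + (c 0 + c 1 + c 3 + c 9 + c 13 + c 17 + c 21) + (c 0 + c 1
      + c 7 + c 13 + c 18 + c 20 + c 5) + (c 0 + c 1 + c 7 + c 14 + c 16 + c 21 + c 6) + (c 0
      + c 2 + c 3 + c 7 + c 12 + c 18 + c 21) + (c 1 + c 2 + c 3 + c 7 + c 13 + c 16 + c 22)
      + (c 10 + c 12 + c 18 + c 19 + c 21 + c 22)"
    by (simp only: ac_simps bit_add_cancel add_0_right add_0_left)
  also have "\<dots> = c 10 + c 12 + c 18 + c 19 + c 21 + c 22 + 1"
    unfolding gens by (simp only: ac_simps bit_add_cancel add_0_right add_0_left)
  finally show "c 4 = c 10 + c 12 + c 18 + c 19 + c 21 + c 22 + 1" .
  have "c 5 = (c 0 + c 1 + c 2 + c 7 + c 8 + c 9 + c 10) + (c 0 + c 1 + c 2 + c 11 + c 12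
      + c 13 + c 14) + (c 0 + c 1 + c 2 + c 15 + c 16 + c 17 + c 18) + (c 0 + c 1 + c 2 + c 3
      + c 4 + c 5 + c 6) + (c 0 + c 1 + c 3 + c 7 + c 11 + c 15 + c 19) + (c 0 + c 1 + c 3
      + c 8 + c 12 + c 16 + c 20) + (c 0 + c 1 + c 3 + c 9 + c 13 + c 17 + c 21) + (c 0 + c 1
      + c 7 + c 12 + c 17 + c 22 + c 4) + (c 0 + c 1 + c 7 + c 14 + c 16 + c 21 + c 6) + (c 0
      + c 2 + c 3 + c 7 + c 12 + c 18 + c 21) + (c 1 + c 2 + c 3 + c 7 + c 13 + c 16 + c 22)
      + (c 10 + c 13 + c 17 + c 19 + c 20 + c 21)"
    by (simp only: ac_simps bit_add_cancel add_0_right add_0_left)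
  also have "\<dots> = c 10 + c 13 + c 17 + c 19 + c 20 + c 21 + 1"
    unfolding gens by (simp only: ac_simps bit_add_cancel add_0_right add_0_left)
  finally show "c 5 = c 10 + c 13 + c 17 + c 19 + c 20 + c 21 + 1" .
  have "c 6 = (c 0 + c 1 + c 2 + c 7 + c 8 + c 9 + c 10) + (c 0 + c 1 + c 2 + c 11 + c 12
      + c 13 + c 14) + (c 0 + c 1 + c 2 + c 15 + c 16 + c 17 + c 18) + (c 0 + c 1 + c 2 + c 3
      + c 4 + c 5 + c 6) + (c 0 + c 1 + c 3 + c 7 + c 11 + c 15 + c 19) + (c 0 + c 1 + c 3
      + c 8 + c 12 + c 16 + c 20) + (c 0 + c 1 + c 3 + c 9 + c 13 + c 17 + c 21) + (c 0 + c 1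
      + c 7 + c 12 + c 17 + c 22 + c 4) + (c 0 + c 1 + c 7 + c 13 + c 18 + c 20 + c 5) + (c 0
      + c 2 + c 3 + c 7 + c 12 + c 18 + c 21) + (c 1 + c 2 + c 3 + c 7 + c 13 + c 16 + c 22)
      + (c 10 + c 14 + c 16 + c 17 + c 18 + c 19)"
    by (simp only: ac_simps bit_add_cancel add_0_right add_0_left)
  also have "\<dots> = c 10 + c 14 + c 16 + c 17 + c 18 + c 19 + 1"
    unfolding gens by (simp only: ac_simps bit_add_cancel add_0_right add_0_left)
  finally show "c 6 = c 10 + c 14 + c 16 + c 17 + c 18 + c 19 + 1" .
  have "c 7 = (c 0 + c 1 + c 2 + c 7 + c 8 + c 9 + c 10) + (c 0 + c 1 + c 2 + c 11 + c 12
      + c 13 + c 14) + (c 0 + c 1 + c 2 + c 15 + c 16 + c 17 + c 18) + (c 0 + c 1 + c 2 + c 3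
      + c 4 + c 5 + c 6) + (c 0 + c 1 + c 3 + c 7 + c 11 + c 15 + c 19) + (c 0 + c 1 + c 3
      + c 8 + c 12 + c 16 + c 20) + (c 0 + c 1 + c 3 + c 9 + c 13 + c 17 + c 21) + (c 0 + c 1
      + c 7 + c 12 + c 17 + c 22 + c 4) + (c 0 + c 1 + c 7 + c 13 + c 18 + c 20 + c 5) + (c 0
      + c 1 + c 7 + c 14 + c 16 + c 21 + c 6) + (c 10 + c 12 + c 13 + c 16 + c 17 + c 19
      + c 22)"
    by (simp only: ac_simps bit_add_cancel add_0_right add_0_left)
  also have "\<dots> = c 10 + c 12 + c 13 + c 16 + c 17 + c 19 + c 22"
    unfolding gens by (simp only: ac_simps bit_add_cancel add_0_right add_0_left)
  finally show "c 7 = c 10 + c 12 + c 13 + c 16 + c 17 + c 19 + c 22" .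
  have "c 8 = (c 0 + c 1 + c 2 + c 7 + c 8 + c 9 + c 10) + (c 0 + c 1 + c 2 + c 3 + c 4 + c 5
      + c 6) + (c 0 + c 1 + c 3 + c 9 + c 13 + c 17 + c 21) + (c 0 + c 1 + c 7 + c 12 + c 17
      + c 22 + c 4) + (c 0 + c 1 + c 7 + c 13 + c 18 + c 20 + c 5) + (c 0 + c 1 + c 7 + c 14
      + c 16 + c 21 + c 6) + (c 10 + c 12 + c 14 + c 16 + c 18 + c 20 + c 22)"
    by (simp only: ac_simps bit_add_cancel add_0_right add_0_left)
  also have "\<dots> = c 10 + c 12 + c 14 + c 16 + c 18 + c 20 + c 22"
    unfolding gens by (simp only: ac_simps bit_add_cancel add_0_right add_0_left)
  finally show "c 8 = c 10 + c 12 + c 14 + c 16 + c 18 + c 20 + c 22" .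
  have "c 9 = (c 0 + c 1 + c 2 + c 7 + c 8 + c 9 + c 10) + (c 0 + c 1 + c 2 + c 3 + c 4 + c 5
      + c 6) + (c 0 + c 1 + c 3 + c 8 + c 12 + c 16 + c 20) + (c 0 + c 1 + c 7 + c 12 + c 17
      + c 22 + c 4) + (c 0 + c 1 + c 7 + c 13 + c 18 + c 20 + c 5) + (c 0 + c 1 + c 7 + c 14
      + c 16 + c 21 + c 6) + (c 10 + c 13 + c 14 + c 17 + c 18 + c 21 + c 22)"
    by (simp only: ac_simps bit_add_cancel add_0_right add_0_left)
  also have "\<dots> = c 10 + c 13 + c 14 + c 17 + c 18 + c 21 + c 22"
    unfolding gens by (simp only: ac_simps bit_add_cancel add_0_right add_0_left)
  finally show "c 9 = c 10 + c 13 + c 14 + c 17 + c 18 + c 21 + c 22" .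
  have "c 11 = (c 0 + c 1 + c 2 + c 15 + c 16 + c 17 + c 18) + (c 0 + c 1 + c 2 + c 3 + c 4
      + c 5 + c 6) + (c 0 + c 1 + c 3 + c 7 + c 11 + c 15 + c 19) + (c 0 + c 1 + c 7 + c 12
      + c 17 + c 22 + c 4) + (c 0 + c 1 + c 7 + c 13 + c 18 + c 20 + c 5) + (c 0 + c 1 + c 7
      + c 14 + c 16 + c 21 + c 6) + (c 12 + c 13 + c 14 + c 19 + c 20 + c 21 + c 22)"
    by (simp only: ac_simps bit_add_cancel add_0_right add_0_left)
  also have "\<dots> = c 12 + c 13 + c 14 + c 19 + c 20 + c 21 + c 22"
    unfolding gens by (simp only: ac_simps bit_add_cancel add_0_right add_0_left)
  finally show "c 11 = c 12 + c 13 + c 14 + c 19 + c 20 + c 21 + c 22" .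
  have "c 15 = (c 0 + c 1 + c 2 + c 11 + c 12 + c 13 + c 14) + (c 0 + c 1 + c 2 + c 3 + c 4
      + c 5 + c 6) + (c 0 + c 1 + c 3 + c 7 + c 11 + c 15 + c 19) + (c 0 + c 1 + c 7 + c 12
      + c 17 + c 22 + c 4) + (c 0 + c 1 + c 7 + c 13 + c 18 + c 20 + c 5) + (c 0 + c 1 + c 7
      + c 14 + c 16 + c 21 + c 6) + (c 16 + c 17 + c 18 + c 19 + c 20 + c 21 + c 22)"
    by (simp only: ac_simps bit_add_cancel add_0_right add_0_left)
  also have "\<dots> = c 16 + c 17 + c 18 + c 19 + c 20 + c 21 + c 22"
    unfolding gens by (simp only: ac_simps bit_add_cancel add_0_right add_0_left)
  finally show "c 15 = c 16 + c 17 + c 18 + c 19 + c 20 + c 21 + c 22" .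
qed

text \<open>Append a coordinate 1 to \<open>c\<close>, to \<open>d\<close> and to every generator.
  The hypotheses then say that the two long vectors are orthogonal to generators of the extended
  Golay code, hence lie in that self-dual code, hence are orthogonal to each other; the appended
  coordinates contribute the 1.\<close>

lemma golay_self_dual:
  fixes c d :: "nat \<Rightarrow> bit"
  assumes c: "\<forall>g \<in> golay_generators. sum c g = 1"
    and d: "\<forall>g \<in> golay_generators. sum d g = 1"
  shows "(\<Sum>i<23. c i * d i) = 1"
proof -
  have "(\<Sum>i<23. c i * d i) = c 0 * d 0 + c 1 * d 1 + c 2 * d 2 + c 3 * d 3 + c 4 * d 4
      + c 5 * d 5 + c 6 * d 6 + c 7 * d 7 + c 8 * d 8 + c 9 * d 9 + c 10 * d 10 + c 11 * d 11
      + c 12 * d 12 + c 13 * d 13 + c 14 * d 14 + c 15 * d 15 + c 16 * d 16 + c 17 * d 17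
      + c 18 * d 18 + c 19 * d 19 + c 20 * d 20 + c 21 * d 21 + c 22 * d 22"
    by (simp add: lessThan_nat_numeral ac_simps del: add_bit_eq_xor mult_bit_eq_and)
  also have "\<dots> = 1"
    \<comment> \<open>After substitution this is a polynomial identity in the parameters of
      \<open>c\<close> and \<open>d\<close>, in which all monomials but the constant occur an even
      number of times.\<close>
    unfolding golay_systematic[OF c] golay_systematic[OF d]
    by (simp only: distrib_left distrib_right mult_1_left mult_1_right ac_simps bit_add_cancel add_0_right add_0_left)
  finally show ?thesis .
qed

section \<open>Blocks, lines and hyperovals in a system S(4,7,23)\<close>

locale steiner23 =
  fixes P :: "'p set" and \<B> :: "'p set set"
  assumes design: "quasi_symmetric_design 4 23 7 1 3 1 P \<B>"
begin

lemma finite_points: "finite P" and card_points: "card P = 23"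
  using design by (auto simp: quasi_symmetric_design_def)

lemma block_subset: "B \<in> \<B> \<Longrightarrow> B \<subseteq> P" and card_block: "B \<in> \<B> \<Longrightarrow> card B = 7"
  using design by (auto simp: quasi_symmetric_design_def)

lemma finite_block: "B \<in> \<B> \<Longrightarrow> finite B"
  using card_block by (metis card.infinite zero_neq_numeral)

lemma card_Int_blocks:
  assumes "B \<in> \<B>" "B' \<in> \<B>" "B \<noteq> B'"
  shows "card (B \<inter> B') = 1 \<or> card (B \<inter> B') = 3"
proof -
  have "card (B \<inter> B') \<in> {card (B \<inter> B') | B B'. B \<in> \<B> \<and> B' \<in> \<B> \<and> B \<noteq> B'}"
    using assms by blast
  also have "\<dots> = {3, 1}"
    using design by (simp add: quasi_symmetric_design_def)
  finally show ?thesis by auto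
qed

lemma odd_Int_blocks: "B \<in> \<B> \<Longrightarrow> B' \<in> \<B> \<Longrightarrow> odd (card (B \<inter> B'))"
  using card_Int_blocks[of B B'] by (cases "B = B'") (auto simp: card_block)

lemma block_through:
  assumes "{a, b, c, e} \<subseteq> P" "distinct [a, b, c, e]"
  obtains B where "B \<in> \<B>" "{a, b, c, e} \<subseteq> B"
proof -
  have "card {a, b, c, e} = 4" using assms(2) by simp
  then have "card {B \<in> \<B>. {a, b, c, e} \<subseteq> B} = 1"
    using design assms(1) unfolding quasi_symmetric_design_def by blast
  then show ?thesis using that
    by (metis (no_types, lifting) One_nat_def card_1_singletonE insertI1 mem_Collect_eq)
qed

lemma card_Int_le: "B \<in> \<B> \<Longrightarrow> B' \<in> \<B> \<Longrightarrow> B \<noteq> B' \<Longrightarrow> card (B \<inter> B') \<le> 3"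
  using card_Int_blocks[of B B'] by auto

lemma block_eqI:
  assumes "B \<in> \<B>" "B' \<in> \<B>" "{a, b, c, e} \<subseteq> B \<inter> B'" "distinct [a, b, c, e]"
  shows "B = B'"
proof (rule ccontr)
  assume "B \<noteq> B'"
  then have "card (B \<inter> B') \<le> 3" using card_Int_le assms by blast
  moreover have "card {a, b, c, e} \<le> card (B \<inter> B')"
    by (rule card_mono) (use assms finite_block in auto)
  ultimately show False using assms(4) by simp
qed

text \<open>Otherwise every block through four points of \<open>X\<close> would meet \<open>X\<close> in exactly five points,
  so that the triples completing a fixed pair would form a Steiner triple system on five points.\<close>

lemma block_if_odd:
  assumes X: "X \<subseteq> P" "card X = 7" and odd: "\<And>B. B \<in> \<B> \<Longrightarrow> odd (card (X \<inter> B))"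
  shows "X \<in> \<B>"
proof (rule ccontr)
  assume "X \<notin> \<B>"
  have finX: "finite X" using X by (metis card.infinite zero_neq_numeral)
  \<comment> \<open>The size is odd and between four and seven, and seven would make
    \<open>X\<close> itself a block.\<close>
  have five: "card (X \<inter> B) = 5" if "B \<in> \<B>" "{a, b, c, e} \<subseteq> X \<inter> B" "distinct [a, b, c, e]"
    for B a b c e
  proof -
    have "card {a, b, c, e} \<le> card (X \<inter> B)"
      by (rule card_mono) (use that finX in auto)
    moreover have "card (X \<inter> B) \<le> 7"
      using card_mono[of X "X \<inter> B"] finX X by auto
    moreover have "card (X \<inter> B) \<noteq> 7"
    proof
      assume "card (X \<inter> B) = 7"
      then have "X \<inter> B = X" "X \<inter> B = B"
        using card_subset_eq[OF finX, of "X \<inter> B"] card_subset_eq[OF finite_block[OF that(1)], of "X \<inter> B"]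
          X card_block[OF that(1)] by auto
      then show False using \<open>X \<notin> \<B>\<close> that(1) by simp
    qed
    moreover have "card (X \<inter> B) \<noteq> 4" "card (X \<inter> B) \<noteq> 6"
      using odd[OF that(1)] by auto
    ultimately show ?thesis using that(3) by simp
  qed
  have fifth: "\<exists>f. f \<notin> {a, b, c, e} \<and> X \<inter> B = {a, b, c, e, f}"
    if B: "B \<in> \<B>" "{a, b, c, e} \<subseteq> X \<inter> B" "distinct [a, b, c, e]" for B a b c e
  proof -
    have "card (X \<inter> B - {a, b, c, e}) = 1"
      using five[OF B] card_Diff_subset[of "{a, b, c, e}" "X \<inter> B"] B(2,3) by simp
    then obtain f where "X \<inter> B - {a, b, c, e} = {f}" by (auto simp: card_1_singleton_iff)
    then show ?thesis using B(2) by (intro exI[of _ f]) auto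
  qed
  obtain a b c d where abcd: "{a, b, c, d} \<subseteq> X" "distinct [a, b, c, d]"
  proof -
    obtain T where "T \<subseteq> X" "card T = 4"
      by (rule obtain_subset_with_card_n[of 4 X]) (simp add: X)
    then obtain xs where "set xs = T" "distinct xs" "length xs = 4"
      using finite_distinct_list[of T] distinct_card by (metis card.infinite zero_neq_numeral)
    then show ?thesis using that \<open>T \<subseteq> X\<close>
      by (auto simp: numeral_eq_Suc length_Suc_conv)
  qed
  obtain B1 where B1: "B1 \<in> \<B>" "{a, b, c, d} \<subseteq> B1"
    using block_through[of a b c d] abcd X by blast
  obtain e where e: "e \<notin> {a, b, c, d}" "X \<inter> B1 = {a, b, c, d, e}"
    using fifth[OF B1(1), of a b c d] B1 abcd by auto
  have "\<not> X \<subseteq> {a, b, c, d, e}"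
  proof
    assume "X \<subseteq> {a, b, c, d, e}"
    then have "card X \<le> card {a, b, c, d, e}" by (rule card_mono[rotated]) simp
    also have "\<dots> \<le> 5" by (simp add: card_insert_if)
    finally show False using X by simp
  qed
  then obtain f where f: "f \<in> X" "f \<notin> {a, b, c, d, e}" by blast
  then have fB1: "f \<notin> B1" using e by blast
  obtain B2 where B2: "B2 \<in> \<B>" "{a, b, c, f} \<subseteq> B2"
    using block_through[of a b c f] abcd f X by auto
  obtain g where g: "g \<notin> {a, b, c, f}" "X \<inter> B2 = {a, b, c, f, g}"
    using fifth[OF B2(1), of a b c f] B2 abcd f by auto
  have "B2 \<noteq> B1" using fB1 B2 by blast
  have dB2: "d \<notin> B2" using block_eqI[OF B1(1) B2(1), of a b c d] B1 B2 abcd \<open>B2 \<noteq> B1\<close> by auto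
  have eB2: "e \<notin> B2" using block_eqI[OF B1(1) B2(1), of a b c e] B1 B2 abcd \<open>B2 \<noteq> B1\<close> e by auto
  have gB1: "g \<notin> B1" using e g dB2 eB2 by blast
  have Xeq: "X = {a, b, c, d, e, f, g}"
  proof (rule card_subset_eq[OF finX, symmetric])
    show "{a, b, c, d, e, f, g} \<subseteq> X" using abcd e f g by blast
    have "distinct [a, b, c, d, e, f, g]" using abcd e f g dB2 eB2 gB1 B1 B2 by auto
    then show "card {a, b, c, d, e, f, g} = card X"
      using X distinct_card[of "[a, b, c, d, e, f, g]"] by simp
  qed
  \<comment> \<open>The fifth point of \<open>B3\<close> in \<open>X\<close> is one of
    \<open>c\<close>, \<open>e\<close>, \<open>g\<close>. The first two would give four points in
    common with \<open>B1\<close>, the third four in common with \<open>B2\<close>.\<close>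
  obtain B3 where B3: "B3 \<in> \<B>" "{a, b, d, f} \<subseteq> B3"
    using block_through[of a b d f] abcd f X by auto
  obtain h where h: "h \<notin> {a, b, d, f}" "X \<inter> B3 = {a, b, d, f, h}"
    using fifth[OF B3(1), of a b d f] B3 abcd f by auto
  have ne: "B3 \<noteq> B1" "B3 \<noteq> B2" using fB1 dB2 B3 by auto
  have "h \<in> {c, e, g}" using h Xeq by blast
  moreover have "h \<in> B3" using h by blast
  moreover have "c \<notin> B3" using block_eqI[OF B1(1) B3(1), of a b c d] B1 B3 abcd ne by auto
  moreover have "e \<notin> B3" using block_eqI[OF B1(1) B3(1), of a b d e] B1 B3 abcd ne e by auto
  moreover have "g \<notin> B3" using block_eqI[OF B2(1) B3(1), of a b f g] B2 B3 abcd ne g f by auto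
  ultimately show False by blast
qed

text \<open>The blocks through two points form a projective plane of order four, in which the remaining
  points of a block through only one of the two points form a hyperoval.\<close>

definition "lines a b = {L. a \<notin> L \<and> b \<notin> L \<and> {a, b} \<union> L \<in> \<B>}"

context
  fixes a b
  assumes ab: "a \<in> P" "b \<in> P" "a \<noteq> b"
begin

lemma line_subset: "L \<in> lines a b \<Longrightarrow> L \<subseteq> P - {a, b}"
  using block_subset by (auto simp: lines_def)

lemma finite_line: "L \<in> lines a b \<Longrightarrow> finite L"
  using finite_subset[OF line_subset] finite_points by auto

lemma card_line: "L \<in> lines a b \<Longrightarrow> card L = 5"
  using card_block[of "{a, b} \<union> L"] finite_line[of L] ab by (simp add: lines_def)

lemma line_through:
  assumes "x \<in> P - {a, b}" "y \<in> P - {a, b}" "x \<noteq> y"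
  obtains L where "L \<in> lines a b" "x \<in> L" "y \<in> L"
proof -
  obtain B where B: "B \<in> \<B>" "{a, b, x, y} \<subseteq> B"
    using block_through[of a b x y] assms ab by auto
  then have eq: "{a, b} \<union> (B - {a, b}) = B" by blast
  have "B - {a, b} \<in> lines a b"
    unfolding lines_def using B(1) by (simp only: mem_Collect_eq eq) simp
  then show ?thesis using that B assms by blast
qed

lemma line_inject:
  assumes "L \<in> lines a b" "M \<in> lines a b" "{a, b} \<union> L = {a, b} \<union> M"
  shows "L = M"
proof -
  have "L = ({a, b} \<union> L) - {a, b}" "M = ({a, b} \<union> M) - {a, b}"
    using assms(1,2) by (auto simp: lines_def)
  then show ?thesis using assms(3) by metis
qed

lemma line_eqI:
  assumes "L \<in> lines a b" "M \<in> lines a b" "x \<in> L" "x \<in> M" "y \<in> L" "y \<in> M" "x \<noteq> y"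
  shows "L = M"
proof -
  have "{a, b} \<union> L = {a, b} \<union> M"
    by (rule block_eqI[of _ _ a b x y]) (use assms ab in \<open>auto simp: lines_def\<close>)
  then show ?thesis using assms(1,2) line_inject by blast
qed

text \<open>The two blocks already share \<open>a\<close> and \<open>b\<close>, and an intersection
  of size two is impossible, so there is a third common point.\<close>

lemma lines_meet:
  assumes L: "L \<in> lines a b" and M: "M \<in> lines a b" and "L \<noteq> M"
  obtains x where "x \<in> L" "x \<in> M"
proof -
  let ?L = "{a, b} \<union> L" and ?M = "{a, b} \<union> M"
  have ne: "?L \<noteq> ?M" using assms line_inject by blast
  have "card {a, b} \<le> card (?L \<inter> ?M)"
    by (rule card_mono) (use finite_line L in auto)
  then have "card (?L \<inter> ?M) = 3"
    using card_Int_blocks[of ?L ?M] ne L M ab by (auto simp: lines_def)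
  then have "\<not> ?L \<inter> ?M \<subseteq> {a, b}" using card_mono[of "{a, b}" "?L \<inter> ?M"] by (auto simp: ab)
  then show ?thesis using that by blast
qed

text \<open>The blocks \<open>B\<close> and \<open>{a, b} \<union> L\<close> share \<open>a\<close>
  but not \<open>b\<close>. Since they meet in one or three points, \<open>B\<close> meets
  \<open>L\<close> in none or two.\<close>

lemma hyperoval_meet:
  assumes "B \<in> \<B>" "a \<in> B" "b \<notin> B" "L \<in> lines a b" "x \<in> B" "x \<in> L"
  shows "\<exists>y. y \<noteq> x \<and> B \<inter> L = {x, y}"
proof -
  let ?L = "{a, b} \<union> L"
  have L: "?L \<in> \<B>" "a \<notin> L" "b \<notin> L" using assms by (auto simp: lines_def)
  have eq: "B \<inter> ?L = insert a (B \<inter> L)" using assms by blast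
  have "card (B \<inter> ?L) = Suc (card (B \<inter> L))"
    using eq L finite_line assms by simp
  moreover have "card (B \<inter> ?L) = 1 \<or> card (B \<inter> ?L) = 3"
    using card_Int_blocks[OF assms(1) L(1)] assms(3) by blast
  moreover have "card (B \<inter> L) \<noteq> 0" using assms finite_line by auto
  ultimately have "card (B \<inter> L) = 2" by auto
  then obtain u v where "B \<inter> L = {u, v}" "u \<noteq> v" by (auto simp: card_2_iff)
  then show ?thesis using assms(5,6) by (metis IntI insertE insert_commute singletonD)
qed

end

lemma lines_commute: "lines a b = lines b a"
  by (auto simp: lines_def insert_commute)

text \<open>\<open>M\<close> plays the line at infinity, and the lines \<open>A i\<close> through
  \<open>r\<close> and \<open>D j\<close> through \<open>c\<close> cut out a grid of sixteen points.
  The free choices are spent so that all incidences of the lines \<open>E k\<close> through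
  \<open>z\<close> and of two hyperovals with the grid are forced: the hyperovals label the points
  of the row \<open>A 1\<close>, and the rows \<open>A 2\<close>, \<open>A 3\<close> are ordered so
  that \<open>E 1\<close> is the diagonal.\<close>

lemma golay_coordinates: "\<exists>f. bij_betw f {..<23} P \<and> (\<forall>g \<in> golay_generators. f ` g \<in> \<B>)"
proof -
  note One_nat_def [simp del]
  obtain a b z r where abzr: "distinct [a, b, z, r]" "{a, b, z, r} \<subseteq> P"
  proof -
    obtain T where "T \<subseteq> P" "card T = 4"
      by (rule obtain_subset_with_card_n[of 4 P]) (simp add: card_points)
    then obtain xs where "set xs = T" "distinct xs" "length xs = 4"
      using finite_distinct_list[of T] distinct_card by (metis card.infinite zero_neq_numeral)
    then show ?thesis using that \<open>T \<subseteq> P\<close>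
      by (auto simp: numeral_eq_Suc length_Suc_conv)
  qed
  have ab: "a \<in> P" "b \<in> P" "a \<noteq> b" and ba: "b \<noteq> a" using abzr by auto
  note line = line_through[OF ab] and meet = lines_meet[OF ab] and eq = line_eqI[OF ab]
  have fin: "finite L" and card5: "card L = 5" and sub: "L \<subseteq> P" and nab: "a \<notin> L" "b \<notin> L"
    and blk: "insert a (insert b L) \<in> \<B>" if "L \<in> lines a b" for L
    using that finite_line[OF ab] card_line[OF ab] line_subset[OF ab] by (auto simp: lines_def)
  have list: "L = set xs" if "L \<in> lines a b" "set xs \<subseteq> L" "distinct xs" "length xs = 5" for L xs
    using card_subset_eq[OF fin[OF that(1)] that(2)] card5[OF that(1)] distinct_card that by metis
  have blist: "B = set xs" if "B \<in> \<B>" "set xs \<subseteq> B" "distinct xs" "length xs = 7" for B xs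
    using card_subset_eq[OF finite_block[OF that(1)] that(2)] card_block[OF that(1)]
      distinct_card that by metis
  obtain A0 where A0: "A0 \<in> lines a b" "z \<in> A0" "r \<in> A0" using line[of z r] abzr by auto
  obtain c where c: "c \<in> P" "c \<notin> A0" "c \<noteq> a" "c \<noteq> b"
  proof -
    have "card ({a, b} \<union> A0) < card P"
      using card_block[of "{a, b} \<union> A0"] blk[OF A0(1)] card_points by simp
    then have "\<not> P \<subseteq> {a, b} \<union> A0" using card_mono[of "{a, b} \<union> A0" P] fin[OF A0(1)] by auto
    then show ?thesis using that by blast
  qed
  have zr: "z \<noteq> r" and cz: "c \<noteq> z" and cr: "c \<noteq> r" using abzr c A0 by auto
  obtain D0 where D0: "D0 \<in> lines a b" "z \<in> D0" "c \<in> D0" using line[of z c] abzr c cz by auto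
  obtain M where M: "M \<in> lines a b" "r \<in> M" "c \<in> M" using line[of r c] abzr c cr by auto
  have rD0: "r \<notin> D0" using eq[OF A0(1) D0(1)] A0 D0 c zr by blast
  have zM: "z \<notin> M" using eq[OF A0(1) M(1)] A0 M c zr by blast
  obtain q where q: "q \<in> D0" "q \<noteq> z" "q \<noteq> c"
  proof -
    have "\<not> D0 \<subseteq> {z, c}" using card_mono[of "{z, c}" D0] card5[OF D0(1)] by (auto simp: card_insert_if split: if_splits)
    then show ?thesis using that by blast
  qed
  have qr: "q \<noteq> r" using q rD0 by blast
  obtain A1 where A1: "A1 \<in> lines a b" "r \<in> A1" "q \<in> A1"
    using line[of r q] abzr q qr sub[OF D0(1)] nab[OF D0(1)] by auto
  have zA1: "z \<notin> A1" using eq[OF A1(1) A0(1)] eq[OF A0(1) D0(1)] A0 A1 D0 q zr c by metis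
  have cA1: "c \<notin> A1" using eq[OF A1(1) D0(1)] A1 D0 q rD0 by blast
  \<comment> \<open>Two hyperovals through the triangle \<open>z\<close>, \<open>r\<close>,
    \<open>c\<close>, one from a block through \<open>a\<close> and one from a block through
    \<open>b\<close>. They share just these three points, so they single out different points
    \<open>s\<close> and \<open>t\<close> of \<open>A1\<close>.\<close>
  obtain Q where Q: "Q \<in> \<B>" "{a, z, r, c} \<subseteq> Q"
    using block_through[of a z r c] abzr c cz cr by auto
  obtain Q' where Q': "Q' \<in> \<B>" "{b, z, r, c} \<subseteq> Q'"
    using block_through[of b z r c] abzr c cz cr by auto
  have bQ: "b \<notin> Q"
    using block_eqI[OF Q(1) blk[OF A0(1)], of a b z r] Q A0 c abzr by auto
  have aQ': "a \<notin> Q'"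
    using block_eqI[OF Q'(1) blk[OF A0(1)], of a b z r] Q' A0 c abzr by auto
  have QQ': "x \<in> {z, r, c}" if "x \<in> Q" "x \<in> Q'" for x
    using block_eqI[OF Q(1) Q'(1), of z r c x] that Q Q' bQ zr cz cr by auto
  have Qmeet: "\<exists>y. y \<noteq> x \<and> Q \<inter> L = {x, y}" if "L \<in> lines a b" "x \<in> Q" "x \<in> L" for L x
    using hyperoval_meet[OF ab] Q bQ that by blast
  have Q'meet: "\<exists>y. y \<noteq> x \<and> Q' \<inter> L = {x, y}" if "L \<in> lines a b" "x \<in> Q'" "x \<in> L" for L x
    using hyperoval_meet[OF ab(2,1) ba] Q' aQ' that lines_commute[of a b] by blast
  have Q2: "w \<notin> Q" if "L \<in> lines a b" "x \<in> L" "y \<in> L" "w \<in> L" "x \<in> Q" "y \<in> Q" "distinct [x, y, w]" for L x y w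
    using Qmeet[OF that(1), of x] that
    by (metis IntI distinct_length_2_or_more empty_iff insert_iff)
  have Q'2: "w \<notin> Q'" if "L \<in> lines a b" "x \<in> L" "y \<in> L" "w \<in> L" "x \<in> Q'" "y \<in> Q'" "distinct [x, y, w]" for L x y w
    using Q'meet[OF that(1), of x] that
    by (metis IntI distinct_length_2_or_more empty_iff insert_iff)
  obtain s where s: "s \<in> Q" "s \<in> A1" "s \<noteq> r" using Qmeet[OF A1(1), of r] A1 Q by blast
  obtain t where t: "t \<in> Q'" "t \<in> A1" "t \<noteq> r" using Q'meet[OF A1(1), of r] A1 Q' by blast
  have st: "s \<noteq> t" using QQ'[of s] s t zA1 cA1 by blast
  have qQ: "q \<notin> Q" using Q2[OF D0(1), of z c q] D0 q Q cz by auto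
  have qQ': "q \<notin> Q'" using Q'2[OF D0(1), of z c q] D0 q Q' cz by auto
  have sq: "s \<noteq> q" "t \<noteq> q" using qQ qQ' s t by auto
  obtain u where u: "u \<in> A1" "u \<notin> {r, q, s, t}"
  proof -
    have "\<not> A1 \<subseteq> {r, q, s, t}"
      using card_mono[of "{r, q, s, t}" A1] card5[OF A1(1)] by (auto simp: card_insert_if split: if_splits)
    then show ?thesis using that by blast
  qed
  have inP: "x \<in> P - {a, b}" if "x \<in> A1" for x using that sub[OF A1(1)] nab[OF A1(1)] by auto
  have cP: "c \<in> P - {a, b}" and zP: "z \<in> P - {a, b}" and rP: "r \<in> P - {a, b}" using c abzr by auto
  have cx: "c \<noteq> x" "z \<noteq> x" if "x \<in> A1" for x using that cA1 zA1 by auto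
  define y where "y = (\<lambda>i. [q, s, t, u] ! i)"
  have y_simps: "y 0 = q" "y 1 = s" "y 2 = t" "y 3 = u" by (simp_all add: y_def)
  have less4: "i < 4 \<longleftrightarrow> i = 0 \<or> i = 1 \<or> i = 2 \<or> i = 3" for i :: nat by auto
  have yA1: "y i \<in> A1" if "i < 4" for i using that s t u A1 unfolding less4 by (auto simp: y_simps)
  have yr: "y i \<noteq> r" if "i < 4" for i using that s t u qr unfolding less4 by (auto simp: y_simps)
  have y_inj: "y i = y j \<Longrightarrow> i = j" if "i < 4" "j < 4" for i j
    using that s t u sq st unfolding less4 by (auto simp: y_simps)
  have "\<exists>L. L \<in> lines a b \<and> c \<in> L \<and> y i \<in> L" if "i < 4" for i
    using line[OF cP inP cx(1)] yA1[OF that] by metis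
  then obtain D where D: "D i \<in> lines a b" "c \<in> D i" "y i \<in> D i" if "i < 4" for i by metis
  have rD: "r \<notin> D i" if "i < 4" for i using eq[OF D(1)[OF that] A1(1)] D[OF that] A1 yA1[OF that] yr[OF that] cA1 by blast
  have D_inj: "D i = D j \<Longrightarrow> i = j" if "i < 4" "j < 4" for i j
    using eq[OF D(1)[OF that(1)] A1(1), of "y i" "y j"] D[OF that(1)] D[OF that(2)] yA1 y_inj that cA1 by metis
  have DD0: "D 0 = D0" using eq[OF D(1) D0(1), of 0 c q] D[of 0] D0 q y_simps by simp
  have "\<exists>L. L \<in> lines a b \<and> z \<in> L \<and> y i \<in> L" if "i < 4" for i
    using line[OF zP inP cx(2)] yA1[OF that] by metis
  then obtain E where E: "E i \<in> lines a b" "z \<in> E i" "y i \<in> E i" if "i < 4" for i by metis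
  have rE: "r \<notin> E i" if "i < 4" for i
    using eq[OF E(1)[OF that] A1(1), of r "y i"] E[OF that] A1 yA1[OF that] yr[OF that] zA1 by metis
  have E_inj: "E i = E j \<Longrightarrow> i = j" if "i < 4" "j < 4" for i j
    using eq[OF E(1)[OF that(1)] A1(1), of "y i" "y j"] E[OF that(1)] E[OF that(2)] yA1 y_inj that zA1 by metis
  have EE0: "E 0 = D0" using eq[OF E(1) D0(1), of 0 z q] E[of 0] D0 q y_simps by auto
  have cE: "c \<notin> E i" if "i < 4" "i \<noteq> 0" for i
    using eq[OF E(1)[OF that(1)] D0(1), of z c] E[OF that(1)] D0 cz EE0 E_inj[of i 0] that by auto
  \<comment> \<open>The rows \<open>A2\<close> and \<open>A3\<close> are defined through points of
    \<open>E 1\<close> in columns 2 and 3, which puts \<open>E 1\<close> on the diagonal of the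
    grid.\<close>
  have E2D2: "E 1 \<noteq> D 2" "E 1 \<noteq> D 3" using D[of 2] D[of 3] cE[of 1] by auto
  obtain x22 where x22: "x22 \<in> E 1" "x22 \<in> D 2" using meet[OF E(1) D(1) E2D2(1)] by auto
  obtain x33 where x33: "x33 \<in> E 1" "x33 \<in> D 3" using meet[OF E(1) D(1) E2D2(2)] by auto
  have xr: "r \<noteq> x22" "r \<noteq> x33" using x22 x33 rE[of 1] by auto
  have xP: "x22 \<in> P - {a, b}" "x33 \<in> P - {a, b}"
    using x22 x33 sub[OF E(1)[of 1]] nab[OF E(1)[of 1]] by auto
  obtain A2 where A2: "A2 \<in> lines a b" "r \<in> A2" "x22 \<in> A2" using line[OF rP xP(1) xr(1)] by metis
  obtain A3 where A3: "A3 \<in> lines a b" "r \<in> A3" "x33 \<in> A3" using line[OF rP xP(2) xr(2)] by metis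
  have xc: "x22 \<noteq> c" "x33 \<noteq> c" using x22 x33 cE[of 1] by auto
  have cA: "c \<notin> A2" "c \<notin> A3"
    using eq[OF A2(1) D(1)[of 2], of c x22] eq[OF A3(1) D(1)[of 3], of c x33] A2 A3 xc D[of 2] D[of 3]
      rD[of 2] rD[of 3] x22 x33 by auto
  define A where "A = (\<lambda>i. [A0, A1, A2, A3] ! i)"
  have A_simps: "A 0 = A0" "A 1 = A1" "A 2 = A2" "A 3 = A3" by (simp_all add: A_def)
  have A: "A i \<in> lines a b" "r \<in> A i" "c \<notin> A i" if "i < 4" for i
    using that A0 A1 A2 A3 cA cA1 c unfolding less4 by (auto simp: A_simps)
  have E1A: "z \<notin> A2 \<and> z \<notin> A3 \<and> s \<notin> A2 \<and> s \<notin> A3"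
  proof -
    have "z \<noteq> x22" "z \<noteq> x33"
      using D_inj[of 2 0] D_inj[of 3 0] eq[OF D(1) D0(1), of 2 z c] eq[OF D(1) D0(1), of 3 z c]
        D[of 2] D[of 3] x22 x33 DD0 D0 cz by auto
    moreover have "s \<noteq> x22" "s \<noteq> x33"
      using D_inj[of 2 1] D_inj[of 3 1] eq[OF D(1) D(1), of 2 1 s c] eq[OF D(1) D(1), of 3 1 s c]
        D[of 1] D[of 2] D[of 3] x22 x33 y_simps cx(1)[OF s(2)] by auto
    ultimately show ?thesis
      using eq[OF E(1) A2(1), of 1 _ x22] eq[OF E(1) A3(1), of 1 _ x33] E[of 1] A2 A3 x22 x33
        y_simps rE[of 1] by auto
  qed
  have A23: "A2 \<noteq> A3"
  proof
    assume "A2 = A3"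
    moreover have "x22 \<noteq> x33"
      using D_inj[of 2 3] eq[OF D(1) D(1), of 2 3 x22 c] D[of 2] D[of 3] x22 x33 xc by auto
    ultimately have "E 1 = A2" using eq[OF E(1) A2(1), of 1 x22 x33] x22 x33 A2 A3 by auto
    then show False using A2 rE[of 1] by auto
  qed
  have A_inj: "A i = A j \<Longrightarrow> i = j" if "i < 4" "j < 4" for i j
    using that E1A A23 A0 zA1 s unfolding less4 by (auto simp: A_simps)
  have "\<exists>x. x \<in> A i \<and> x \<in> D j" if "i < 4" "j < 4" for i j
    using meet[OF A(1)[OF that(1)] D(1)[OF that(2)]] A[OF that(1)] D[OF that(2)] by metis
  then obtain x where xA: "x i j \<in> A i" and xD: "x i j \<in> D j" if "i < 4" "j < 4" for i j by metis
  have x_uniq: "w = x i j" if "w \<in> A i" "w \<in> D j" "i < 4" "j < 4" for w i j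
    using eq[OF A(1)[OF that(3)] D(1)[OF that(4)], of w "x i j"] that xA xD rD A(2) by metis
  have xc: "x i j \<noteq> c" "x i j \<noteq> r" if "i < 4" "j < 4" for i j
    using xA[OF that] xD[OF that] A(3) rD that by metis+
  have x_inj: "i = k \<and> j = l" if "x i j = x k l" "i < 4" "j < 4" "k < 4" "l < 4" for i j k l
    using eq[OF A(1)[OF that(2)] A(1)[OF that(4)], of "x i j" r]
      eq[OF D(1)[OF that(3)] D(1)[OF that(5)], of "x i j" c] that xA xD A_inj D_inj xc A(2) D(2) by metis
  have x_spec: "z = x 0 0" "q = x 1 0" "s = x 1 1" "t = x 1 2" "u = x 1 3" "x22 = x 2 2" "x33 = x 3 3"
    using A0 D0 A1 D[of 0] D[of 1] D[of 2] D[of 3] s t u x22 x33 A2 A3 A_simps DD0 y_simps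
    by (auto intro!: x_uniq)
  have x_eq: "x i j = x k l \<longleftrightarrow> i = k \<and> j = l" if "i < 4" "j < 4" "k < 4" "l < 4" for i j k l
    using x_inj[OF _ that] by blast
  have A_list: "A i = set [r, x i 0, x i 1, x i 2, x i 3]" if "i < 4" for i
    using that by (intro list[OF A(1)]) (simp_all add: xA A x_eq xc xc[symmetric])
  have col: "\<exists>j<4. x i j \<in> L" if "L \<in> lines a b" "r \<notin> L" "i < 4" for L i
  proof -
    have "\<exists>w. w \<in> A i \<and> w \<in> L"
      using meet[OF A(1)[OF that(3)] that(1)] A(2)[OF that(3)] that(2) by metis
    then show ?thesis using that(2) A_list[OF that(3)] unfolding less4 by auto
  qed
  have Q_col: "\<exists>j<4. x i j \<in> B" if "\<exists>y. y \<noteq> r \<and> B \<inter> A i = {r, y}" "i < 4" for B i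
    using that(1) A_list[OF that(2)] unfolding less4 by auto
  have E_row: "i = k" if "x i j \<in> E l" "x k j \<in> E l" "i < 4" "j < 4" "k < 4" "l < 4" "l \<noteq> 0" for i j k l
    using eq[OF E(1)[OF that(6)] D(1)[OF that(4)], of "x i j" "x k j"] that xD x_inj cE[OF that(6,7)]
      D(2)[OF that(4)] by metis
  have E_col: "x i j \<notin> E l" if "x i j \<in> E k" "i < 4" "j < 4" "k < 4" "l < 4" "k \<noteq> l" "(i, j) \<noteq> (0, 0)"
    for i j k l
  proof
    assume "x i j \<in> E l"
    moreover have "x i j \<noteq> z" using that x_eq[of i j 0 0] by (auto simp: x_spec(1))
    ultimately have "E k = E l"
      using eq[OF E(1)[OF that(4)] E(1)[OF that(5)]] that(1) E(2)[OF that(4)] E(2)[OF that(5)] by blast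
    then show False using E_inj[OF that(4,5)] that(6) by blast
  qed
  have zE: "x 0 0 \<in> E l" "x 1 l \<in> E l" if "l < 4" for l
    using E[OF that] x_spec y_simps that unfolding less4 by auto
  have E1: "x 2 2 \<in> E 1" "x 3 3 \<in> E 1" using x22 x33 x_spec by auto
  \<comment> \<open>For \<open>l \<noteq> 0\<close> the line \<open>E l\<close> meets every row, has
    at most one point in each column, and shares only \<open>x 0 0\<close> in the grid with the
    other lines \<open>E k\<close>. The known points leave a single column each time.\<close>
  have E2': "x 3 1 \<in> E 2"
    using col[OF E(1)[of 2] rE[of 2], of 3] E_row[of 3 0 2 0] E_row[of 3 2 2 1] zE[of 2] E_col[OF E1(2), of 2]
    unfolding less4 by auto
  have E2: "x 2 3 \<in> E 2"
    using col[OF E(1)[of 2] rE[of 2], of 2] E_row[of 2 0 2 0] E_row[of 2 2 2 1] zE[of 2] E_row[of 2 1 2 3] E2'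
    unfolding less4 by auto
  have E3: "x 2 1 \<in> E 3"
    using col[OF E(1)[of 3] rE[of 3], of 2] E_row[of 2 0 3 0] E_row[of 2 3 3 1] zE[of 3] E_col[OF E1(1), of 3]
    unfolding less4 by auto
  have E3': "x 3 2 \<in> E 3"
    using col[OF E(1)[of 3] rE[of 3], of 3] E_row[of 3 0 3 0] E_row[of 3 3 3 1] zE[of 3] E_row[of 3 1 3 2] E3
    unfolding less4 by auto
  have xQ: "x 0 0 \<in> Q" "x 1 1 \<in> Q" "r \<in> Q" "c \<in> Q" using x_spec Q s by auto
  have xQ': "x 0 0 \<in> Q'" "x 1 2 \<in> Q'" "r \<in> Q'" "c \<in> Q'" using x_spec Q' t by auto
  have QD: "x i j \<notin> Q" if "x k j \<in> Q" "i < 4" "j < 4" "k < 4" "i \<noteq> k" for i j k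
    using Q2[OF D(1)[OF that(3)], of c "x k j" "x i j"] that xD D(2) xQ xc xc[symmetric] x_eq by simp
  have Q'D: "x i j \<notin> Q'" if "x k j \<in> Q'" "i < 4" "j < 4" "k < 4" "i \<noteq> k" for i j k
    using Q'2[OF D(1)[OF that(3)], of c "x k j" "x i j"] that xD D(2) xQ' xc xc[symmetric] x_eq by simp
  have QE: "x i j \<notin> Q" if "x i j \<in> E 1" "i < 4" "j < 4" "i \<noteq> 0" "i \<noteq> 1" for i j
    using Q2[OF E(1)[of 1], of "x 0 0" "x 1 1" "x i j"] that zE[of 1] xQ x_eq[of 0 0 1 1]
      x_eq[of 0 0 i j] x_eq[of 1 1 i j] by auto
  have Q'E: "x i j \<notin> Q'" if "x i j \<in> E 2" "i < 4" "j < 4" "i \<noteq> 0" "i \<noteq> 1" for i j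
    using Q'2[OF E(1)[of 2], of "x 0 0" "x 1 2" "x i j"] that zE[of 2] xQ' x_eq[of 0 0 1 2]
      x_eq[of 0 0 i j] x_eq[of 1 2 i j] by auto
  have QA: "\<exists>j<4. x i j \<in> Q" "\<exists>j<4. x i j \<in> Q'" if "i < 4" for i
    using Q_col[OF Qmeet[OF A(1)] that] Q_col[OF Q'meet[OF A(1)] that] that A(2) xQ xQ' by auto
  \<comment> \<open>Again a single column remains: a hyperoval has one further point on each row,
    since it contains \<open>r\<close>, at most one in each column, since it contains
    \<open>c\<close>, and no third point on \<open>E 1\<close> (for \<open>Q\<close>) or
    \<open>E 2\<close> (for \<open>Q'\<close>).\<close>
  have Q23: "x 2 3 \<in> Q"
    using QA(1)[of 2] QD[of 0 0 2] QD[of 1 1 2] QE[OF E1(1)] xQ unfolding less4 by auto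
  have Q32: "x 3 2 \<in> Q"
    using QA(1)[of 3] QD[of 0 0 3] QD[of 1 1 3] QE[OF E1(2)] xQ unfolding less4 by auto
  have Q21: "x 2 1 \<in> Q'"
    using QA(2)[of 2] Q'D[of 0 0 2] Q'D[of 1 2 2] Q'E[OF E2] xQ' unfolding less4 by auto
  have Q33: "x 3 3 \<in> Q'"
    using QA(2)[of 3] Q'D[of 0 0 3] Q'D[of 1 2 3] Q'E[OF E2'] xQ' unfolding less4 by auto
  have xM: "x i j \<notin> M" if "i < 4" "j < 4" for i j
    using eq[OF A(1)[OF that(1)] M(1), of "x i j" r] A[OF that(1)] xA[OF that] xc[OF that] M by metis
  have "\<exists>m. m \<in> M \<and> m \<in> E i" if "i < 4" for i
    using meet[OF M(1) E(1)[OF that]] M(2) rE[OF that] by metis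
  then obtain m where m: "m i \<in> M" "m i \<in> E i" if "i < 4" for i by metis
  have mrc: "m i \<noteq> r" "m i \<noteq> c" if "i < 4" "i \<noteq> 0" for i using m rE cE that by metis+
  have m_inj: "m i = m j \<Longrightarrow> i = j" if "i < 4" "j < 4" for i j
    using eq[OF E(1)[OF that(1)] E(1)[OF that(2)], of "m i" z] m that E(2) E_inj zM by metis
  have m_eq: "m i = m j \<longleftrightarrow> i = j" if "i < 4" "j < 4" for i j using m_inj that by blast
  have mx: "m k \<noteq> x i j" if "k < 4" "i < 4" "j < 4" for i j k using xM m that by metis
  define f where "f = (\<lambda>n. if n < 7 then [a, b, r, c, m 1, m 2, m 3] ! n else x ((n - 7) div 4) ((n - 7) mod 4))"
  have xab: "x i j \<in> P" "x i j \<noteq> a" "x i j \<noteq> b" if "i < 4" "j < 4" for i j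
    using xA[OF that] A(1)[OF that(1)] sub nab by blast+
  have mab: "m i \<in> P" "m i \<noteq> a" "m i \<noteq> b" if "i < 4" for i
    using m[OF that] M(1) sub nab by blast+
  have dist: "distinct [a, b, r, c, m 1, m 2, m 3]"
    using abzr c cr mrc[of 1] mrc[of 2] mrc[of 3] mab[of 1] mab[of 2] mab[of 3] m_inj[of 1 2] m_inj[of 1 3] m_inj[of 2 3]
    by auto
  have seven: "f n = x ((n - 7) div 4) ((n - 7) mod 4)" if "\<not> n < 7" for n
    using that by (simp add: f_def)
  have idx: "(n - 7) div 4 < 4" "(n - 7) mod 4 < 4" if "n < 23" for n :: nat using that by auto
  have small: "f n \<in> {a, b, r, c, m 1, m 2, m 3}" if "n < 7" for n
    using that nth_mem[of n "[a, b, r, c, m 1, m 2, m 3]"] by (simp add: f_def)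
  have grid: "x i j \<notin> {a, b, r, c, m 1, m 2, m 3}" if "i < 4" "j < 4" for i j
    using xab[OF that] xc[OF that] mx[OF _ that, of 1] mx[OF _ that, of 2] mx[OF _ that, of 3] by auto
  have cross: "f k \<noteq> f n" if "k < 7" "\<not> n < 7" "n < 23" for k n
    using small[OF that(1)] grid[OF idx[OF that(3)]] seven[OF that(2)] by metis
  have "inj_on f {..<23}"
  proof (rule inj_onI)
    fix k n assume kn: "k \<in> {..<23}" "n \<in> {..<23}" "f k = f n"
    show "k = n"
    proof (cases "k < 7"; cases "n < 7")
      assume "k < 7" "n < 7"
      then show ?thesis using kn(3) dist nth_eq_iff_index_eq[OF dist, of k n] by (simp add: f_def)
    next
      assume "\<not> k < 7" "\<not> n < 7"
      then have "(k - 7) div 4 = (n - 7) div 4 \<and> (k - 7) mod 4 = (n - 7) mod 4"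
        using kn x_inj idx seven by simp
      then have "k - 7 = n - 7" by (metis div_mult_mod_eq)
      then show ?thesis using \<open>\<not> k < 7\<close> \<open>\<not> n < 7\<close> by simp
    qed (use kn cross in \<open>force+\<close>)
  qed
  moreover have "f n \<in> P" if "n < 23" for n
    using small[of n] seven[of n] xab(1)[OF idx[OF that]] ab rP cP mab[of 1] mab[of 2] mab[of 3] by (cases "n < 7") auto
  ultimately have "bij_betw f {..<23} P"
    using card_subset_eq[OF finite_points, of "f ` {..<23}"] card_image[of f "{..<23}"] card_points
    by (simp add: bij_betw_def image_subset_iff)
  moreover have "\<forall>g \<in> golay_generators. f ` g \<in> \<B>"
  proof -
    have f: "f 0 = a" "f 1 = b" "f 2 = r" "f 3 = c" "f 4 = m 1" "f 5 = m 2" "f 6 = m 3"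
      "f 7 = x 0 0" "f 8 = x 0 1" "f 9 = x 0 2" "f 10 = x 0 3"
      "f 11 = x 1 0" "f 12 = x 1 1" "f 13 = x 1 2" "f 14 = x 1 3"
      "f 15 = x 2 0" "f 16 = x 2 1" "f 17 = x 2 2" "f 18 = x 2 3"
      "f 19 = x 3 0" "f 20 = x 3 1" "f 21 = x 3 2" "f 22 = x 3 3"
      by (simp_all add: f_def nth_Cons')
    have D_list: "D j = set [c, x 0 j, x 1 j, x 2 j, x 3 j]" if "j < 4" for j
      using that by (intro list[OF D(1)]) (simp_all add: xD D x_eq xc xc[symmetric])
    have M_list: "M = set [r, c, m 1, m 2, m 3]"
      using M m mrc mrc[symmetric] cr m_eq by (intro list[OF M(1)]) simp_all
    have E_lists: "E 1 = set [x 0 0, x 1 1, x 2 2, x 3 3, m 1]"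
      "E 2 = set [x 0 0, x 1 2, x 2 3, x 3 1, m 2]"
      "E 3 = set [x 0 0, x 1 3, x 2 1, x 3 2, m 3]"
      using E1 E2 E2' E3 E3' zE[of 1] zE[of 2] zE[of 3] m mx mx[symmetric] x_eq
      by (intro list[OF E(1)]; simp)+
    have Q_list: "Q = set [a, r, c, x 0 0, x 1 1, x 2 3, x 3 2]"
      using Q xQ Q23 Q32 x_eq xc xc[symmetric] xab xab(2,3)[symmetric] abzr c cr by (intro blist[OF Q(1)]) auto
    have Q'_list: "Q' = set [b, r, c, x 0 0, x 1 2, x 2 1, x 3 3]"
      using Q' xQ' Q21 Q33 x_eq xc xc[symmetric] xab xab(2,3)[symmetric] abzr c cr by (intro blist[OF Q'(1)]) auto
    have "f ` {0,1,2,7,8,9,10} \<in> \<B>"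
      using blk[OF A(1)[of 0]] by (simp add: f A_list)
    moreover have "f ` {0,1,2,11,12,13,14} \<in> \<B>"
      using blk[OF A(1)[of 1]] by (simp add: f A_list)
    moreover have "f ` {0,1,2,15,16,17,18} \<in> \<B>"
      using blk[OF A(1)[of 2]] by (simp add: f A_list)
    moreover have "f ` {0,1,2,3,4,5,6} \<in> \<B>"
      using blk[OF M(1)] by (simp add: f M_list)
    moreover have "f ` {0,1,3,7,11,15,19} \<in> \<B>"
      using blk[OF D(1)[of 0]] by (simp add: f D_list)
    moreover have "f ` {0,1,3,8,12,16,20} \<in> \<B>"
      using blk[OF D(1)[of 1]] by (simp add: f D_list)
    moreover have "f ` {0,1,3,9,13,17,21} \<in> \<B>"
      using blk[OF D(1)[of 2]] by (simp add: f D_list)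
    moreover have "f ` {0,1,7,12,17,22,4} \<in> \<B>"
      using blk[OF E(1)[of 1]] by (simp add: f E_lists)
    moreover have "f ` {0,1,7,13,18,20,5} \<in> \<B>"
      using blk[OF E(1)[of 2]] by (simp add: f E_lists)
    moreover have "f ` {0,1,7,14,16,21,6} \<in> \<B>"
      using blk[OF E(1)[of 3]] by (simp add: f E_lists)
    moreover have "f ` {0,2,3,7,12,18,21} \<in> \<B>"
      using Q(1) by (simp add: f Q_list)
    moreover have "f ` {1,2,3,7,13,16,22} \<in> \<B>"
      using Q'(1) by (simp add: f Q'_list)
    ultimately show ?thesis
      by (simp only: golay_generators_def ball_simps simp_thms)
  qed
  ultimately show ?thesis by blast
qed

end

section \<open>Comparison of two systems S(4,7,23)\<close>

lemma of_nat_bit_eq_1_iff: "(of_nat n :: bit) = 1 \<longleftrightarrow> odd n"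
  by (induction n) (auto simp: bit_not_zero_iff)

lemma odd_card_Int_golay:
  assumes XY: "X \<subseteq> {..<23}" "Y \<subseteq> {..<23}"
    and odd: "\<And>g. g \<in> golay_generators \<Longrightarrow> odd (card (X \<inter> g))"
      "\<And>g. g \<in> golay_generators \<Longrightarrow> odd (card (Y \<inter> g))"
  shows "odd (card (X \<inter> Y))"
proof -
  have card: "(of_nat (card (Z \<inter> g)) :: bit) = (\<Sum>i\<in>g. of_bool (i \<in> Z))" if "finite g" for Z g :: "nat set"
    using that by (simp add: sum.If_cases of_bool_def Int_commute)
  have sums: "(\<Sum>i\<in>g. of_bool (i \<in> Z) :: bit) = 1"
    if "g \<in> golay_generators" "odd (card (Z \<inter> g))" for Z g :: "nat set"
  proof -
    have "finite g" using that(1) by (auto simp: golay_generators_def)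
    then show ?thesis using that(2) card[of g Z] of_nat_bit_eq_1_iff by metis
  qed
  have "(\<Sum>i<23. of_bool (i \<in> X) * of_bool (i \<in> Y) :: bit) = 1"
    using sums odd by (intro golay_self_dual) blast+
  moreover have "(\<Sum>i<23. of_bool (i \<in> X) * of_bool (i \<in> Y) :: bit) = of_nat (card (X \<inter> Y))"
  proof -
    have "{..<23} \<inter> {i. i \<in> X \<and> i \<in> Y} = X \<inter> Y" using XY by auto
    then show ?thesis by (simp add: sum.If_cases flip: of_bool_conj)
  qed
  ultimately show ?thesis by (metis of_nat_bit_eq_1_iff)
qed

lemma card_image_Int_image:
  assumes "inj_on f A" "X \<subseteq> A" "Y \<subseteq> A"
  shows "card (f ` X \<inter> f ` Y) = card (X \<inter> Y)"
  using assms by (metis card_image inj_on_image_Int inj_on_subset inf.coboundedI1)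

theorem steiner_4_7_23_unique:
  assumes "quasi_symmetric_design 4 23 7 1 3 1 P \<B>" "quasi_symmetric_design 4 23 7 1 3 1 P' \<B>'"
  shows "\<exists>h. bij_betw h P P' \<and> (`) h ` \<B> = \<B>'"
proof -
  \<comment> \<open>Stated for arbitrary systems, because it is applied in both directions to obtain
    the two inclusions between the sets of blocks.\<close>
  have transfer: "(g \<circ> inv_into {..<23} f) ` D \<in> \<B>'"
    if "quasi_symmetric_design 4 23 7 1 3 1 P \<B>" "quasi_symmetric_design 4 23 7 1 3 1 P' \<B>'"
      and f: "bij_betw f {..<23} P" "\<forall>w \<in> golay_generators. f ` w \<in> \<B>"
      and g: "bij_betw g {..<23} P'" "\<forall>w \<in> golay_generators. g ` w \<in> \<B>'" and D: "D \<in> \<B>"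
    for P :: "'x set" and \<B> and P' :: "'y set" and \<B>' f g D
  proof -
    interpret A: steiner23 P \<B> by unfold_locales fact
    interpret B: steiner23 P' \<B>' by unfold_locales fact
    have odd: "odd (card (X \<inter> w))" if "e ` X \<in> \<C>" "steiner23 R \<C>" "inj_on e {..<23}"
      "X \<subseteq> {..<23}" "\<forall>w \<in> golay_generators. e ` w \<in> \<C>" "w \<in> golay_generators"
      for e :: "nat \<Rightarrow> 'z" and R \<C> X w
    proof -
      have w: "w \<subseteq> {..<23}" using that(6) by (auto simp: golay_generators_def)
      then have "card (X \<inter> w) = card (e ` X \<inter> e ` w)"
        using card_image_Int_image[OF that(3,4) w] by simp
      then show ?thesis using steiner23.odd_Int_blocks[OF that(2) that(1)] that(5,6) by metis
    qed
    have fi: "inj_on f {..<23}" and gi: "inj_on g {..<23}" and fP: "f ` {..<23} = P"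
      and gP: "g ` {..<23} = P'"
      using f g by (auto simp: bij_betw_def)
    define X where "X = inv_into {..<23} f ` D"
    have DP: "D \<subseteq> f ` {..<23}" using A.block_subset[OF D] fP by simp
    have X: "X \<subseteq> {..<23}" "f ` X = D"
      using DP inv_into_into[of _ f "{..<23}"] by (auto simp: X_def image_image f_inv_into_f subset_iff)
    have "g ` X \<in> \<B>'"
    proof (rule B.block_if_odd)
      show "g ` X \<subseteq> P'" using X gP by blast
      show "card (g ` X) = 7"
        using A.card_block[OF D] X card_image inj_on_subset[OF fi X(1)] inj_on_subset[OF gi X(1)] by metis
    next
      fix D' assume D': "D' \<in> \<B>'"
      define Y where "Y = inv_into {..<23} g ` D'"
      have DP': "D' \<subseteq> g ` {..<23}" using B.block_subset[OF D'] gP by simp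
      have Y: "Y \<subseteq> {..<23}" "g ` Y = D'"
        using DP' inv_into_into[of _ g "{..<23}"] by (auto simp: Y_def image_image f_inv_into_f subset_iff)
      have "odd (card (X \<inter> Y))"
        using odd_card_Int_golay[OF X(1) Y(1)] odd[of f X \<B> P] odd[of g Y \<B>' P'] X Y D D' f g fi gi
          A.steiner23_axioms B.steiner23_axioms by auto
      moreover have "card (g ` X \<inter> D') = card (X \<inter> Y)"
        using card_image_Int_image[OF gi X(1) Y(1)] Y by simp
      ultimately show "odd (card (g ` X \<inter> D'))" by simp
    qed
    then show ?thesis by (simp add: X_def image_comp)
  qed
  interpret A: steiner23 P \<B> by unfold_locales fact
  interpret B: steiner23 P' \<B>' by unfold_locales fact
  obtain f where f: "bij_betw f {..<23} P" "\<forall>w \<in> golay_generators. f ` w \<in> \<B>"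
    using A.golay_coordinates by blast
  obtain g where g: "bij_betw g {..<23} P'" "\<forall>w \<in> golay_generators. g ` w \<in> \<B>'"
    using B.golay_coordinates by blast
  let ?h = "g \<circ> inv_into {..<23} f" and ?k = "f \<circ> inv_into {..<23} g"
  have "bij_betw ?h P P'"
    using bij_betw_trans[OF bij_betw_inv_into[OF f(1)] g(1)] .
  moreover have "(`) ?h ` \<B> = \<B>'"
  proof (intro equalityI subsetI)
    fix D assume "D \<in> (`) ?h ` \<B>"
    then show "D \<in> \<B>'" using transfer[OF assms f g] by blast
  next
    fix D assume D: "D \<in> \<B>'"
    have "?k ` D \<in> \<B>" using transfer[OF assms(2,1) g f D] .
    moreover have "?h ` ?k ` D = D"
    proof -
      have "?h (?k x) = x" if "x \<in> D" for x
      proof -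
        have "x \<in> g ` {..<23}" using that B.block_subset[OF D] g(1) by (auto simp: bij_betw_def)
        then show ?thesis
          using f(1) inv_into_into[of x g "{..<23}"]
          by (simp add: bij_betw_def inv_into_f_f f_inv_into_f)
      qed
      then show ?thesis by (force simp: image_image)
    qed
    ultimately show "D \<in> (`) ?h ` \<B>" by (metis image_eqI)
  qed
  ultimately show ?thesis by blast
qed

section \<open>Moments of sign vectors\<close>

lemma Rats_square_Ints:
  fixes x :: real
  assumes "x \<in> \<rat>" "x^2 \<in> \<int>"
  shows "x \<in> \<int>"
proof -
  obtain a b where ab: "x = of_int a / of_int b" "b > 0" "coprime a b"
    using assms(1) by (metis Rats_cases')
  obtain n where "x^2 = of_int n" using assms(2) by (auto elim: Ints_cases)
  then have "of_int (a^2) = (of_int (n * b^2) :: real)"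
    using ab by (simp add: power_divide field_simps)
  then have "a^2 = n * b^2" by (simp only: of_int_eq_iff)
  then have "b dvd a^2" by (simp add: power2_eq_square)
  moreover have "coprime b (a^2)" using ab(3) by (simp add: coprime_commute)
  ultimately have "is_unit b" by (metis coprime_absorb_left)
  then have "b = 1" using ab(2) by simp
  then show ?thesis using ab by simp
qed

lemma nonsquare:
  fixes k n :: int
  assumes "n \<ge> 0" "n^2 < m" "m < (n + 1)^2"
  shows "k^2 \<noteq> m"
proof
  assume "k^2 = m"
  then show False
    using assms abs_le_square_iff[of k n] abs_le_square_iff[of "n + 1" k] by linarith
qed

text \<open>The tuples are ordered and nested, so that a sum over them unfolds one index at a
  time.\<close>

definition pairs :: "'i set \<Rightarrow> ('i \<times> 'i) set" where
  "pairs I = (SIGMA a:I. I - {a})"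

definition triples :: "'i set \<Rightarrow> ('i \<times> 'i \<times> 'i) set" where
  "triples I = (SIGMA a:I. SIGMA b:I - {a}. I - {a, b})"

definition quads :: "'i set \<Rightarrow> ('i \<times> 'i \<times> 'i \<times> 'i) set" where
  "quads I = (SIGMA a:I. SIGMA b:I - {a}. SIGMA c:I - {a, b}. I - {a, b, c})"

lemma sum_Diff_one: "finite I \<Longrightarrow> a \<in> I \<Longrightarrow> (\<Sum>b\<in>I - {a}. f b) = (\<Sum>b\<in>I. f b) - f a"
  for f :: "_ \<Rightarrow> real"
  by (simp add: sum_diff1)

lemma sum_Diff_two:
  "finite I \<Longrightarrow> a \<in> I \<Longrightarrow> b \<in> I - {a} \<Longrightarrow> (\<Sum>c\<in>I - {a, b}. f c) = (\<Sum>c\<in>I. f c) - f a - f b"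
  for f :: "_ \<Rightarrow> real"
  by (auto simp: sum_diff)

lemma sum_Diff_three:
  "finite I \<Longrightarrow> a \<in> I \<Longrightarrow> b \<in> I - {a} \<Longrightarrow> c \<in> I - {a, b} \<Longrightarrow>
    (\<Sum>e\<in>I - {a, b, c}. f e) = (\<Sum>e\<in>I. f e) - f a - f b - f c"
  for f :: "_ \<Rightarrow> real"
  by (auto simp: sum_diff)

context
  fixes I :: "'i set" and z :: "'i \<Rightarrow> real" and w d :: real
  assumes fin: "finite I" and d: "d = real (card I)" and sgn: "\<And>a. a \<in> I \<Longrightarrow> z a * z a = 1"
    and w: "w = (\<Sum>a\<in>I. z a)"
begin

text \<open>Summing out all but two indices of a product of signs leaves an expression of this
  shape, with coefficients that may involve \<open>w\<close>. The sums over triples and quadruples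
  are reduced to it.\<close>

lemma sum_pairs_affine:
  "(\<Sum>a\<in>I. \<Sum>b\<in>I - {a}. k0 * (z a * z b) + k1 * z a + k2 * z b + k3) =
    k0 * (w^2 - d) + (k1 + k2) * (d - 1) * w + k3 * d * (d - 1)"
proof -
  have "(\<Sum>b\<in>I - {a}. k0 * (z a * z b) + k1 * z a + k2 * z b + k3) =
    k0 * (z a * w - 1) + k1 * (d - 1) * z a + k2 * (w - z a) + k3 * (d - 1)" if "a \<in> I" for a
  proof -
    have "(\<Sum>b\<in>I - {a}. k0 * (z a * z b) + k1 * z a + k2 * z b + k3) =
      (\<Sum>b\<in>I. k0 * (z a * z b) + k1 * z a + k2 * z b + k3) - (k0 * (z a * z a) + k1 * z a + k2 * z a + k3)"
      using that fin by (simp add: sum_Diff_one)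
    also have "(\<Sum>b\<in>I. k0 * (z a * z b) + k1 * z a + k2 * z b + k3) =
      k0 * (z a * w) + d * (k1 * z a) + k2 * w + d * k3"
      by (simp add: sum.distrib w d sum_distrib_left)
    finally show ?thesis using sgn[OF that] by (simp add: algebra_simps)
  qed
  then have "(\<Sum>a\<in>I. \<Sum>b\<in>I - {a}. k0 * (z a * z b) + k1 * z a + k2 * z b + k3) =
    (\<Sum>a\<in>I. k0 * (z a * w - 1) + k1 * (d - 1) * z a + k2 * (w - z a) + k3 * (d - 1))"
    by (intro sum.cong) auto
  also have "\<dots> = k0 * (w * w - d) + k1 * (d - 1) * w + k2 * (d * w - w) + k3 * (d - 1) * d"
    using d by (simp add: sum.distrib sum_subtractf w flip: sum_distrib_left sum_distrib_right)
  finally show ?thesis by (simp add: algebra_simps power2_eq_square)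
qed

lemma sum_pairs: "(\<Sum>(a, b)\<in>pairs I. z a * z b) = w^2 - d"
  using sum_pairs_affine[of 1 0 0 0] fin by (simp add: pairs_def flip: sum.Sigma)

text \<open>Newton's identities collapse for signs, since odd power sums equal \<open>w\<close> and
  even ones equal \<open>d\<close>. So an elementary symmetric function of the signs is a polynomial
  in \<open>w\<close>; here it is six times the third one, in \<open>sum_quads\<close> twenty-four
  times the fourth.\<close>

lemma sum_triples: "(\<Sum>(a, b, c)\<in>triples I. z a * z b * z c) = w^3 - (3 * d - 2) * w"
proof -
  have "(\<Sum>c\<in>I - {a, b}. z a * z b * z c) = w * (z a * z b) + (-1) * z a + (-1) * z b + 0"
    if "a \<in> I" "b \<in> I - {a}" for a b
  proof -
    have "(\<Sum>c\<in>I - {a, b}. z a * z b * z c) = z a * z b * (w - z a - z b)"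
      using that fin unfolding sum_distrib_left[symmetric] by (simp add: sum_Diff_two w)
    also have "\<dots> = w * (z a * z b) - (z a * z a) * z b - z a * (z b * z b)"
      by (simp add: algebra_simps)
    finally show ?thesis using that sgn[of a] sgn[of b] by simp
  qed
  then have "(\<Sum>(a, b, c)\<in>triples I. z a * z b * z c) =
    (\<Sum>a\<in>I. \<Sum>b\<in>I - {a}. w * (z a * z b) + (-1) * z a + (-1) * z b + 0)"
    using fin by (simp add: triples_def flip: sum.Sigma)
  then show ?thesis
    unfolding sum_pairs_affine by (simp add: algebra_simps power2_eq_square power3_eq_cube)
qed

lemma sum_quads:
  "(\<Sum>(a, b, c, e)\<in>quads I. z a * z b * z c * z e) = w^4 - (6 * d - 8) * w^2 + 3 * d^2 - 6 * d"
proof -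
  have "(\<Sum>c\<in>I - {a, b}. \<Sum>e\<in>I - {a, b, c}. z a * z b * z c * z e) =
      (w^2 + 4 - d) * (z a * z b) + (-2 * w) * z a + (-2 * w) * z b + 2"
    if "a \<in> I" "b \<in> I - {a}" for a b
  proof -
    have "(\<Sum>c\<in>I - {a, b}. \<Sum>e\<in>I - {a, b, c}. z a * z b * z c * z e) =
        (\<Sum>c\<in>I - {a, b}. z a * z b * ((w - z a - z b) * z c - 1))"
    proof (intro sum.cong refl)
      fix c assume c: "c \<in> I - {a, b}"
      have "(\<Sum>e\<in>I - {a, b, c}. z a * z b * z c * z e) = z a * z b * z c * (w - z a - z b - z c)"
        using that c fin unfolding sum_distrib_left[symmetric] by (simp add: sum_Diff_three w)
      also have "\<dots> = z a * z b * ((w - z a - z b) * z c - z c * z c)" by (simp add: algebra_simps)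
      finally show "(\<Sum>e\<in>I - {a, b, c}. z a * z b * z c * z e) =
        z a * z b * ((w - z a - z b) * z c - 1)" using sgn[of c] c by simp
    qed
    also have "\<dots> = z a * z b * ((w - z a - z b) * (w - z a - z b) - (d - 2))"
      using that fin d sum_Diff_two[OF fin that, of "\<lambda>_. 1"]
      unfolding sum_distrib_left[symmetric] sum_subtractf
      by (simp add: sum_Diff_two w)
    also have "\<dots> = (w^2 + 2 - d) * (z a * z b) + (z a * z a) * (z a * z b) + (z b * z b) * (z a * z b)
        + 2 * (z a * z a) * (z b * z b) - 2 * w * (z a * z a) * z b - 2 * w * z a * (z b * z b)"
      by (simp add: algebra_simps power2_eq_square)
    also have "\<dots> = (w^2 + 2 - d) * (z a * z b) + z a * z b + z a * z b + 2 - 2 * w * z b - 2 * w * z a"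
      using that sgn[of a] sgn[of b] by simp
    finally show ?thesis by (simp add: algebra_simps)
  qed
  then have "(\<Sum>(a, b, c, e)\<in>quads I. z a * z b * z c * z e) =
    (\<Sum>a\<in>I. \<Sum>b\<in>I - {a}. (w^2 + 4 - d) * (z a * z b) + (-2 * w) * z a + (-2 * w) * z b + 2)"
    using fin by (simp add: quads_def flip: sum.Sigma)
  then show ?thesis
    unfolding sum_pairs_affine by (simp add: algebra_simps power2_eq_square power4_eq_xxxx)
qed

end

lemma card_triples:
  assumes "finite I"
  defines "d \<equiv> real (card I)"
  shows "real (card (triples I)) = d * (d - 1) * (d - 2)"
  using sum_triples[OF assms(1) refl, of "\<lambda>_. 1", OF _ refl]
  by (simp add: d_def algebra_simps power2_eq_square power3_eq_cube split_def)

section \<open>Restrictions on the parameters of a sign configuration\<close>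

text \<open>The rows of \<open>x\<close> are the coordinates, up to the factor \<open>1 / q\<close>, of the remaining lines with
  respect to the \<open>d\<close> lines of an incoherent set, where \<open>1 / q\<close> is the common angle.\<close>

locale sign_config =
  fixes I :: "'i set" and C :: "'c set" and x :: "'c \<Rightarrow> 'i \<Rightarrow> real" and q s d b p t :: real
  assumes fin: "finite I" "finite C" and d: "d = real (card I)" and b: "b = real (card C)"
    and sgn: "\<And>c a. c \<in> C \<Longrightarrow> a \<in> I \<Longrightarrow> x c a = 1 \<or> x c a = -1"
    and sum_s: "\<And>c. c \<in> C \<Longrightarrow> (\<Sum>a\<in>I. x c a) = s"
    and s: "s \<le> 0" "s^2 = (d - q^2 + q) * (q - 1 + d)"
    and ip: "\<And>c e. c \<in> C \<Longrightarrow> e \<in> C \<Longrightarrow> c \<noteq> e \<Longrightarrow>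
      (\<Sum>a\<in>I. x c a * x e a) = d - (q - 1)^2 \<or> (\<Sum>a\<in>I. x c a * x e a) = d - (q^2 - 1)"
    and q: "q > 1" "q^2 > d" "b * (q^2 - d) = d * (d - 1)"
    and d4: "d \<ge> 4"
    and two: "\<And>a e. a \<in> I \<Longrightarrow> e \<in> I \<Longrightarrow> a \<noteq> e \<Longrightarrow> (\<Sum>c\<in>C. x c a * x c e) = p"
    and four: "\<And>a e f g. (a, e, f, g) \<in> quads I \<Longrightarrow> (\<Sum>c\<in>C. x c a * x c e * x c f * x c g) = t"
begin

lemma sgn2: "c \<in> C \<Longrightarrow> a \<in> I \<Longrightarrow> x c a * x c a = 1"
  using sgn by fastforce

lemma two_const: "(a, e) \<in> pairs I \<Longrightarrow> (\<Sum>c\<in>C. x c a * x c e) = p"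
  using two by (auto simp: pairs_def)

lemma b_pos: "b > 0"
proof -
  have "b * (q^2 - d) > 0" unfolding q(3) using d4 by (intro mult_pos_pos) auto
  then show ?thesis by (rule zero_less_mult_pos2) (use q in simp)
qed

text \<open>Interchange the sums: weighting the columns by \<open>z\<close> multiplies each constant
  moment by a product of entries of \<open>z\<close>, and both sides are symmetric sums in signs.
  The versions for three and four places below have the same proof.\<close>

lemma two_pairs: "(\<Sum>c\<in>C. (\<Sum>a\<in>I. x c a * z a)^2 - d) = p * ((\<Sum>a\<in>I. z a)^2 - d)"
  if z: "\<And>a. a \<in> I \<Longrightarrow> z a * z a = 1" for z
proof -
  have "(\<Sum>c\<in>C. (\<Sum>a\<in>I. x c a * z a)^2 - d) = (\<Sum>c\<in>C. \<Sum>(a, e)\<in>pairs I. (x c a * z a) * (x c e * z e))"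
    by (intro sum.cong refl sum_pairs[symmetric] fin d) (simp add: mult_ac sgn2 z)
  also have "\<dots> = (\<Sum>(a, e)\<in>pairs I. z a * z e * (\<Sum>c\<in>C. x c a * x c e))"
    by (subst sum.swap) (simp add: sum_distrib_left split_def mult_ac)
  also have "\<dots> = (\<Sum>(a, e)\<in>pairs I. z a * z e * p)"
    by (intro sum.cong refl) (auto simp: two_const)
  also have "\<dots> = p * (\<Sum>(a, e)\<in>pairs I. z a * z e)"
    by (simp add: sum_distrib_left split_def mult_ac)
  finally show ?thesis using sum_pairs[OF fin(1) d z refl] by simp
qed

lemma three_triples:
  assumes three: "\<And>a e f. (a, e, f) \<in> triples I \<Longrightarrow> (\<Sum>c\<in>C. x c a * x c e * x c f) = \<tau>"
    and z: "\<And>a. a \<in> I \<Longrightarrow> z a * z a = 1"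
  defines "E \<equiv> \<lambda>w. w^3 - (3 * d - 2) * w"
  shows "(\<Sum>c\<in>C. E (\<Sum>a\<in>I. x c a * z a)) = \<tau> * E (\<Sum>a\<in>I. z a)"
proof -
  have "(\<Sum>c\<in>C. E (\<Sum>a\<in>I. x c a * z a)) =
      (\<Sum>c\<in>C. \<Sum>(a, e, f)\<in>triples I. (x c a * z a) * (x c e * z e) * (x c f * z f))"
    unfolding E_def by (intro sum.cong refl sum_triples[symmetric] fin d) (simp add: mult_ac sgn2 z)
  also have "\<dots> = (\<Sum>(a, e, f)\<in>triples I. z a * z e * z f * (\<Sum>c\<in>C. x c a * x c e * x c f))"
    by (subst sum.swap) (simp add: sum_distrib_left split_def mult_ac)
  also have "\<dots> = (\<Sum>(a, e, f)\<in>triples I. z a * z e * z f * \<tau>)"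
    by (intro sum.cong refl) (auto simp: three)
  also have "\<dots> = \<tau> * (\<Sum>(a, e, f)\<in>triples I. z a * z e * z f)"
    by (simp add: sum_distrib_left split_def mult_ac)
  finally show ?thesis using sum_triples[OF fin(1) d z refl] by (simp add: E_def)
qed

lemma four_quads:
  assumes z: "\<And>a. a \<in> I \<Longrightarrow> z a * z a = 1"
  defines "E \<equiv> \<lambda>w. w^4 - (6 * d - 8) * w^2 + 3 * d^2 - 6 * d"
  shows "(\<Sum>c\<in>C. E (\<Sum>a\<in>I. x c a * z a)) = t * E (\<Sum>a\<in>I. z a)"
proof -
  have "(\<Sum>c\<in>C. E (\<Sum>a\<in>I. x c a * z a)) =
      (\<Sum>c\<in>C. \<Sum>(a, e, f, g)\<in>quads I. (x c a * z a) * (x c e * z e) * (x c f * z f) * (x c g * z g))"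
    unfolding E_def by (intro sum.cong refl sum_quads[symmetric] fin d) (simp add: mult_ac sgn2 z)
  also have "\<dots> = (\<Sum>(a, e, f, g)\<in>quads I. z a * z e * z f * z g * (\<Sum>c\<in>C. x c a * x c e * x c f * x c g))"
    by (subst sum.swap) (simp add: sum_distrib_left split_def mult_ac)
  also have "\<dots> = (\<Sum>(a, e, f, g)\<in>quads I. z a * z e * z f * z g * t)"
    by (intro sum.cong refl) (auto simp: four)
  also have "\<dots> = t * (\<Sum>(a, e, f, g)\<in>quads I. z a * z e * z f * z g)"
    by (simp add: sum_distrib_left split_def mult_ac)
  finally show ?thesis using sum_quads[OF fin(1) d z refl] by (simp add: E_def)
qed

lemma p_eq: "p * (d * (d - 1)) = b * (s^2 - d)"
  using two_pairs[of "\<lambda>_. 1"] sum_s d b by (simp add: algebra_simps power2_eq_square)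

lemma t_eq: "t * (d * (d - 1) * (d - 2) * (d - 3)) = b * (s^4 - (6 * d - 8) * s^2 + 3 * d^2 - 6 * d)"
  using four_quads[of "\<lambda>_. 1"] sum_s d b
  by (simp add: algebra_simps power2_eq_square power4_eq_xxxx)

text \<open>Replacing the factor \<open>s\<close> by the row sum turns the first moment into second
  moments; the repeated place contributes \<open>b\<close> because the entries square to
  one.\<close>

lemma one_const: "s * (\<Sum>c\<in>C. x c a) = b + (d - 1) * p" if "a \<in> I"
proof -
  have "s * (\<Sum>c\<in>C. x c a) = (\<Sum>c\<in>C. x c a * (\<Sum>e\<in>I. x c e))"
    by (simp add: sum_s sum_distrib_left mult_ac)
  also have "\<dots> = (\<Sum>e\<in>I. \<Sum>c\<in>C. x c a * x c e)"
    by (subst sum.swap) (simp add: sum_distrib_left)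
  also have "\<dots> = (\<Sum>c\<in>C. x c a * x c a) + (\<Sum>e\<in>I - {a}. \<Sum>c\<in>C. x c a * x c e)"
    using fin that by (simp add: sum_Diff_one)
  also have "(\<Sum>e\<in>I - {a}. \<Sum>c\<in>C. x c a * x c e) = (\<Sum>e\<in>I - {a}. p)"
    using that by (intro sum.cong refl two) auto
  also have "(\<Sum>c\<in>C. x c a * x c a) = b"
    using that by (simp add: sgn2 b)
  also have "(\<Sum>e\<in>I - {a}. p) = (d - 1) * p"
    using fin that sum_Diff_one[OF fin(1) that, of "\<lambda>_. p"] d by (simp add: algebra_simps)
  finally show ?thesis .
qed

text \<open>The same device: of the products with a fourth entry, three collapse to pairs and the
  other \<open>d - 3\<close> are genuine fourth moments.\<close>

lemma three_const:
  assumes "(a, e, f) \<in> triples I"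
  shows "s * (\<Sum>c\<in>C. x c a * x c e * x c f) = 3 * p + (d - 3) * t"
proof -
  have aef: "a \<in> I" "e \<in> I - {a}" "f \<in> I - {a, e}" using assms by (auto simp: triples_def)
  let ?g = "\<lambda>g. \<Sum>c\<in>C. x c a * x c e * x c f * x c g"
  have "s * (\<Sum>c\<in>C. x c a * x c e * x c f) = (\<Sum>c\<in>C. x c a * x c e * x c f * (\<Sum>g\<in>I. x c g))"
    by (simp add: sum_s sum_distrib_left mult_ac)
  also have "\<dots> = sum ?g I"
    by (subst sum.swap) (simp add: sum_distrib_left)
  also have "\<dots> = ?g a + ?g e + ?g f + sum ?g (I - {a, e, f})"
    using sum_Diff_three[OF fin(1) aef, of ?g] by simp
  also have "?g a = (\<Sum>c\<in>C. (x c a * x c a) * (x c e * x c f))" by (simp add: mult_ac)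
  also have "\<dots> = p" using aef two[of e f] by (auto simp: sgn2)
  also have "?g e = (\<Sum>c\<in>C. (x c e * x c e) * (x c a * x c f))" by (simp add: mult_ac)
  also have "\<dots> = p" using aef two[of a f] by (auto simp: sgn2)
  also have "?g f = (\<Sum>c\<in>C. (x c f * x c f) * (x c a * x c e))" by (simp add: mult_ac)
  also have "\<dots> = p" using aef two[of a e] by (auto simp: sgn2)
  also have "sum ?g (I - {a, e, f}) = (\<Sum>g\<in>I - {a, e, f}. t)"
    using aef by (intro sum.cong refl four) (auto simp: quads_def)
  also have "\<dots> = (d - 3) * t"
    using sum_Diff_three[OF fin(1) aef, of "\<lambda>_. t"] d by (simp add: algebra_simps)
  finally show ?thesis by simp
qed

text \<open>\<open>N\<close> is the number of other rows attaining the larger of the two possible inner products.\<close>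

lemma sum_over_rows:
  assumes "y \<in> C"
  shows "\<exists>N. \<forall>f :: real \<Rightarrow> real. (\<Sum>c\<in>C. f (\<Sum>a\<in>I. x c a * x y a)) =
    f d + N * f (d - (q - 1)^2) + (b - 1 - N) * f (d - (q^2 - 1))"
proof (intro exI allI)
  fix f :: "real \<Rightarrow> real"
  let ?w = "\<lambda>c. \<Sum>a\<in>I. x c a * x y a"
  let ?T = "{c \<in> C - {y}. ?w c = d - (q - 1)^2}"
  have "?w y = d" using assms by (simp add: sgn2 d)
  have "(\<Sum>c\<in>C. f (?w c)) = f (?w y) + (\<Sum>c\<in>C - {y}. f (?w c))"
    using fin assms by (simp add: sum_Diff_one)
  also have "(\<Sum>c\<in>C - {y}. f (?w c)) =
      (\<Sum>c\<in>C - {y}. if ?w c = d - (q - 1)^2 then f (d - (q - 1)^2) else f (d - (q^2 - 1)))"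
    using ip[OF _ assms] by (intro sum.cong refl) (metis DiffD1 DiffD2 singletonI)
  also have "\<dots> = real (card ?T) * f (d - (q - 1)^2) +
      real (card (C - {y} - ?T)) * f (d - (q^2 - 1))"
  proof -
    have "(C - {y}) \<inter> {c. ?w c = d - (q - 1)^2} = ?T"
      "(C - {y}) \<inter> - {c. ?w c = d - (q - 1)^2} = C - {y} - ?T" by auto
    then show ?thesis using fin by (simp add: sum.If_cases)
  qed
  also have "real (card (C - {y} - ?T)) = b - 1 - real (card ?T)"
  proof -
    have "card C \<ge> 1" using assms fin by (metis One_nat_def Suc_leI card_gt_0_iff empty_iff)
    moreover have "card ?T \<le> card (C - {y})" using fin by (intro card_mono) auto
    moreover have "card (C - {y} - ?T) = card (C - {y}) - card ?T"
      using fin by (intro card_Diff_subset) auto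
    ultimately show ?thesis using assms fin by (simp add: b of_nat_diff)
  qed
  finally show "(\<Sum>c\<in>C. f (?w c)) = f d + real (card ?T) * f (d - (q - 1)^2) +
      (b - 1 - real (card ?T)) * f (d - (q^2 - 1))"
    using \<open>?w y = d\<close> by simp
qed

text \<open>Here \<open>d = q^2 - q\<close>, and the two possible inner products are
  \<open>q - 1\<close> and its negative. Hence the even polynomial \<open>E\<close> takes one value
  on all other rows, and \<open>four_quads\<close> for a row against the all-one vector is an
  equation in \<open>q\<close> alone.\<close>

lemma s_zero_case:
  assumes "s = 0"
  shows "d = 6 \<and> q = 3 \<and> b = 10"
proof -
  define E where "E = (\<lambda>w. w^4 - (6 * d - 8) * w^2 + 3 * d^2 - 6 * d)"
  have "(d - q^2 + q) * (q - 1 + d) = 0" using s assms by simp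
  then have dq: "d = q^2 - q" using q d4 by simp
  have bq: "b = (q - 1) * (d - 1)"
  proof -
    have "b * q = q * ((q - 1) * (d - 1))"
      using q(3) unfolding dq by (simp add: algebra_simps power2_eq_square)
    then show ?thesis using q by simp
  qed
  have "C \<noteq> {}" using b_pos b by auto
  then obtain y where y: "y \<in> C" by blast
  from sum_over_rows[OF y] obtain N where
    "\<forall>f :: real \<Rightarrow> real. (\<Sum>c\<in>C. f (\<Sum>a\<in>I. x c a * x y a)) =
      f d + N * f (d - (q - 1)^2) + (b - 1 - N) * f (d - (q^2 - 1))" ..
  note N = this[rule_format]
  have vals: "d - (q - 1)^2 = q - 1" "d - (q^2 - 1) = - (q - 1)"
    unfolding dq by (simp_all add: algebra_simps power2_eq_square)
  have "E d + N * E (q - 1) + (b - 1 - N) * E (- (q - 1)) = t * E 0"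
    using four_quads[OF sgn2[OF y]] N[of E] sum_s[OF y] assms unfolding vals E_def by simp
  moreover have "E (- (q - 1)) = E (q - 1)" unfolding E_def by algebra
  ultimately have eq: "E d + (b - 1) * E (q - 1) = t * E 0" by (simp add: algebra_simps)
  have t: "t * ((d - 1) * (d - 3)) = 3 * b"
  proof -
    have "(d * (d - 2)) * (t * ((d - 1) * (d - 3))) = (d * (d - 2)) * (3 * b)"
      using t_eq assms by (simp add: algebra_simps power2_eq_square)
    then show ?thesis using d4 by simp
  qed
  \<comment> \<open>In terms of \<open>u\<close> one has \<open>d = u * (u + 1)\<close>, and the
    equation splits into linear factors. All of them except \<open>u - 2\<close> are positive or
    excluded by \<open>d \<ge> 4\<close>.\<close>
  define u where "u = q - 1"
  have u: "q = u + 1" "u > 0" using q by (auto simp: u_def)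
  have du: "d = u^2 + u" unfolding dq u by algebra
  have bu: "b = u * (d - 1)" using bq u by simp
  have nz: "u \<noteq> 0" "u + 1 \<noteq> 0" "u - 1 \<noteq> 0" "u + 2 \<noteq> 0" "d - 1 \<noteq> 0"
    using u du d4 by auto
  have Ed: "E d = u * (u + 1) * (u - 1) * (u + 2) * ((d - 1) * (d - 3))"
    unfolding E_def du by algebra
  have Eu: "E (q - 1) = - u * (u + 2) * (2 * u^2 - 4 * u + 3)"
    unfolding E_def du u by algebra
  have b1: "b - 1 = (u + 1)^2 * (u - 1)" unfolding bu du by algebra
  have "(d - 1) * (d - 3) - (u + 1) * (2 * u^2 - 4 * u + 3) = u * (u^3 - u - 3)"
    unfolding du by algebra
  moreover have "E d + (b - 1) * E (q - 1) =
    u * (u + 1) * (u - 1) * (u + 2) * ((d - 1) * (d - 3) - (u + 1) * (2 * u^2 - 4 * u + 3))"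
    unfolding Ed Eu b1 by algebra
  ultimately have lhs: "E d + (b - 1) * E (q - 1) = u * (u + 1) * (u - 1) * (u + 2) * (u * (u^3 - u - 3))"
    by simp
  have E0: "E 0 = 3 * u * (u + 1) * (u - 1) * (u + 2)"
    unfolding E_def du by (simp add: algebra_simps power2_eq_square)
  let ?k = "u * (u + 1) * (u - 1) * (u + 2)"
  have "?k * (u * (u^3 - u - 3)) * ((d - 1) * (d - 3)) = t * E 0 * ((d - 1) * (d - 3))"
    using eq lhs by simp
  also have "\<dots> = 3 * ?k * (t * ((d - 1) * (d - 3)))" unfolding E0 by algebra
  also have "\<dots> = 9 * ?k * (u * (d - 1))" unfolding t bu by simp
  finally have "(?k * u * (d - 1)) * ((u^3 - u - 3) * (d - 3)) = (?k * u * (d - 1)) * 9"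
    by (simp only: ac_simps)
  then have "(u^3 - u - 3) * (d - 3) = 9" using nz by simp
  moreover have "(u^3 - u - 3) * (d - 3) - 9 = u^2 * (u + 1) * (u - 2) * (u + 2)"
    unfolding du by algebra
  ultimately have "u = 2" using nz by simp
  then have "q = 3" using u by simp
  then show ?thesis using dq bq by simp
qed

text \<open>With \<open>z\<close> a row, the first-moment identity determines \<open>N\<close>.
  Eliminating \<open>N\<close> from the third-moment identity leaves a polynomial in
  \<open>d\<close> and \<open>q\<close> whose only factor that can vanish is
  \<open>d - q^2 + 2\<close>.\<close>

lemma d_eq:
  assumes "s \<noteq> 0"
  shows "d = q^2 - 2"
proof -
  define E where "E = (\<lambda>w. w^3 - (3 * d - 2) * w)"
  define \<tau> where "\<tau> = (3 * p + (d - 3) * t) / s"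
  define r where "r = (b + (d - 1) * p) / s"
  have r: "(\<Sum>c\<in>C. x c a) = r" if "a \<in> I" for a
    using one_const[OF that] assms by (simp add: r_def field_simps)
  have three: "(\<Sum>c\<in>C. x c a * x c e * x c f) = \<tau>" if "(a, e, f) \<in> triples I" for a e f
    using three_const[OF that] assms by (simp add: \<tau>_def field_simps)
  have sum_one: "(\<Sum>c\<in>C. \<Sum>a\<in>I. x c a * z a) = r * (\<Sum>a\<in>I. z a)" for z
    by (subst sum.swap) (simp add: r sum_distrib_left flip: sum_distrib_right)
  have rd: "r * d = b * s" using sum_one[of "\<lambda>_. 1"] sum_s d b by simp
  have "C \<noteq> {}" using b_pos b by auto
  then obtain y where y: "y \<in> C" by blast
  from sum_over_rows[OF y] obtain N where
    "\<forall>f :: real \<Rightarrow> real. (\<Sum>c\<in>C. f (\<Sum>a\<in>I. x c a * x y a)) =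
      f d + N * f (d - (q - 1)^2) + (b - 1 - N) * f (d - (q^2 - 1))" ..
  note N = this[rule_format]
  let ?A = "d - (q - 1)^2" and ?B = "d - (q^2 - 1)"
  have first: "(d + N * ?A + (b - 1 - N) * ?B) * d = b * s^2"
  proof -
    have "d + N * ?A + (b - 1 - N) * ?B = r * s"
      using N[of "\<lambda>w. w"] sum_one[of "x y"] sum_s[OF y] by simp
    then show ?thesis using rd by (simp add: algebra_simps power2_eq_square)
  qed
  have third: "(E d + N * E ?A + (b - 1 - N) * E ?B) * (d * (d - 1) * (d - 2)) = b * s^2 * (s^2 - 3 * d + 2)^2"
  proof -
    have Ed: "E d = d * (d - 1) * (d - 2)"
      by (simp add: E_def algebra_simps power2_eq_square power3_eq_cube)
    \<comment> \<open>The all-one vector expresses \<open>\<tau>\<close> and the row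
      \<open>y\<close> uses it; multiplying the two relations eliminates
      \<open>\<tau>\<close>.\<close>
    have "\<tau> * E d = b * E s"
      using three_triples[OF three, of "\<lambda>_. 1"] sum_s d b by (simp add: E_def)
    moreover have "E d + N * E ?A + (b - 1 - N) * E ?B = \<tau> * E s"
      using three_triples[OF three sgn2[OF y]] N[of E] sum_s[OF y] by (simp add: E_def)
    ultimately have "(E d + N * E ?A + (b - 1 - N) * E ?B) * E d = b * (E s)^2"
      by (simp add: power2_eq_square algebra_simps)
    also have "\<dots> = b * s^2 * (s^2 - 3 * d + 2)^2"
      by (simp add: E_def algebra_simps power2_eq_square power3_eq_cube)
    finally show ?thesis unfolding Ed .
  qed
  have qd: "q^2 - d \<noteq> 0" "d \<noteq> 0" "q - 1 \<noteq> 0" using q d4 by auto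
  \<comment> \<open>The multiple by \<open>2 * (q^2 - d)\<close> is polynomial in \<open>d\<close>
    and \<open>q\<close>, as \<open>b * (q^2 - d)\<close> is. \<open>M2\<close> is its counterpart
    for the smaller inner product.\<close>
  have N2: "2 * (q^2 - d) * N = - (q + 1) * (q^2 - d) + (d - 1) * (2 * d - q * (q - 1))" (is "?l = ?r")
  proof -
    have "((q - 1) * d) * ?l =
      (q^2 - d) * ((d + N * ?A + (b - 1 - N) * ?B) * d) - d * d * (q^2 - d)
        - (b * (q^2 - d) - (q^2 - d)) * ?B * d"
      by algebra
    also have "\<dots> = b * (q^2 - d) * s^2 - d * d * (q^2 - d) - (b * (q^2 - d) - (q^2 - d)) * ?B * d"
      unfolding first by simp
    also have "\<dots> = ((q - 1) * d) * ?r"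
      unfolding q(3) s(2) by algebra
    finally show ?thesis using qd mult_left_cancel[of "(q - 1) * d" ?l ?r] by simp
  qed
  have M2: "2 * (q^2 - d) * (b - 1 - N) = (q - 1) * (q^2 - d + (d - 1) * q)"
  proof -
    have "2 * (q^2 - d) * (b - 1 - N) = 2 * (b * (q^2 - d)) - 2 * (q^2 - d) - 2 * (q^2 - d) * N" by algebra
    also have "\<dots> = (q - 1) * (q^2 - d + (d - 1) * q)" unfolding q(3) N2 by algebra
    finally show ?thesis .
  qed
  have EA: "E ?A = ?A^3 - (3 * d - 2) * ?A" and EB: "E ?B = ?B^3 - (3 * d - 2) * ?B"
    by (simp_all add: E_def)
  have "d * (d - 1) * ((2 * (q^2 - d) * E d + 2 * (q^2 - d) * N * E ?A + 2 * (q^2 - d) * (b - 1 - N) * E ?B) * (d - 2)) =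
      2 * (q^2 - d) * ((E d + N * E ?A + (b - 1 - N) * E ?B) * (d * (d - 1) * (d - 2)))"
    by algebra
  also have "\<dots> = 2 * (b * (q^2 - d)) * s^2 * (s^2 - 3 * d + 2)^2"
    unfolding third by simp
  also have "\<dots> = d * (d - 1) * (2 * s^2 * (s^2 - 3 * d + 2)^2)" unfolding q(3) by simp
  finally have "(2 * (q^2 - d) * E d + 2 * (q^2 - d) * N * E ?A + 2 * (q^2 - d) * (b - 1 - N) * E ?B) * (d - 2)
      - 2 * s^2 * (s^2 - 3 * d + 2)^2 = 0"
    using qd d4 by simp
  moreover have "(2 * (q^2 - d) * E d + 2 * (q^2 - d) * N * E ?A + 2 * (q^2 - d) * (b - 1 - N) * E ?B) * (d - 2)
      - 2 * s^2 * (s^2 - 3 * d + 2)^2 = - 2 * (q - 1)^4 * (q + 1)^2 * (d - q^2 + 2) * (d + q)"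
    unfolding N2 M2 EA EB s(2) unfolding E_def by algebra
  ultimately have "(q - 1)^4 * (q + 1)^2 * (d - q^2 + 2) * (d + q) = 0" by simp
  moreover have "d + q \<noteq> 0" "q + 1 \<noteq> 0" using q d4 by auto
  ultimately have "d - q^2 + 2 = 0" using qd by simp
  then show ?thesis by simp
qed

text \<open>Expand the indicator as a product of factors \<open>(1 + x) / 2\<close> and insert the
  moments. With k = (d + s) / 2 positive entries per row, this is the usual block count of a
  3-design.\<close>

lemma triple_count:
  assumes "s \<noteq> 0" and aef: "(a, e, f) \<in> triples I"
  shows "8 * d * (d - 1) * (d - 2) * real (card {c \<in> C. x c a = 1 \<and> x c e = 1 \<and> x c f = 1}) =
    b * (d + s) * (d + s - 2) * (d + s - 4)"
proof -
  have I: "a \<in> I" "e \<in> I" "f \<in> I" "a \<noteq> e" "a \<noteq> f" "e \<noteq> f" using aef by (auto simp: triples_def)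
  have r: "(\<Sum>c\<in>C. x c a) * d = b * s" if "a \<in> I" for a
  proof -
    have "(\<Sum>c\<in>C. x c e) = (\<Sum>c\<in>C. x c a)" if "e \<in> I" for e
    proof -
      have "s * (\<Sum>c\<in>C. x c e) = s * (\<Sum>c\<in>C. x c a)"
        unfolding one_const[OF that] one_const[OF \<open>a \<in> I\<close>] ..
      then show ?thesis using assms(1) by simp
    qed
    then have "(\<Sum>e\<in>I. \<Sum>c\<in>C. x c e) = d * (\<Sum>c\<in>C. x c a)" by (simp add: d)
    moreover have "(\<Sum>e\<in>I. \<Sum>c\<in>C. x c e) = b * s"
      by (subst sum.swap) (simp add: sum_s b)
    ultimately show ?thesis by simp
  qed
  have \<tau>: "(\<Sum>c\<in>C. x c a * x c e * x c f) * (d * (d - 1) * (d - 2)) = b * (s^3 - (3 * d - 2) * s)"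
  proof -
    let ?\<tau> = "\<Sum>c\<in>C. x c a * x c e * x c f"
    have "(\<Sum>c\<in>C. x c i * x c j * x c k) = ?\<tau>" if "(i, j, k) \<in> triples I" for i j k
    proof -
      have "s * (\<Sum>c\<in>C. x c i * x c j * x c k) = s * ?\<tau>"
        unfolding three_const[OF that] three_const[OF aef] ..
      then show ?thesis using assms(1) by simp
    qed
    from three_triples[OF this, of "\<lambda>_. 1"] show ?thesis
      using sum_s d b by (simp add: algebra_simps power2_eq_square power3_eq_cube)
  qed
  have "8 * real (card {c \<in> C. x c a = 1 \<and> x c e = 1 \<and> x c f = 1}) =
      (\<Sum>c\<in>C. 8 * (if x c a = 1 \<and> x c e = 1 \<and> x c f = 1 then 1 else 0))"
    using fin by (simp add: sum.If_cases Int_def flip: sum_distrib_left)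
  also have "\<dots> = (\<Sum>c\<in>C. (1 + x c a) * (1 + x c e) * (1 + x c f))"
  proof (rule sum.cong[OF refl])
    fix c assume "c \<in> C"
    then show "8 * (if x c a = 1 \<and> x c e = 1 \<and> x c f = 1 then 1 else 0) = (1 + x c a) * (1 + x c e) * (1 + x c f)"
      using sgn[of c a] sgn[of c e] sgn[of c f] I by auto
  qed
  also have "\<dots> = b + ((\<Sum>c\<in>C. x c a) + (\<Sum>c\<in>C. x c e) + (\<Sum>c\<in>C. x c f)) +
      ((\<Sum>c\<in>C. x c a * x c e) + (\<Sum>c\<in>C. x c a * x c f) + (\<Sum>c\<in>C. x c e * x c f)) +
      (\<Sum>c\<in>C. x c a * x c e * x c f)"
  proof -
    have "(1 + u) * (1 + v) * (1 + w) = 1 + (u + v + w) + (u * v + u * w + v * w) + u * v * w"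
      for u v w :: real by algebra
    then show ?thesis by (simp add: b sum.distrib)
  qed
  also have "\<dots> = b + ((\<Sum>c\<in>C. x c a) + (\<Sum>c\<in>C. x c e) + (\<Sum>c\<in>C. x c f)) + 3 * p +
      (\<Sum>c\<in>C. x c a * x c e * x c f)"
    using two I by simp
  finally have eight: "8 * real (card {c \<in> C. x c a = 1 \<and> x c e = 1 \<and> x c f = 1}) =
      b + ((\<Sum>c\<in>C. x c a) + (\<Sum>c\<in>C. x c e) + (\<Sum>c\<in>C. x c f)) + 3 * p +
      (\<Sum>c\<in>C. x c a * x c e * x c f)" .
  have "8 * d * (d - 1) * (d - 2) * real (card {c \<in> C. x c a = 1 \<and> x c e = 1 \<and> x c f = 1}) =
    (d * (d - 1) * (d - 2)) * (8 * real (card {c \<in> C. x c a = 1 \<and> x c e = 1 \<and> x c f = 1}))"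
    by simp
  also have "\<dots> =
    d * (d - 1) * (d - 2) * b + ((\<Sum>c\<in>C. x c a) * d + (\<Sum>c\<in>C. x c e) * d + (\<Sum>c\<in>C. x c f) * d) * ((d - 1) * (d - 2))
     + 3 * (p * (d * (d - 1))) * (d - 2) + (\<Sum>c\<in>C. x c a * x c e * x c f) * (d * (d - 1) * (d - 2))"
    unfolding eight by algebra
  also have "\<dots> = d * (d - 1) * (d - 2) * b + 3 * (b * s) * ((d - 1) * (d - 2)) + 3 * (b * (s^2 - d)) * (d - 2) +
      b * (s^3 - (3 * d - 2) * s)"
    unfolding r[OF I(1)] r[OF I(2)] r[OF I(3)] p_eq \<tau> by algebra
  also have "\<dots> = b * (d + s) * (d + s - 2) * (d + s - 4)" by algebra
  finally show ?thesis .
qed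

lemma s_Ints: "s \<in> \<int>"
proof -
  obtain y where y: "y \<in> C" using b_pos b by fastforce
  have "(\<Sum>a\<in>I. x y a) \<in> \<int>" using sgn[OF y] by (intro Ints_sum) force
  then show ?thesis using sum_s[OF y] by simp
qed

lemma q_values:
  assumes "s \<noteq> 0"
  shows "d = 7 \<and> q = 3 \<and> s = -3 \<and> b = 21 \<or> d = 23 \<and> q = 5 \<and> s = -9 \<and> b = 253"
proof -
  note dq = d_eq[OF assms]
  have b2: "2 * b = d * (d - 1)" using q(3) dq by simp
  have s2: "s^2 = (q - 2) * (q^2 + q - 3)" unfolding s(2) unfolding dq by algebra
  \<comment> \<open>This makes \<open>q\<close> a quotient of integers. Since
    \<open>q^2 = d + 2\<close> is an integer too, so is \<open>q\<close>.\<close>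
  have "q * (d - 3) = s^2 + d - 4" unfolding s2 unfolding dq by algebra
  then have "q = (s^2 + d - 4) / (d - 3)" using d4 by (simp add: field_simps)
  moreover have "s \<in> \<rat>" "d \<in> \<rat>" using s_Ints Ints_subset_Rats d by auto
  ultimately have "q \<in> \<rat>" by simp
  moreover have "q^2 \<in> \<int>" using dq d by (metis Ints_add Ints_numeral Ints_of_nat diff_add_cancel)
  ultimately have "q \<in> \<int>" by (rule Rats_square_Ints)
  then obtain m where m: "q = of_int m" by (auto elim: Ints_cases)
  obtain k where k: "s = of_int k" using s_Ints by (auto elim: Ints_cases)
  have "\<exists>a e f. (a, e, f) \<in> triples I"
  proof -
    have "real (card (triples I)) \<noteq> 0" using d4 by (simp add: card_triples[OF fin(1)] flip: d)
    then have "triples I \<noteq> {}" by auto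
    then obtain w where "w \<in> triples I" by blast
    then show ?thesis by (cases w) auto
  qed
  then obtain a e f where aef: "(a, e, f) \<in> triples I" by blast
  let ?n = "card {c \<in> C. x c a = 1 \<and> x c e = 1 \<and> x c f = 1}"
  have "d * (d - 1) * (16 * (d - 2) * real ?n) = 2 * (8 * d * (d - 1) * (d - 2) * real ?n)"
    by algebra
  also have "\<dots> = (2 * b) * ((d + s) * (d + s - 2) * (d + s - 4))"
    unfolding triple_count[OF assms aef] by algebra
  finally have "d * (d - 1) * (16 * (d - 2) * real ?n) = d * (d - 1) * ((d + s) * (d + s - 2) * (d + s - 4))"
    unfolding b2 .
  then have "16 * (d - 2) * real ?n = (d + s) * (d + s - 2) * (d + s - 4)"
    using d4 by simp
  then have "of_int (16 * (m^2 - 4) * int ?n) =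
      (of_int ((m^2 - 2 + k) * (m^2 - 4 + k) * (m^2 - 6 + k)) :: real)"
    unfolding dq m k by (simp add: algebra_simps)
  then have n: "16 * (m^2 - 4) * int ?n = (m^2 - 2 + k) * (m^2 - 4 + k) * (m^2 - 6 + k)"
    by (simp only: of_int_eq_iff)
  have "of_int (k^2) = (of_int ((m - 2) * (m^2 + m - 3)) :: real)" using s2 m k by simp
  then have k2: "k^2 = (m - 2) * (m^2 + m - 3)" by (simp only: of_int_eq_iff)
  have "m > 2"
  proof -
    have "\<not> q \<le> 2"
    proof
      assume "q \<le> 2"
      then have "q^2 \<le> 2^2" using q by (intro power_mono) auto
      then show False using dq d4 by simp
    qed
    then show ?thesis using m by simp
  qed
  \<comment> \<open>Modulo \<open>m - 2\<close> one has \<open>m^2 = 4\<close> and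
    \<open>k^2 = 0\<close>, so that \<open>n\<close> reads
    \<open>0 = (k + 2) * k * (k - 2) = - 4 * k\<close>. Squaring and cancelling one factor
    \<open>m - 2\<close> from \<open>k^2\<close> then leaves a divisor of
    \<open>16 * 3 = 48\<close>.\<close>
  have "m - 2 dvd 4 * k"
  proof -
    have "4 * k = 16 * (m^2 - 4) * int ?n * (- 1) + (m - 2) * (m + 2) * ((m^2 - 4) * (m^2 - 4) - 4 + 3 * (m^2 - 4) * k)
      + 3 * (m^2 - 4) * k^2 + k * k^2"
      unfolding n by algebra
    also have "\<dots> = (m - 2) * (16 * (m + 2) * int ?n * (- 1) + (m + 2) * ((m^2 - 4) * (m^2 - 4) - 4 + 3 * (m^2 - 4) * k)
      + 3 * (m^2 - 4) * (m^2 + m - 3) + k * (m^2 + m - 3))"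
      unfolding k2 by algebra
    finally show ?thesis by (rule dvdI)
  qed
  then have "(m - 2)^2 dvd (4 * k)^2" by (rule dvd_power_same)
  also have "(4 * k)^2 = (m - 2) * (16 * (m^2 + m - 3))" using k2 by (simp add: power_mult_distrib)
  finally have "m - 2 dvd 16 * (m^2 + m - 3)" using \<open>m > 2\<close> by (simp add: power2_eq_square)
  moreover have "16 * (m^2 + m - 3) = (m - 2) * (16 * (m + 3)) + 48" by algebra
  ultimately have "m - 2 dvd 48" by (metis dvd_add_right_iff dvd_triv_left)
  then have "m - 2 \<le> 48" by (rule zdvd_imp_le) simp
  then have "m - 2 \<in> set [1..48]" using \<open>m > 2\<close> by simp
  moreover have "\<forall>j \<in> set [1..48]. j dvd (48 :: int) \<longrightarrow> j \<in> {1, 2, 3, 4, 6, 8, 12, 16, 24, 48}"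
    by code_simp
  ultimately have "m - 2 \<in> {1, 2, 3, 4, 6, 8, 12, 16, 24, 48}"
    using \<open>m - 2 dvd 48\<close> by blast
  then have "m \<in> {3, 4, 5, 6, 8, 10, 14, 18, 26, 50}" by auto
  \<comment> \<open>These are the values of \<open>(m - 2) * (m^2 + m - 3)\<close> for the
    candidates other than 3 and 5; none is a square.\<close>
  moreover have "k^2 \<noteq> 34" "k^2 \<noteq> 156" "k^2 \<noteq> 414" "k^2 \<noteq> 856" "k^2 \<noteq> 2484"
      "k^2 \<noteq> 5424" "k^2 \<noteq> 16776" "k^2 \<noteq> 122256"
    using nonsquare[of 5 34 k] nonsquare[of 12 156 k] nonsquare[of 20 414 k] nonsquare[of 29 856 k]
      nonsquare[of 49 2484 k] nonsquare[of 73 5424 k] nonsquare[of 129 16776 k] nonsquare[of 349 122256 k] by simp_all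
  ultimately have m35: "m = 3 \<or> m = 5" using k2 by auto
  then show ?thesis
  proof
    assume m3: "m = 3"
    then have "k^2 = 3^2" using k2 by simp
    then have "k = 3 \<or> k = -3" by (simp only: power2_eq_iff)
    then have "s = -3" using k s(1) by auto
    then show ?thesis using m m3 dq b2 by simp
  next
    assume m5: "m = 5"
    then have "k^2 = 9^2" using k2 by simp
    then have "k = 9 \<or> k = -9" by (simp only: power2_eq_iff)
    then have "s = -9" using k s(1) by auto
    then show ?thesis using m m5 dq b2 by simp
  qed
qed

text \<open>The expansion of \<open>triple_count\<close> with one more factor; the moments are -99,
  29, -3 and -3, and 253 - 4 * 99 + 6 * 29 - 4 * 3 - 3 = 16.\<close>

lemma quad_count:
  assumes d23: "d = 23" "s = -9" "b = 253" and aefg: "(a, e, f, g) \<in> quads I"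
  shows "card {c \<in> C. x c a = 1 \<and> x c e = 1 \<and> x c f = 1 \<and> x c g = 1} = 1"
proof -
  have I: "a \<in> I" "e \<in> I" "f \<in> I" "g \<in> I" "a \<noteq> e" "a \<noteq> f" "a \<noteq> g" "e \<noteq> f" "e \<noteq> g" "f \<noteq> g"
    using aefg by (auto simp: quads_def)
  have p: "p = 29" using p_eq d23 by simp
  have t: "t = -3" using t_eq d23 by simp
  have one: "(\<Sum>c\<in>C. x c i) = -99" if "i \<in> I" for i
    using one_const[OF that] d23 p by simp
  have three: "(\<Sum>c\<in>C. x c i * x c j * x c k) = -3" if "(i, j, k) \<in> triples I" for i j k
    using three_const[OF that] d23 p t by simp
  have "16 * real (card {c \<in> C. x c a = 1 \<and> x c e = 1 \<and> x c f = 1 \<and> x c g = 1}) =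
      (\<Sum>c\<in>C. 16 * (if x c a = 1 \<and> x c e = 1 \<and> x c f = 1 \<and> x c g = 1 then 1 else 0))"
    using fin by (simp add: sum.If_cases Int_def flip: sum_distrib_left)
  also have "\<dots> = (\<Sum>c\<in>C. (1 + x c a) * (1 + x c e) * (1 + x c f) * (1 + x c g))"
  proof (rule sum.cong[OF refl])
    fix c assume "c \<in> C"
    then show "16 * (if x c a = 1 \<and> x c e = 1 \<and> x c f = 1 \<and> x c g = 1 then 1 else 0) =
        (1 + x c a) * (1 + x c e) * (1 + x c f) * (1 + x c g)"
      using sgn[of c a] sgn[of c e] sgn[of c f] sgn[of c g] I by auto
  qed
  also have "\<dots> = b + ((\<Sum>c\<in>C. x c a) + (\<Sum>c\<in>C. x c e) + (\<Sum>c\<in>C. x c f) + (\<Sum>c\<in>C. x c g)) +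
      ((\<Sum>c\<in>C. x c a * x c e) + (\<Sum>c\<in>C. x c a * x c f) + (\<Sum>c\<in>C. x c a * x c g) +
       (\<Sum>c\<in>C. x c e * x c f) + (\<Sum>c\<in>C. x c e * x c g) + (\<Sum>c\<in>C. x c f * x c g)) +
      ((\<Sum>c\<in>C. x c a * x c e * x c f) + (\<Sum>c\<in>C. x c a * x c e * x c g) +
       (\<Sum>c\<in>C. x c a * x c f * x c g) + (\<Sum>c\<in>C. x c e * x c f * x c g)) +
      (\<Sum>c\<in>C. x c a * x c e * x c f * x c g)"
  proof -
    have "(1 + u) * (1 + v) * (1 + w) * (1 + z) = 1 + (u + v + w + z) +
        (u * v + u * w + u * z + v * w + v * z + w * z) +
        (u * v * w + u * v * z + u * w * z + v * w * z) + u * v * w * z"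
      for u v w z :: real by algebra
    then show ?thesis by (simp add: b sum.distrib)
  qed
  also have "\<dots> = 16"
    using I two four[OF aefg] by (simp add: one three triples_def p t d23)
  finally show ?thesis by simp
qed

end

section \<open>Orthogonal maps from Gram matrices\<close>

text \<open>The last property recovers the image of any vector from its inner products with the
  basis. It identifies the images of the remaining lines without expanding them in the
  basis.\<close>

lemma gram_isometry:
  fixes u :: "'i \<Rightarrow> real^'n" and w :: "'i \<Rightarrow> real^'m"
  assumes card: "CARD('n) = CARD('m)" and inj: "inj_on u A"
    and indep: "independent (u ` A)" and span: "span (u ` A) = UNIV"
    and gram: "\<And>i j. i \<in> A \<Longrightarrow> j \<in> A \<Longrightarrow> w i \<bullet> w j = u i \<bullet> u j"
  obtains f :: "real^'n \<Rightarrow> real^'m"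
    where "linear f" "bij f" "\<And>v v'. f v \<bullet> f v' = v \<bullet> v'" "\<And>i. i \<in> A \<Longrightarrow> f (u i) = w i"
      "\<And>v y. (\<And>i. i \<in> A \<Longrightarrow> v \<bullet> u i = y \<bullet> w i) \<Longrightarrow> f v = y"
proof -
  obtain f where f: "linear f" "\<forall>x \<in> u ` A. f x = w (the_inv_into A u x)"
    using linear_independent_extend[OF indep, of "\<lambda>x. w (the_inv_into A u x)"] by blast
  have fu: "f (u i) = w i" if "i \<in> A" for i
    using f(2) that inj by (simp add: the_inv_into_f_f)
  have ip: "f v \<bullet> f v' = v \<bullet> v'" for v v'
  proof (rule bilinear_eq[where B = "u ` A" and C = "u ` A" and S = UNIV and T = UNIV])
    show "bilinear (\<lambda>v v'. f v \<bullet> f v')"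
      unfolding bilinear_def using f(1) by (auto intro!: linearI simp: linear_add linear_scale inner_add)
    show "bilinear ((\<bullet>) :: real^'n \<Rightarrow> _)"
      unfolding bilinear_def by (auto intro!: linearI simp: inner_add)
  qed (use span gram fu in auto)
  have "inj f"
    unfolding linear_injective_0[OF f(1)] using ip by (metis inner_eq_zero_iff inner_zero_left)
  have "surj f"
  proof -
    have "dim (range f) = dim (UNIV :: (real^'n) set)"
      using \<open>inj f\<close> by (intro dim_image_eq[OF f(1)]) auto
    then have "dim (range f) = DIM(real^'m)" using card by simp
    then have "span (range f) = UNIV" using dim_eq_full by blast
    then show ?thesis using f(1) by (simp add: span_linear_image)
  qed
  have "f v = y" if "\<And>i. i \<in> A \<Longrightarrow> v \<bullet> u i = y \<bullet> w i" for v y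
  proof -
    obtain v' where v': "y = f v'" using \<open>surj f\<close> by (metis surjD)
    have "(v - v') \<bullet> z = 0" for z
    proof -
      have "z \<in> span (u ` A)" using span by simp
      then show ?thesis
      proof (induction rule: span_induct_alt)
        case (step c x z)
        then obtain i where "i \<in> A" "x = u i" by blast
        then have "(v - v') \<bullet> x = 0"
          using that[of i] v' ip[of v' "u i"] fu[of i] by (simp add: inner_diff_left)
        then show ?case using step by (simp add: inner_add_right)
      qed simp
    qed
    then show ?thesis using v' by (metis inner_eq_zero_iff right_minus_eq)
  qed
  then show ?thesis using that f(1) \<open>inj f\<close> \<open>surj f\<close> ip fu unfolding bij_def by blast
qed

section \<open>Oriented equiangular lines\<close>

text \<open>\<open>orient\<close> gives all rows outside \<Gamma> the same sign of the coordinate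
  sum. \<open>no_const\<close> expresses the maximality of \<Gamma>: a line with inner product
  \<open>- 1 / q\<close> to all of \<Gamma> could be added to it.\<close>

locale oriented_lines =
  fixes \<Omega> \<Gamma> :: "(real^'n) set set" and u :: "(real^'n) set \<Rightarrow> real^'n" and q :: real
  assumes fin: "finite \<Omega>" and sub: "\<Gamma> \<subseteq> \<Omega>" and card_\<Gamma>: "card \<Gamma> = CARD('n)"
    and q: "q > 1" "q^2 > CARD('n)"
    and card_\<Omega>: "card \<Omega> * (q^2 - CARD('n)) = CARD('n) * (q^2 - 1)"
    and unit: "\<And>L. L \<in> \<Omega> \<Longrightarrow> u L \<bullet> u L = 1"
    and span: "\<And>L. L \<in> \<Omega> \<Longrightarrow> span {u L} = L"
    and angle: "\<And>L M. L \<in> \<Omega> \<Longrightarrow> M \<in> \<Omega> \<Longrightarrow> L \<noteq> M \<Longrightarrow> u L \<bullet> u M = 1 / q \<or> u L \<bullet> u M = - 1 / q"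
    and angle_\<Gamma>: "\<And>L M. L \<in> \<Gamma> \<Longrightarrow> M \<in> \<Gamma> \<Longrightarrow> L \<noteq> M \<Longrightarrow> u L \<bullet> u M = 1 / q"
    and orient: "\<And>L. L \<in> \<Omega> - \<Gamma> \<Longrightarrow> (\<Sum>M\<in>\<Gamma>. u L \<bullet> u M) \<le> 0"
    and no_const: "\<And>L. L \<in> \<Omega> - \<Gamma> \<Longrightarrow> \<exists>M \<in> \<Gamma>. u L \<bullet> u M = 1 / q"
begin

definition d :: real where "d = real CARD('n)"

definition x :: "(real^'n) set \<Rightarrow> (real^'n) set \<Rightarrow> real" where "x L M = q * (u L \<bullet> u M)"

lemma d_pos: "d \<ge> 1" by (simp add: d_def Suc_leI)

lemma fin_\<Gamma>: "finite \<Gamma>" using fin sub finite_subset by blast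

lemma inner_\<Gamma>: "L \<in> \<Gamma> \<Longrightarrow> M \<in> \<Gamma> \<Longrightarrow> u L \<bullet> u M = (if L = M then 1 else 1 / q)"
  using unit angle_\<Gamma> sub by auto

lemma combination_inner:
  assumes "M \<in> \<Gamma>"
  shows "(\<Sum>L\<in>\<Gamma>. c L *\<^sub>R u L) \<bullet> u M = c M * (1 - 1 / q) + (\<Sum>L\<in>\<Gamma>. c L) / q"
proof -
  have "(\<Sum>L\<in>\<Gamma>. c L *\<^sub>R u L) \<bullet> u M = (\<Sum>L\<in>\<Gamma>. (if L = M then c M * (1 - 1 / q) else 0) + c L / q)"
    unfolding inner_sum_left using assms by (intro sum.cong refl) (auto simp: inner_\<Gamma> algebra_simps)
  then show ?thesis using fin_\<Gamma> assms by (simp add: sum.distrib sum_divide_distrib)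
qed

text \<open>The Gram matrix is positive definite since \<open>q > 1\<close>; this is where the
  linear independence of \<Gamma> comes from.\<close>

lemma combination_norm:
  "(\<Sum>L\<in>\<Gamma>. c L *\<^sub>R u L) \<bullet> (\<Sum>L\<in>\<Gamma>. c L *\<^sub>R u L) = (1 - 1 / q) * (\<Sum>L\<in>\<Gamma>. c L ^ 2) + (\<Sum>L\<in>\<Gamma>. c L)^2 / q"
proof -
  have "(\<Sum>L\<in>\<Gamma>. c L *\<^sub>R u L) \<bullet> (\<Sum>L\<in>\<Gamma>. c L *\<^sub>R u L) =
    (\<Sum>M\<in>\<Gamma>. c M * ((\<Sum>L\<in>\<Gamma>. c L *\<^sub>R u L) \<bullet> u M))"
    by (subst inner_sum_right) simp
  also have "\<dots> = (\<Sum>M\<in>\<Gamma>. (1 - 1 / q) * c M ^ 2 + (\<Sum>L\<in>\<Gamma>. c L) / q * c M)"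
    by (intro sum.cong refl) (simp add: combination_inner algebra_simps power2_eq_square)
  also have "\<dots> = (1 - 1 / q) * (\<Sum>L\<in>\<Gamma>. c L ^ 2) + (\<Sum>L\<in>\<Gamma>. c L) / q * (\<Sum>L\<in>\<Gamma>. c L)"
    unfolding sum.distrib sum_distrib_left[symmetric] ..
  finally show ?thesis by (simp add: power2_eq_square)
qed

lemma inj_u: "inj_on u \<Omega>"
  using span by (metis inj_onI)

lemma independent_u: "independent (u ` \<Gamma>)"
proof (rule independent_if_scalars_zero)
  show "finite (u ` \<Gamma>)" using fin_\<Gamma> by simp
next
  fix f v assume f: "(\<Sum>v\<in>u ` \<Gamma>. f v *\<^sub>R v) = 0" and v: "v \<in> u ` \<Gamma>"
  have "(\<Sum>L\<in>\<Gamma>. f (u L) *\<^sub>R u L) = 0"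
    using f sum.reindex[OF inj_on_subset[OF inj_u sub], of "\<lambda>v. f v *\<^sub>R v"] by simp
  then have "(1 - 1 / q) * (\<Sum>L\<in>\<Gamma>. f (u L) ^ 2) + (\<Sum>L\<in>\<Gamma>. f (u L))^2 / q = 0"
    using combination_norm[of "\<lambda>L. f (u L)"] by simp
  moreover have "(\<Sum>L\<in>\<Gamma>. f (u L))^2 / q \<ge> 0" "(\<Sum>L\<in>\<Gamma>. f (u L) ^ 2) \<ge> 0"
    using q by (auto intro: sum_nonneg)
  moreover have "1 - 1 / q > 0" using q by simp
  ultimately have "(\<Sum>L\<in>\<Gamma>. f (u L) ^ 2) = 0"
    by (metis add_nonneg_eq_0_iff less_eq_real_def mult_eq_0_iff mult_nonneg_nonneg less_irrefl)
  then show "f v = 0" using v fin_\<Gamma> by (auto simp: sum_nonneg_eq_0_iff)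
qed

lemma span_u: "span (u ` \<Gamma>) = UNIV"
proof -
  have "card (u ` \<Gamma>) = CARD('n)" using card_\<Gamma> card_image[OF inj_on_subset[OF inj_u sub]] by simp
  then have "dim (u ` \<Gamma>) = DIM(real^'n)" using dim_eq_card_independent[OF independent_u] by simp
  then show ?thesis using dim_eq_full by blast
qed

lemma eq_if_inner_eq:
  assumes "\<And>M. M \<in> \<Gamma> \<Longrightarrow> v \<bullet> u M = w \<bullet> u M"
  shows "v = w"
proof -
  have "(v - w) \<bullet> z = 0" for z
  proof -
    have "z \<in> span (u ` \<Gamma>)" using span_u by simp
    then show ?thesis
      by (induction rule: span_induct_alt) (use assms in \<open>auto simp: inner_add_right inner_diff_left\<close>)
  qed
  then show ?thesis by (metis inner_eq_zero_iff right_minus_eq)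
qed

text \<open>The right-hand side comes from inverting the Gram matrix \<open>(1 - 1 / q) I + (1 / q) J\<close>.\<close>

lemma inner_via_coordinates:
  assumes v: "\<And>M. M \<in> \<Gamma> \<Longrightarrow> v \<bullet> u M = y M / q" and w: "\<And>M. M \<in> \<Gamma> \<Longrightarrow> w \<bullet> u M = z M / q"
  shows "q * (q - 1) * (v \<bullet> w) = (\<Sum>M\<in>\<Gamma>. y M * z M) - (\<Sum>M\<in>\<Gamma>. y M) * (\<Sum>M\<in>\<Gamma>. z M) / (q - 1 + d)"
proof -
  define Y where "Y = (\<Sum>M\<in>\<Gamma>. y M)"
  \<comment> \<open>Solution of \<open>(q - 1) * c M + sum c \<Gamma> = y M\<close>; summing over
    \<open>M\<close> gives \<open>sum c \<Gamma> = Y / (q - 1 + d)\<close>.\<close>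
  define c where "c = (\<lambda>M. (y M - Y / (q - 1 + d)) / (q - 1))"
  have pos: "q - 1 > 0" "q - 1 + d > 0" "q > 0" using q d_pos by auto
  have "(\<Sum>M\<in>\<Gamma>. c M) = (Y - d * (Y / (q - 1 + d))) / (q - 1)"
    by (simp add: c_def Y_def sum_subtractf card_\<Gamma> d_def flip: sum_divide_distrib)
  also have "Y - d * (Y / (q - 1 + d)) = (q - 1) * (Y / (q - 1 + d))"
  proof -
    have shift: "Y - d * e = (q - 1) * e" if "Y = (q - 1 + d) * e" for e
      using that by (simp add: algebra_simps)
    show ?thesis by (rule shift) (use pos in simp)
  qed
  also have "(q - 1) * (Y / (q - 1 + d)) / (q - 1) = Y / (q - 1 + d)" using pos by simp
  finally have sum_c: "(\<Sum>M\<in>\<Gamma>. c M) = Y / (q - 1 + d)" .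
  have "v = (\<Sum>L\<in>\<Gamma>. c L *\<^sub>R u L)"
  proof (rule eq_if_inner_eq)
    fix M assume M: "M \<in> \<Gamma>"
    have "p * (1 - 1 / q) + e / q = ((q - 1) * p + e) / q" for p e
      using pos by (simp add: field_simps)
    then have "c M * (1 - 1 / q) + Y / (q - 1 + d) / q = ((q - 1) * c M + Y / (q - 1 + d)) / q" .
    also have "(q - 1) * c M = y M - Y / (q - 1 + d)" using pos by (simp add: c_def)
    finally show "v \<bullet> u M = (\<Sum>L\<in>\<Gamma>. c L *\<^sub>R u L) \<bullet> u M"
      using M by (simp add: v combination_inner sum_c)
  qed
  then have "v \<bullet> w = (\<Sum>L\<in>\<Gamma>. c L * (z L / q))"
    using w[unfolded inner_commute[of w]] by (simp add: inner_sum_left)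
  then have "q * (q - 1) * (v \<bullet> w) = (\<Sum>L\<in>\<Gamma>. q * (q - 1) * (c L * (z L / q)))"
    by (simp add: sum_distrib_left)
  also have "\<dots> = (\<Sum>L\<in>\<Gamma>. y L * z L - Y / (q - 1 + d) * z L)"
  proof (rule sum.cong[OF refl])
    fix L
    have "(q - 1) * c L = y L - Y / (q - 1 + d)" using pos by (simp add: c_def)
    have "q * (q - 1) * (c L * (z L / q)) = ((q - 1) * c L) * z L" using pos by simp
    also have "\<dots> = y L * z L - Y / (q - 1 + d) * z L"
      unfolding \<open>(q - 1) * c L = y L - Y / (q - 1 + d)\<close> by (rule left_diff_distrib)
    finally show "q * (q - 1) * (c L * (z L / q)) = y L * z L - Y / (q - 1 + d) * z L" .
  qed
  also have "\<dots> = (\<Sum>M\<in>\<Gamma>. y M * z M) - Y * (\<Sum>M\<in>\<Gamma>. z M) / (q - 1 + d)"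
    by (simp add: sum_subtractf sum_distrib_left sum_divide_distrib)
  finally show ?thesis by (simp add: Y_def)
qed

text \<open>Equality in the relative bound makes the squared distance from the frame operator to
  \<open>(card \<Omega> / d) I\<close> vanish.\<close>

lemma tight_frame: "(\<Sum>L\<in>\<Omega>. (u L \<bullet> v) * (u L \<bullet> w)) = (card \<Omega> / d) * (v \<bullet> w)"
proof -
  define n where "n = real (card \<Omega>)"
  define F where "F = (\<lambda>i j. \<Sum>L\<in>\<Omega>. u L $ i * u L $ j)"
  define m where "m = n / d"
  have dpos: "d > 0" using d_pos by simp
  have "(\<Sum>i\<in>UNIV. F i i) = n"
  proof -
    have "(\<Sum>i\<in>UNIV. u L $ i * u L $ i) = 1" if "L \<in> \<Omega>" for L
      using unit[OF that] by (simp add: inner_vec_def)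
    then show ?thesis unfolding F_def by (subst sum.swap) (simp add: n_def)
  qed
  \<comment> \<open>The frame operator and the Gram matrix have the same Frobenius norm, and
    equiangularity determines the latter.\<close>
  moreover have "(\<Sum>i\<in>UNIV. \<Sum>j\<in>UNIV. (F i j)^2) = n + n * (n - 1) / q^2"
  proof -
    have "(\<Sum>i\<in>UNIV. \<Sum>j\<in>UNIV. (F i j)^2) =
      (\<Sum>i\<in>UNIV. \<Sum>j\<in>UNIV. \<Sum>L\<in>\<Omega>. \<Sum>M\<in>\<Omega>. (u L $ i * u M $ i) * (u L $ j * u M $ j))"
      by (simp add: F_def power2_eq_square sum_product mult_ac)
    also have "\<dots> = (\<Sum>i\<in>UNIV. \<Sum>L\<in>\<Omega>. \<Sum>M\<in>\<Omega>. \<Sum>j\<in>UNIV. (u L $ i * u M $ i) * (u L $ j * u M $ j))"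
      by (subst sum.swap, subst (2) sum.swap) simp
    also have "\<dots> = (\<Sum>L\<in>\<Omega>. \<Sum>M\<in>\<Omega>. \<Sum>i\<in>UNIV. \<Sum>j\<in>UNIV. (u L $ i * u M $ i) * (u L $ j * u M $ j))"
      by (subst sum.swap, subst (2) sum.swap) simp
    also have "\<dots> = (\<Sum>L\<in>\<Omega>. \<Sum>M\<in>\<Omega>. (u L \<bullet> u M)^2)"
      by (simp add: inner_vec_def power2_eq_square sum_product)
    also have "\<dots> = (\<Sum>L\<in>\<Omega>. \<Sum>M\<in>\<Omega>. (if L = M then 1 - 1 / q^2 else 0) + 1 / q^2)"
    proof (intro sum.cong refl)
      fix L M assume "L \<in> \<Omega>" "M \<in> \<Omega>"
      then show "(u L \<bullet> u M)^2 = (if L = M then 1 - 1 / q^2 else 0) + 1 / q^2"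
        using unit[of L] angle[of L M] by (cases "L = M") (auto simp: power_divide)
    qed
    also have "\<dots> = n * (1 - 1 / q^2) + n * (n * (1 / q^2))"
      using fin by (simp add: sum.distrib n_def algebra_simps)
    finally show ?thesis by (simp add: algebra_simps diff_divide_distrib)
  qed
  moreover have "(\<Sum>i\<in>UNIV. \<Sum>j\<in>UNIV. (F i j - (if i = j then m else 0))^2) =
    (\<Sum>i\<in>UNIV. \<Sum>j\<in>UNIV. (F i j)^2) - 2 * m * (\<Sum>i\<in>UNIV. F i i) + d * m^2"
  proof -
    have "(\<Sum>j\<in>UNIV. (F i j - (if i = j then m else 0))^2) = (\<Sum>j\<in>UNIV. (F i j)^2) - 2 * m * F i i + m^2" for i
    proof -
      have "(\<Sum>j\<in>UNIV. (F i j - (if i = j then m else 0))^2) =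
        (\<Sum>j\<in>UNIV. (F i j)^2 + (if i = j then m^2 - 2 * m * F i i else 0))"
        by (intro sum.cong refl) (auto simp: power2_eq_square algebra_simps)
      then show ?thesis by (simp add: sum.distrib)
    qed
    then show ?thesis by (simp add: sum.distrib sum_subtractf d_def sum_distrib_left)
  qed
  ultimately have "(\<Sum>i\<in>UNIV. \<Sum>j\<in>UNIV. (F i j - (if i = j then m else 0))^2) =
    n + n * (n - 1) / q^2 - 2 * m * n + d * m^2" by simp
  also have "\<dots> = n * ((d * (q^2 - 1) - n * (q^2 - d)) / (d * q^2))"
    using dpos q by (simp add: m_def field_simps power2_eq_square)
  also have "\<dots> = 0" using card_\<Omega> by (simp add: n_def d_def)
  finally have "\<forall>i. \<forall>j. (F i j - (if i = j then m else 0))^2 = 0"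
    by (simp add: sum_nonneg_eq_0_iff sum_nonneg)
  then have F: "F i j = (if i = j then m else 0)" for i j
    by (metis power_eq_0_iff eq_iff_diff_eq_0 zero_neq_numeral)
  have "(\<Sum>L\<in>\<Omega>. (u L \<bullet> v) * (u L \<bullet> w)) =
      (\<Sum>L\<in>\<Omega>. \<Sum>i\<in>UNIV. \<Sum>j\<in>UNIV. v $ i * w $ j * (u L $ i * u L $ j))"
    by (simp add: inner_vec_def sum_product mult_ac)
  also have "\<dots> = (\<Sum>i\<in>UNIV. \<Sum>j\<in>UNIV. v $ i * w $ j * F i j)"
    unfolding F_def sum_distrib_left by (subst sum.swap, subst (2) sum.swap) simp
  also have "\<dots> = (\<Sum>i\<in>UNIV. m * (v $ i * w $ i))"
    by (simp add: F if_distrib mult_ac cong: if_cong)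
  also have "\<dots> = m * (v \<bullet> w)" by (simp add: inner_vec_def sum_distrib_left)
  finally show ?thesis by (simp add: m_def n_def)
qed

end

section \<open>Sign vectors of the remaining lines\<close>

context oriented_lines
begin

definition b :: real where "b = real (card (\<Omega> - \<Gamma>))"

text \<open>By \<open>sum_x\<close> the radicand is the squared coordinate sum of any line outside
  \<Gamma>; \<open>orient\<close> selects the negative root.\<close>

definition s :: real where "s = - sqrt ((d - q^2 + q) * (q - 1 + d))"

lemma b_eq: "b * (q^2 - d) = d * (d - 1)"
proof -
  have "b = real (card \<Omega>) - d"
    using card_Diff_subset[OF fin_\<Gamma> sub] card_mono[OF fin sub] card_\<Gamma> by (simp add: b_def d_def)
  then have "b * (q^2 - d) = real (card \<Omega>) * (q^2 - d) - d * (q^2 - d)" by (simp add: left_diff_distrib)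
  also have "real (card \<Omega>) * (q^2 - d) = d * (q^2 - 1)" using card_\<Omega> by (simp add: d_def)
  finally show ?thesis by (simp add: algebra_simps)
qed

lemma x_sign: "x L M = 1 \<or> x L M = -1" if "L \<in> \<Omega> - \<Gamma>" "M \<in> \<Gamma>"
proof -
  have "L \<in> \<Omega>" "M \<in> \<Omega>" "L \<noteq> M" using that sub by blast+
  from angle[OF this] show ?thesis using q by (auto simp: x_def)
qed

lemma x_square: "L \<in> \<Omega> - \<Gamma> \<Longrightarrow> M \<in> \<Gamma> \<Longrightarrow> x L M * x L M = 1"
  using x_sign by fastforce

lemma inner_\<Omega>:
  "q * (q - 1) * (u L \<bullet> u M) =
    (\<Sum>K\<in>\<Gamma>. x L K * x M K) - (\<Sum>K\<in>\<Gamma>. x L K) * (\<Sum>K\<in>\<Gamma>. x M K) / (q - 1 + d)"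
  using inner_via_coordinates[of "u L" "x L" "u M" "x M"] q by (simp add: x_def)

text \<open>That \<open>u L\<close> is a unit vector reads, in coordinates,
  \<open>q * (q - 1) = d - s^2 / (q - 1 + d)\<close>.\<close>

lemma sum_x:
  assumes "L \<in> \<Omega> - \<Gamma>"
  shows "(\<Sum>M\<in>\<Gamma>. x L M) = s" and "s^2 = (d - q^2 + q) * (q - 1 + d)" and "s \<le> 0"
proof -
  let ?s = "\<Sum>M\<in>\<Gamma>. x L M"
  have pos: "q - 1 + d > 0" using q d_pos by auto
  have "(\<Sum>K\<in>\<Gamma>. x L K * x L K) = d" using assms by (simp add: x_square card_\<Gamma> d_def)
  then have "q * (q - 1) = d - ?s * ?s / (q - 1 + d)"
    using inner_\<Omega>[of L L] unit[of L] assms by simp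
  then have sq: "?s^2 = (d - q^2 + q) * (q - 1 + d)"
    using pos by (simp add: field_simps power2_eq_square)
  have "?s = q * (\<Sum>M\<in>\<Gamma>. u L \<bullet> u M)" by (simp add: x_def sum_distrib_left)
  then have "?s \<le> 0" using orient[OF assms] q by (simp add: mult_le_0_iff)
  then have "sqrt (?s^2) = - ?s" by simp
  then show "?s = s" unfolding s_def sq by simp
  then show "s^2 = (d - q^2 + q) * (q - 1 + d)" "s \<le> 0" using sq \<open>?s \<le> 0\<close> by auto
qed

lemma x_inner:
  assumes "L \<in> \<Omega> - \<Gamma>" "M \<in> \<Omega> - \<Gamma>" "L \<noteq> M"
  shows "(\<Sum>K\<in>\<Gamma>. x L K * x M K) = d - (q - 1)^2 \<or> (\<Sum>K\<in>\<Gamma>. x L K * x M K) = d - (q^2 - 1)"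
proof -
  have pos: "q - 1 + d > 0" using q d_pos by auto
  have "s * s / (q - 1 + d) = d - q^2 + q"
    using sum_x(2)[OF assms(1)] pos by (simp add: power2_eq_square)
  then have "(\<Sum>K\<in>\<Gamma>. x L K * x M K) = q * (q - 1) * (u L \<bullet> u M) + (d - q^2 + q)"
    using inner_\<Omega>[of L M] sum_x(1)[OF assms(1)] sum_x(1)[OF assms(2)] by simp
  moreover have "u L \<bullet> u M = 1 / q \<or> u L \<bullet> u M = - 1 / q" using angle assms by auto
  ultimately show ?thesis using q by (auto simp: algebra_simps power2_eq_square)
qed

text \<open>The tight frame identity at \<open>u M\<close> and \<open>u N\<close> gives the sum over
  all of \<Omega>. In the part over \<Gamma>, the two lines \<open>M\<close> and \<open>N\<close>
  contribute \<open>q\<close> each and the others 1.\<close>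

lemma x_pair_const:
  assumes "M \<in> \<Gamma>" "N \<in> \<Gamma>" "M \<noteq> N"
  shows "(\<Sum>L\<in>\<Omega> - \<Gamma>. x L M * x L N) = q * real (card \<Omega>) / d - 2 * q - (d - 2)"
proof -
  have "(\<Sum>L\<in>\<Omega>. x L M * x L N) = q^2 * (\<Sum>L\<in>\<Omega>. (u L \<bullet> u M) * (u L \<bullet> u N))"
    by (simp add: x_def sum_distrib_left power2_eq_square mult_ac)
  also have "\<dots> = q * real (card \<Omega>) / d"
    unfolding tight_frame using angle_\<Gamma>[OF assms] q by (simp add: power2_eq_square)
  finally have "(\<Sum>L\<in>\<Omega>. x L M * x L N) = q * real (card \<Omega>) / d" .
  moreover have "(\<Sum>L\<in>\<Omega>. x L M * x L N) = (\<Sum>L\<in>\<Omega> - \<Gamma>. x L M * x L N) + (\<Sum>L\<in>\<Gamma>. x L M * x L N)"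
    using sum.subset_diff[OF sub fin] .
  moreover have "(\<Sum>L\<in>\<Gamma>. x L M * x L N) = 2 * q + (d - 2)"
  proof -
    have "(\<Sum>L\<in>\<Gamma>. x L M * x L N) = (\<Sum>L\<in>\<Gamma>. (if L = M then q - 1 else 0) + (if L = N then q - 1 else 0) + 1)"
      using assms q by (intro sum.cong refl) (auto simp: x_def inner_\<Gamma>)
    then show ?thesis using assms fin_\<Gamma> by (simp add: sum.distrib card_\<Gamma> d_def)
  qed
  ultimately show ?thesis by simp
qed

text \<open>Triple products are unchanged by reorientation, so they may be computed with
  \<open>u\<close>. On \<Gamma> they are positive, and elsewhere their sign is that of the two
  entries.\<close>

lemma S_eq:
  assumes triple: "\<And>K L M. K \<in> \<Omega> \<Longrightarrow> L \<in> \<Omega> \<Longrightarrow> M \<in> \<Omega> \<Longrightarrow>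
      triple_prod K L M = (u K \<bullet> u L) * (u K \<bullet> u M) * (u L \<bullet> u M)"
    and "M \<in> \<Gamma>" "N \<in> \<Gamma>" "M \<noteq> N"
  shows "S \<Omega> M N = {L \<in> \<Omega> - \<Gamma>. x L M * x L N = -1}"
proof -
  have "L \<in> S \<Omega> M N \<longleftrightarrow> L \<in> \<Omega> - \<Gamma> \<and> x L M * x L N = -1" for L
  proof (cases "L \<in> \<Omega> - {M, N}")
    case True
    have "triple_prod M N L = x L M * x L N / q^3"
    proof -
      have "M \<in> \<Omega>" "N \<in> \<Omega>" "L \<in> \<Omega>" using True assms sub by blast+
      then show ?thesis using angle_\<Gamma>[OF assms(2,3,4)] q
        by (simp add: triple x_def inner_commute[of "u M" "u L"] inner_commute[of "u N" "u L"] power3_eq_cube)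
    qed
    then have "L \<in> S \<Omega> M N \<longleftrightarrow> x L M * x L N < 0"
      using True q by (simp add: S_def divide_less_0_iff)
    also have "\<dots> \<longleftrightarrow> L \<in> \<Omega> - \<Gamma> \<and> x L M * x L N = -1"
    proof (cases "L \<in> \<Gamma>")
      case True
      moreover have "L \<noteq> M" "L \<noteq> N" using \<open>L \<in> \<Omega> - {M, N}\<close> by blast+
      ultimately show ?thesis using assms(2,3) q by (simp add: x_def inner_\<Gamma>)
    next
      case False
      then have L: "L \<in> \<Omega> - \<Gamma>" using True by blast
      then show ?thesis using x_sign[OF L assms(2)] x_sign[OF L assms(3)] by auto
    qed
    finally show ?thesis .
  qed (use assms(2,3) in \<open>auto simp: S_def\<close>)
  then show ?thesis by blast
qed

text \<open>The indicator of membership in both sets is (1 - x x)(1 - x x) / 4, with one pair of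
  entries in each factor. The constant cardinality thus fixes the fourth moment once the second
  moments are known.\<close>

lemma x_quad_const:
  assumes triple: "\<And>K L M. K \<in> \<Omega> \<Longrightarrow> L \<in> \<Omega> \<Longrightarrow> M \<in> \<Omega> \<Longrightarrow>
      triple_prod K L M = (u K \<bullet> u L) * (u K \<bullet> u M) * (u L \<bullet> u M)"
    and c: "\<And>\<alpha> \<beta> \<eta> \<nu>. \<alpha> \<in> \<Gamma> \<Longrightarrow> \<beta> \<in> \<Gamma> \<Longrightarrow> \<eta> \<in> \<Gamma> \<Longrightarrow> \<nu> \<in> \<Gamma> \<Longrightarrow> distinct [\<alpha>, \<beta>, \<eta>, \<nu>] \<Longrightarrow>
      card (S \<Omega> \<alpha> \<beta> \<inter> S \<Omega> \<eta> \<nu>) = c"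
    and quad: "(\<alpha>, \<beta>, \<eta>, \<nu>) \<in> quads \<Gamma>"
  shows "(\<Sum>L\<in>\<Omega> - \<Gamma>. x L \<alpha> * x L \<beta> * x L \<eta> * x L \<nu>) =
    4 * c - b + 2 * (q * real (card \<Omega>) / d - 2 * q - (d - 2))"
proof -
  have D: "\<alpha> \<in> \<Gamma>" "\<beta> \<in> \<Gamma>" "\<eta> \<in> \<Gamma>" "\<nu> \<in> \<Gamma>" "distinct [\<alpha>, \<beta>, \<eta>, \<nu>]"
    using quad by (auto simp: quads_def)
  have "S \<Omega> \<alpha> \<beta> \<inter> S \<Omega> \<eta> \<nu> = (\<Omega> - \<Gamma>) \<inter> {L. x L \<alpha> * x L \<beta> = -1 \<and> x L \<eta> * x L \<nu> = -1}"
    using S_eq[OF triple, of \<alpha> \<beta>] S_eq[OF triple, of \<eta> \<nu>] D by auto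
  then have "4 * real c = (\<Sum>L\<in>\<Omega> - \<Gamma>. 4 * (if x L \<alpha> * x L \<beta> = -1 \<and> x L \<eta> * x L \<nu> = -1 then 1 else 0))"
    using c[OF D] fin by (simp add: sum.If_cases flip: sum_distrib_left)
  also have "\<dots> = (\<Sum>L\<in>\<Omega> - \<Gamma>. 1 - x L \<alpha> * x L \<beta> - x L \<eta> * x L \<nu> + x L \<alpha> * x L \<beta> * x L \<eta> * x L \<nu>)"
  proof (rule sum.cong[OF refl])
    fix L assume "L \<in> \<Omega> - \<Gamma>"
    then have "x L \<alpha> = 1 \<or> x L \<alpha> = -1" "x L \<beta> = 1 \<or> x L \<beta> = -1"
      "x L \<eta> = 1 \<or> x L \<eta> = -1" "x L \<nu> = 1 \<or> x L \<nu> = -1"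
      using x_sign D by blast+
    then show "4 * (if x L \<alpha> * x L \<beta> = -1 \<and> x L \<eta> * x L \<nu> = -1 then 1 else 0) =
      1 - x L \<alpha> * x L \<beta> - x L \<eta> * x L \<nu> + x L \<alpha> * x L \<beta> * x L \<eta> * x L \<nu>"
      by (elim disjE) simp_all
  qed
  also have "\<dots> = b - (\<Sum>L\<in>\<Omega> - \<Gamma>. x L \<alpha> * x L \<beta>) - (\<Sum>L\<in>\<Omega> - \<Gamma>. x L \<eta> * x L \<nu>) +
      (\<Sum>L\<in>\<Omega> - \<Gamma>. x L \<alpha> * x L \<beta> * x L \<eta> * x L \<nu>)"
    by (simp add: sum.distrib sum_subtractf b_def)
  finally show ?thesis using x_pair_const D by simp
qed

lemma sign_config:
  assumes triple: "\<And>K L M. K \<in> \<Omega> \<Longrightarrow> L \<in> \<Omega> \<Longrightarrow> M \<in> \<Omega> \<Longrightarrow>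
      triple_prod K L M = (u K \<bullet> u L) * (u K \<bullet> u M) * (u L \<bullet> u M)"
    and c: "\<And>\<alpha> \<beta> \<eta> \<nu>. \<alpha> \<in> \<Gamma> \<Longrightarrow> \<beta> \<in> \<Gamma> \<Longrightarrow> \<eta> \<in> \<Gamma> \<Longrightarrow> \<nu> \<in> \<Gamma> \<Longrightarrow> distinct [\<alpha>, \<beta>, \<eta>, \<nu>] \<Longrightarrow>
      card (S \<Omega> \<alpha> \<beta> \<inter> S \<Omega> \<eta> \<nu>) = c"
    and d4: "d \<ge> 4"
  shows "sign_config \<Gamma> (\<Omega> - \<Gamma>) x q s d b (q * real (card \<Omega>) / d - 2 * q - (d - 2))
    (4 * c - b + 2 * (q * real (card \<Omega>) / d - 2 * q - (d - 2)))"
proof -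
  \<comment> \<open>The formula for \<open>s^2\<close> is available only through a line outside
    \<Gamma>.\<close>
  have "b \<noteq> 0"
  proof
    assume "b = 0"
    then have "d * (d - 1) = 0" using b_eq by simp
    then show False using d4 by simp
  qed
  then obtain L where L: "L \<in> \<Omega> - \<Gamma>" by (metis b_def card.empty equals0I of_nat_0)
  show ?thesis
  proof
    show "s \<le> 0" "s^2 = (d - q^2 + q) * (q - 1 + d)" using sum_x[OF L] by auto
  qed (use fin fin_\<Gamma> card_\<Gamma> q b_eq d4 sum_x x_sign x_inner x_pair_const x_quad_const[OF triple c]
      in \<open>auto simp: d_def b_def\<close>)
qed

end

section \<open>Isometry with the standard sets\<close>

lemma span_scaleR: "span {c *\<^sub>R y} = span {y}" if "c \<noteq> 0" for y :: "'a::real_vector"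
  using span_image_scale[of "{y}" "\<lambda>_. c"] that by simp

context oriented_lines
begin

text \<open>The map sending each \<open>u L\<close> to the normalized \<open>w L\<close> takes
  \<Omega> into \<open>\<Omega>'\<close>, and the bound on the cardinality makes this inclusion an
  equality. The sign \<open>\<sigma>\<close> accounts for the orientation of
  \<open>y\<close>.\<close>

lemma isometricI:
  fixes w :: "(real^'n) set \<Rightarrow> real^'m" and \<Omega>' :: "(real^'m) set set"
  assumes card: "CARD('n) = CARD('m)" and N: "N > 0"
    and gram: "\<And>L M. L \<in> \<Gamma> \<Longrightarrow> M \<in> \<Gamma> \<Longrightarrow> w L \<bullet> w M = N * (if L = M then 1 else 1 / q)"
    and base: "\<And>L. L \<in> \<Gamma> \<Longrightarrow> span {w L} \<in> \<Omega>'"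
    and rest: "\<And>L. L \<in> \<Omega> - \<Gamma> \<Longrightarrow>
      \<exists>y \<sigma>. span {y} \<in> \<Omega>' \<and> (\<sigma> = 1 \<or> \<sigma> = -1) \<and> (\<forall>M\<in>\<Gamma>. y \<bullet> w M = \<sigma> * (N / q) * x L M)"
    and fin': "finite \<Omega>'" "card \<Omega>' \<le> card \<Omega>"
  shows "isometric \<Omega> \<Omega>'"
proof -
  define r where "r = 1 / sqrt N"
  have r: "r \<noteq> 0" "r * r * N = 1" using N by (simp_all add: r_def)
  have "(r *\<^sub>R w L) \<bullet> (r *\<^sub>R w M) = u L \<bullet> u M" if "L \<in> \<Gamma>" "M \<in> \<Gamma>" for L M
    using gram[OF that] inner_\<Gamma>[OF that] r(2) by simp
  then obtain f :: "real^'n \<Rightarrow> real^'m" where f: "linear f" "bij f" "\<And>v v'. f v \<bullet> f v' = v \<bullet> v'"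
      "\<And>L. L \<in> \<Gamma> \<Longrightarrow> f (u L) = r *\<^sub>R w L"
      "\<And>v y. (\<And>L. L \<in> \<Gamma> \<Longrightarrow> v \<bullet> u L = y \<bullet> (r *\<^sub>R w L)) \<Longrightarrow> f v = y"
    using gram_isometry[OF card inj_on_subset[OF inj_u sub] independent_u span_u, of "\<lambda>L. r *\<^sub>R w L"]
    by metis
  have image: "f ` L = span {f (u L)}" if "L \<in> \<Omega>" for L
    using span_linear_image[OF f(1), of "{u L}"] span[OF that] by simp
  have "f ` L \<in> \<Omega>'" if "L \<in> \<Omega>" for L
  proof (cases "L \<in> \<Gamma>")
    case True
    then show ?thesis using image[OF that] f(4) base r(1) by (simp add: span_scaleR)
  next
    case False
    then have "L \<in> \<Omega> - \<Gamma>" using that by blast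
    from rest[OF this] obtain y \<sigma> where y: "span {y} \<in> \<Omega>'" "\<sigma> = 1 \<or> \<sigma> = -1" "\<forall>M\<in>\<Gamma>. y \<bullet> w M = \<sigma> * (N / q) * x L M"
      by blast
    have "f (u L) = (\<sigma> * r) *\<^sub>R y"
    proof (rule f(5))
      fix M assume "M \<in> \<Gamma>"
      then have "(\<sigma> * r) *\<^sub>R y \<bullet> (r *\<^sub>R w M) = (\<sigma> * \<sigma>) * (r * r * N) * (x L M / q)"
        using y(3) by simp
      then show "u L \<bullet> u M = (\<sigma> * r) *\<^sub>R y \<bullet> (r *\<^sub>R w M)" using y(2) r(2) q by (auto simp: x_def)
    qed
    then show ?thesis using image[OF that] y r(1) span_scaleR[of "\<sigma> * r" y] by auto
  qed
  then have subset: "(\<lambda>L. f ` L) ` \<Omega> \<subseteq> \<Omega>'" by blast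
  have "inj_on (\<lambda>L. f ` L) \<Omega>"
    using f(2) by (meson bij_is_inj inj_image_eq_iff inj_onI)
  then have "card ((\<lambda>L. f ` L) ` \<Omega>) = card \<Omega>" by (rule card_image)
  then have "(\<lambda>L. f ` L) ` \<Omega> = \<Omega>'"
    using card_subset_eq[OF fin'(1) subset] card_mono[OF fin'(1) subset] fin'(2) by simp
  then show ?thesis unfolding isometric_def using f(1-3) by blast
qed

text \<open>Passing to the complement of a block reverses the sign vector and so keeps the line,
  whence the alternative in \<open>rest\<close>. It occurs for \<open>d = 6\<close>, where only half
  of the balanced sign vectors are blocks.\<close>

lemma isometric_design_lines:
  fixes \<B> :: "'m::finite set set"
  assumes card: "CARD('n) = CARD('m)" and N: "N > 0" and \<pi>: "bij_betw \<pi> \<Gamma> (UNIV :: 'm set)"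
    and pp: "\<And>i j :: 'm. point_vec k s1 s2 i \<bullet> point_vec k s1 s2 j = (if i = j then N else N / q)"
    and bp: "\<And>B i. B \<in> \<B> \<Longrightarrow> block_vec k s1 s2 B \<bullet> point_vec k s1 s2 i = (if i \<in> B then N / q else - (N / q))"
    and rest: "\<And>L. L \<in> \<Omega> - \<Gamma> \<Longrightarrow> \<pi> ` {M \<in> \<Gamma>. x L M = 1} \<in> \<B> \<or> - \<pi> ` {M \<in> \<Gamma>. x L M = 1} \<in> \<B>"
    and card_\<B>: "real (card \<B>) \<le> b"
  shows "isometric \<Omega> (design_lines k s1 s2 \<B>)"
proof (rule isometricI[where w = "\<lambda>L. point_vec k s1 s2 (\<pi> L)"])
  have inj: "\<pi> L = \<pi> M \<longleftrightarrow> L = M" if "L \<in> \<Gamma>" "M \<in> \<Gamma>" for L M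
    using \<pi> that by (auto simp: bij_betw_def inj_on_eq_iff)
  show "point_vec k s1 s2 (\<pi> L) \<bullet> point_vec k s1 s2 (\<pi> M) = N * (if L = M then 1 else 1 / q)"
    if "L \<in> \<Gamma>" "M \<in> \<Gamma>" for L M
    using pp inj[OF that] by simp
  show "span {point_vec k s1 s2 (\<pi> L)} \<in> design_lines k s1 s2 \<B>" for L
    by (auto simp: design_lines_def)
  show "\<exists>y \<sigma>. span {y} \<in> design_lines k s1 s2 \<B> \<and> (\<sigma> = 1 \<or> \<sigma> = -1) \<and>
      (\<forall>M\<in>\<Gamma>. y \<bullet> point_vec k s1 s2 (\<pi> M) = \<sigma> * (N / q) * x L M)" if L: "L \<in> \<Omega> - \<Gamma>" for L
  proof -
    let ?B = "\<pi> ` {M \<in> \<Gamma>. x L M = 1}"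
    have mem: "\<pi> M \<in> ?B \<longleftrightarrow> x L M = 1" if "M \<in> \<Gamma>" for M using inj that by auto
    show ?thesis
    proof (cases "?B \<in> \<B>")
      case True
      have "block_vec k s1 s2 ?B \<bullet> point_vec k s1 s2 (\<pi> M) = 1 * (N / q) * x L M" if "M \<in> \<Gamma>" for M
        using bp[OF True, of "\<pi> M"] mem[OF that] x_sign[OF L that] by auto
      moreover have "span {block_vec k s1 s2 ?B} \<in> design_lines k s1 s2 \<B>"
        using True by (auto simp: design_lines_def)
      ultimately show ?thesis by blast
    next
      case False
      then have B: "- ?B \<in> \<B>" using rest[OF L] by blast
      have "block_vec k s1 s2 (- ?B) \<bullet> point_vec k s1 s2 (\<pi> M) = -1 * (N / q) * x L M" if "M \<in> \<Gamma>" for M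
        using bp[OF B, of "\<pi> M"] mem[OF that] x_sign[OF L that] by auto
      moreover have "span {block_vec k s1 s2 (- ?B)} \<in> design_lines k s1 s2 \<B>"
        using B by (auto simp: design_lines_def)
      ultimately show ?thesis by blast
    qed
  qed
  have eq: "design_lines k s1 s2 \<B> = (\<lambda>B. span {block_vec k s1 s2 B}) ` \<B> \<union>
      range (\<lambda>i. span {point_vec k s1 s2 i :: real^'m})"
    by (auto simp: design_lines_def)
  show "finite (design_lines k s1 s2 \<B>)" unfolding eq by simp
  have "card (design_lines k s1 s2 \<B>) \<le> card \<B> + CARD('m)"
    unfolding eq by (intro order_trans[OF card_Un_le] add_mono card_image_le) auto
  moreover have "card \<Omega> = card (\<Omega> - \<Gamma>) + CARD('m)"
    using card_Diff_subset[OF fin_\<Gamma> sub] card_mono[OF fin sub] card_\<Gamma> card by simp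
  ultimately show "card (design_lines k s1 s2 \<B>) \<le> card \<Omega>" using card_\<B> by (simp add: b_def)
qed (fact card N)+

end

section \<open>Inner products of the standard vectors\<close>

lemma inner_two_valued:
  fixes B D :: "'m::finite set"
  shows "(\<chi> j. if j \<in> B then a + c else a) \<bullet> (\<chi> j. if j \<in> D then a' + c' else a') =
    real CARD('m) * (a * a') + real (card B) * (c * a') + real (card D) * (a * c') + real (card (B \<inter> D)) * (c * c')"
proof -
  have "(\<chi> j. if j \<in> B then a + c else a) \<bullet> (\<chi> j. if j \<in> D then a' + c' else a') =
    (\<Sum>j\<in>UNIV. a * a' + (if j \<in> B then c * a' else 0) + (if j \<in> D then a * c' else 0) +
      (if j \<in> B \<inter> D then c * c' else 0))"
    unfolding inner_vec_def by (intro sum.cong refl) (auto simp: algebra_simps)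
  then show ?thesis by (simp add: sum.distrib sum.If_cases Int_def)
qed

lemma point_vec_eq:
  fixes i :: "'m::finite" and k s1 s2 :: nat
  defines "e \<equiv> sqrt ((real k - real s1) + real CARD('m) * (real s1 - real s2) / 2)" and "m \<equiv> real s1 - real s2"
  shows "point_vec k s1 s2 i = (\<chi> j. if j \<in> {i} then (- m - e) + m * real CARD('m) else - m - e)"
  by (simp add: point_vec_def Let_def vec_eq_iff e_def m_def algebra_simps)

lemma block_vec_eq:
  fixes B :: "'m::finite set" and k s1 s2 :: nat
  defines "r \<equiv> sqrt ((real k)^2 - real CARD('m) * (real s1 + real s2) / 2)"
  shows "block_vec k s1 s2 B = (\<chi> j. if j \<in> B then (r - real k) + real CARD('m) else r - real k)"
  by (simp add: block_vec_def Let_def vec_eq_iff r_def algebra_simps)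

text \<open>\<open>e\<close> is the square root of \<Delta>\<open>\<^sub>2\<close>, characterized by
  its square so that concrete dimensions can insert a closed form.\<close>

lemma point_vec_inner:
  fixes i j :: "'m::finite" and k s1 s2 :: nat
  defines "d \<equiv> real CARD('m)" and "m \<equiv> real s1 - real s2"
  assumes "e \<ge> 0" "e^2 = (real k - real s1) + real CARD('m) * (real s1 - real s2) / 2"
  shows "point_vec k s1 s2 i \<bullet> point_vec k s1 s2 j = d * (e^2 - m^2 + (if i = j then m^2 * d else 0))"
proof -
  have "sqrt ((real k - real s1) + real CARD('m) * (real s1 - real s2) / 2) = e"
    using assms by (metis real_sqrt_unique)
  then have "point_vec k s1 s2 i \<bullet> point_vec k s1 s2 j = d * ((- m - e) * (- m - e)) +
     2 * ((m * d) * (- m - e)) + real (card ({i} \<inter> {j})) * ((m * d) * (m * d))"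
    unfolding point_vec_eq inner_two_valued d_def m_def by simp
  then show ?thesis by (auto simp: algebra_simps power2_eq_square)
qed

lemma block_vec_inner_point_vec:
  fixes B :: "'m::finite set" and k s1 s2 :: nat
  defines "d \<equiv> real CARD('m)" and "m \<equiv> real s1 - real s2"
  assumes "e \<ge> 0" "e^2 = (real k - real s1) + real CARD('m) * (real s1 - real s2) / 2"
    and "r \<ge> 0" "r^2 = (real k)^2 - real CARD('m) * (real s1 + real s2) / 2" and "card B = k"
  shows "block_vec k s1 s2 B \<bullet> point_vec k s1 s2 i = d * (- (e * r) - m * k + (if i \<in> B then m * d else 0))"
proof -
  have "sqrt ((real k - real s1) + real CARD('m) * (real s1 - real s2) / 2) = e"
    "sqrt ((real k)^2 - real CARD('m) * (real s1 + real s2) / 2) = r"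
    using assms by (metis real_sqrt_unique)+
  then have "block_vec k s1 s2 B \<bullet> point_vec k s1 s2 i = d * ((r - real k) * (- m - e)) +
     real k * (d * (- m - e)) + (r - real k) * (m * d) + real (card (B \<inter> {i})) * (d * (m * d))"
    using assms(7) unfolding point_vec_eq block_vec_eq inner_two_valued d_def m_def by simp
  then show ?thesis by (cases "i \<in> B") (auto simp: algebra_simps power2_eq_square)
qed

section \<open>Designs\<close>

lemma design_transfer:
  assumes f: "bij_betw f P P'" and Q: "quasi_symmetric_design t d k l s1 s2 P \<B>"
  shows "quasi_symmetric_design t d k l s1 s2 P' ((`) f ` \<B>)"
proof -
  have inj: "inj_on f P" and im: "f ` P = P'" using f by (auto simp: bij_betw_def)
  have finP: "finite P" "card P = d" and B: "\<And>B. B \<in> \<B> \<Longrightarrow> B \<subseteq> P \<and> card B = k"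
    and lam: "\<And>T. T \<subseteq> P \<Longrightarrow> card T = t \<Longrightarrow> card {B \<in> \<B>. T \<subseteq> B} = l"
    and ints: "{card (B \<inter> B') | B B'. B \<in> \<B> \<and> B' \<in> \<B> \<and> B \<noteq> B'} = {s1, s2}"
    using Q by (auto simp: quasi_symmetric_design_def)
  have inj2: "f ` X = f ` Y \<longleftrightarrow> X = Y" if "X \<subseteq> P" "Y \<subseteq> P" for X Y
    using inj_on_image_eq_iff[OF inj that] .
  have "card {B \<in> (`) f ` \<B>. T \<subseteq> B} = l" if T: "T \<subseteq> P'" "card T = t" for T
  proof -
    obtain T0 where T0: "T0 \<subseteq> P" "T = f ` T0" using T(1) im by (metis subset_imageE)
    then have "card T0 = t" using T(2) card_image inj_on_subset[OF inj] by metis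
    have "{B \<in> (`) f ` \<B>. T \<subseteq> B} = (`) f ` {B \<in> \<B>. T0 \<subseteq> B}"
      using B T0 inj_on_image_subset_iff[OF inj] by (auto simp: image_iff)
    moreover have "inj_on ((`) f) {B \<in> \<B>. T0 \<subseteq> B}"
      using B inj2 by (intro inj_onI) auto
    ultimately show ?thesis using lam[OF T0(1) \<open>card T0 = t\<close>] by (simp add: card_image)
  qed
  moreover have "{card (B \<inter> B') | B B'. B \<in> (`) f ` \<B> \<and> B' \<in> (`) f ` \<B> \<and> B \<noteq> B'} =
      {card (B \<inter> B') | B B'. B \<in> \<B> \<and> B' \<in> \<B> \<and> B \<noteq> B'}"
  proof -
    have "card (f ` B \<inter> f ` B') = card (B \<inter> B')" if "B \<in> \<B>" "B' \<in> \<B>" for B B'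
      using card_image_Int_image[OF inj] B that by blast
    then show ?thesis using B inj2 by (auto; metis image_eqI)
  qed
  moreover have "B \<subseteq> P' \<and> card B = k" if "B \<in> (`) f ` \<B>" for B
    using that B im card_image inj_on_subset[OF inj] by (metis (no_types, lifting) imageE image_mono)
  ultimately show ?thesis
    using ints finP im card_image[OF inj] by (auto simp: quasi_symmetric_design_def)
qed

lemma design_count:
  assumes "quasi_symmetric_design t d k l s1 s2 P \<B>"
  shows "l * (d choose t) = card \<B> * (k choose t)"
proof -
  have finP: "finite P" "card P = d" and B: "\<And>B. B \<in> \<B> \<Longrightarrow> B \<subseteq> P \<and> card B = k"
    and lam: "\<And>T. T \<subseteq> P \<Longrightarrow> card T = t \<Longrightarrow> card {B \<in> \<B>. T \<subseteq> B} = l"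
    using assms by (auto simp: quasi_symmetric_design_def)
  let ?T = "{T. T \<subseteq> P \<and> card T = t}"
  have fin\<B>: "finite \<B>" using B finP(1) by (intro finite_subset[of \<B> "Pow P"]) auto
  have finT: "finite ?T" using finP(1) by simp
  have "(\<Sum>T\<in>?T. card {B \<in> \<B>. T \<subseteq> B}) = (\<Sum>B\<in>\<B>. card {T \<in> ?T. T \<subseteq> B})"
    using sum.swap_restrict[OF finT fin\<B>, of "\<lambda>_ _. 1 :: nat" "(\<subseteq>)"] by simp
  also have "\<dots> = (\<Sum>B\<in>\<B>. k choose t)"
  proof (rule sum.cong[OF refl])
    fix C assume C: "C \<in> \<B>"
    then have "{T \<in> ?T. T \<subseteq> C} = {T. T \<subseteq> C \<and> card T = t}" using B by auto
    then show "card {T \<in> ?T. T \<subseteq> C} = k choose t"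
      using n_subsets[of C t] B[OF C] finP(1) finite_subset by metis
  qed
  finally show ?thesis using n_subsets[OF finP(1), of t] lam finP(2) by (simp add: mult.commute)
qed

text \<open>The list consists of the faces of the six-vertex triangulation of the projective plane,
  in which every edge lies in two triangles.\<close>

lemma design6_exists: "\<exists>\<B>. quasi_symmetric_design 2 6 3 2 2 1 (UNIV :: 6 set) \<B>"
proof -
  define D :: "nat set list" where "D = [{0,1,2}, {0,1,3}, {0,2,4}, {0,3,5}, {0,4,5}, {1,2,5}, {1,3,4}, {1,4,5}, {2,3,4}, {2,3,5}]"
  have pairs: "\<forall>i\<in>{0,1,2,3,4,5}. \<forall>j\<in>{0,1,2,3,4,5}. i \<noteq> j \<longrightarrow> card (Set.filter (\<lambda>B. i \<in> B \<and> j \<in> B) (set D)) = 2"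
    unfolding D_def by code_simp
  have ints: "\<forall>B \<in> set D. \<forall>B' \<in> set D. B \<noteq> B' \<longrightarrow> card (B \<inter> B') = 1 \<or> card (B \<inter> B') = 2"
    unfolding D_def by code_simp
  have P: "{..<6 :: nat} = {0,1,2,3,4,5}" by auto
  have "card {B \<in> set D. T \<subseteq> B} = 2" if T: "T \<subseteq> {..<6}" "card T = 2" for T
  proof -
    obtain i j where ij: "T = {i, j}" "i \<noteq> j" using T(2) by (auto simp: card_2_iff)
    then have "i \<in> {0,1,2,3,4,5}" "j \<in> {0,1,2,3,4,5}" using T(1) unfolding P by blast+
    from pairs[rule_format, OF this ij(2)] show ?thesis using ij(1) by simp
  qed
  moreover have "{card (B \<inter> B') | B B'. B \<in> set D \<and> B' \<in> set D \<and> B \<noteq> B'} = {2, 1}" (is "?L = _")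
  proof
    show "?L \<subseteq> {2, 1}" using ints by auto
    have "\<exists>B \<in> set D. \<exists>B' \<in> set D. B \<noteq> B' \<and> card (B \<inter> B') = 1"
      "\<exists>B \<in> set D. \<exists>B' \<in> set D. B \<noteq> B' \<and> card (B \<inter> B') = 2"
      unfolding D_def by code_simp+
    then show "{2, 1} \<subseteq> ?L" by (simp; metis)
  qed
  moreover have "\<forall>B \<in> set D. B \<subseteq> {..<6} \<and> card B = 3" by (simp add: D_def)
  ultimately have "quasi_symmetric_design 2 6 3 2 2 1 {..<6} (set D)"
    by (simp add: quasi_symmetric_design_def)
  moreover obtain f :: "nat \<Rightarrow> 6" where "bij_betw f {..<6} UNIV"
    using finite_same_card_bij[of "{..<6 :: nat}" "UNIV :: 6 set"] by auto
  ultimately show ?thesis using design_transfer by blast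
qed

lemma blocks6: "quasi_symmetric_design 2 6 3 2 2 1 UNIV blocks6"
  unfolding blocks6_def using design6_exists by (rule someI_ex)

lemma card_blocks6: "card blocks6 = 10"
  using design_count[OF blocks6] by (simp add: choose_two numeral_eq_Suc)

text \<open>Blocks meet pairwise, so the ten blocks and their complements are all twenty triples.\<close>

lemma blocks6_complement:
  assumes "card (T :: 6 set) = 3"
  shows "T \<in> blocks6 \<or> - T \<in> blocks6"
proof -
  have B: "card B = 3" if "B \<in> blocks6" for B
    using blocks6 that by (auto simp: quasi_symmetric_design_def)
  have meet: "B \<inter> B' \<noteq> {}" if "B \<in> blocks6" "B' \<in> blocks6" for B B'
  proof (cases "B = B'")
    case True
    then show ?thesis using B[OF that(1)] by auto
  next
    case False
    have "card (B \<inter> B') \<in> {card (B \<inter> B') | B B'. B \<in> blocks6 \<and> B' \<in> blocks6 \<and> B \<noteq> B'}"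
      using that False by blast
    also have "\<dots> = {2, 1}" using blocks6 by (simp add: quasi_symmetric_design_def)
    finally show ?thesis by auto
  qed
  have disj: "blocks6 \<inter> uminus ` blocks6 = {}" using meet by fastforce
  have sub: "blocks6 \<union> uminus ` blocks6 \<subseteq> {T. T \<subseteq> UNIV \<and> card T = 3}"
    using B by (auto simp: Compl_eq_Diff_UNIV card_Diff_subset)
  have "card (uminus ` blocks6) = 10" using card_blocks6 by (subst card_image) (auto simp: inj_on_def)
  then have "card (blocks6 \<union> uminus ` blocks6) = 20"
    using disj card_blocks6 by (simp add: card_Un_disjoint)
  moreover have "card {T :: 6 set. T \<subseteq> UNIV \<and> card T = 3} = 20"
    using n_subsets[of "UNIV :: 6 set" 3] by (simp add: numeral_eq_Suc)
  ultimately have "blocks6 \<union> uminus ` blocks6 = {T. T \<subseteq> UNIV \<and> card T = 3}"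
    by (intro card_subset_eq[OF _ sub]) auto
  then have "T \<in> blocks6 \<union> uminus ` blocks6" using assms by auto
  then show ?thesis by force
qed

lemma card_blocks7: "card blocks7 = 21"
  using n_subsets[of "UNIV :: 7 set" 2] by (simp add: blocks7_def choose_two)

section \<open>The five cases\<close>

context sign_config
begin

lemma card_positive:
  assumes "c \<in> C"
  shows "2 * real (card {a \<in> I. x c a = 1}) = d + s"
proof -
  have "d + s = (\<Sum>a\<in>I. 1 + x c a)" using sum_s[OF assms] d by (simp add: sum.distrib)
  also have "\<dots> = (\<Sum>a\<in>I. if x c a = 1 then 2 else 0)"
  proof (rule sum.cong[OF refl])
    fix a assume "a \<in> I"
    then show "1 + x c a = (if x c a = 1 then 2 else 0)" using sgn[OF assms, of a] by auto
  qed
  finally show ?thesis using fin by (simp add: sum.If_cases Int_def)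
qed

lemma inner_via_card:
  assumes "c \<in> C" "e \<in> C"
  shows "(\<Sum>a\<in>I. x c a * x e a) = 4 * real (card ({a \<in> I. x c a = 1} \<inter> {a \<in> I. x e a = 1})) - d - 2 * s"
proof -
  have "(\<Sum>a\<in>I. x c a * x e a) = (\<Sum>a\<in>I. 4 * (if x c a = 1 \<and> x e a = 1 then 1 else 0) - 1 - x c a - x e a)"
  proof (rule sum.cong[OF refl])
    fix a assume "a \<in> I"
    then show "x c a * x e a = 4 * (if x c a = 1 \<and> x e a = 1 then 1 else 0) - 1 - x c a - x e a"
      using sgn[OF assms(1), of a] sgn[OF assms(2), of a] by auto
  qed
  also have "\<dots> = 4 * real (card ({a \<in> I. x c a = 1} \<inter> {a \<in> I. x e a = 1})) - d - s - s"
    using fin sum_s[OF assms(1)] sum_s[OF assms(2)]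
    by (simp add: sum_subtractf d sum.If_cases Int_def conj_ac flip: sum_distrib_left cong: conj_cong)
  finally show ?thesis by simp
qed

text \<open>A quasi-symmetric design requires both intersection sizes to be attained. The first
  moment gives \<open>N = 140\<close> of the 252 other rows, so both inner products occur; 7 and -1
  correspond to sizes 3 and 1.\<close>

lemma both_values_occur:
  assumes v: "d = 23" "q = 5" "s = -9" "b = 253" and y: "y \<in> C"
  shows "\<exists>c \<in> C. (\<Sum>a\<in>I. x c a * x y a) = 7" "\<exists>c \<in> C. (\<Sum>a\<in>I. x c a * x y a) = -1"
proof -
  from sum_over_rows[OF y] obtain N where
    "\<forall>f :: real \<Rightarrow> real. (\<Sum>c\<in>C. f (\<Sum>a\<in>I. x c a * x y a)) =
      f d + N * f (d - (q - 1)^2) + (b - 1 - N) * f (d - (q^2 - 1))" ..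
  then have N: "(\<Sum>c\<in>C. f (\<Sum>a\<in>I. x c a * x y a)) = f 23 + N * f 7 + (252 - N) * f (-1)"
    for f :: "real \<Rightarrow> real" using v by simp
  have "(\<Sum>c\<in>C. x c a) = -99" if "a \<in> I" for a
    using one_const[OF that] p_eq v by simp
  then have "(\<Sum>c\<in>C. \<Sum>a\<in>I. x c a * x y a) = (\<Sum>a\<in>I. -99 * x y a)"
    by (subst sum.swap) (simp flip: sum_distrib_right)
  also have "\<dots> = 891" using sum_s[OF y] v by (simp only: sum_distrib_left[symmetric])
  finally have N': "N = 140" using N[of "\<lambda>w. w"] by simp
  have "\<exists>c \<in> C. (\<Sum>a\<in>I. x c a * x y a) = w" if "w = 7 \<or> w = -1" for w
  proof (rule ccontr)
    assume "\<not> ?thesis"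
    then have "(\<Sum>c\<in>C. if (\<Sum>a\<in>I. x c a * x y a) = w then 1 else 0 :: real) = 0"
      by (intro sum.neutral) auto
    then show False using N[of "\<lambda>v. if v = w then 1 else 0"] N' that by auto
  qed
  then show "\<exists>c \<in> C. (\<Sum>a\<in>I. x c a * x y a) = 7" "\<exists>c \<in> C. (\<Sum>a\<in>I. x c a * x y a) = -1"
    by blast+
qed

lemma steiner_system:
  assumes v: "d = 23" "q = 5" "s = -9" "b = 253"
  shows "quasi_symmetric_design 4 23 7 1 3 1 I ((\<lambda>c. {a \<in> I. x c a = 1}) ` C)"
proof -
  let ?B = "\<lambda>c. {a \<in> I. x c a = 1}"
  have card7: "card (?B c) = 7" if "c \<in> C" for c
    using card_positive[OF that] v by simp
  have four: "card {B \<in> ?B ` C. T \<subseteq> B} = 1" if T: "T \<subseteq> I" "card T = 4" for T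
  proof -
    obtain xs where xs: "set xs = T" "distinct xs" "length xs = 4"
      using finite_distinct_list[of T] distinct_card T(2) by (metis card.infinite zero_neq_numeral)
    then obtain a e f g where "xs = [a, e, f, g]"
      by (auto simp: numeral_eq_Suc length_Suc_conv)
    then have T': "T = {a, e, f, g}" "(a, e, f, g) \<in> quads I"
      using xs T(1) by (auto simp: quads_def)
    obtain c where "{c \<in> C. x c a = 1 \<and> x c e = 1 \<and> x c f = 1 \<and> x c g = 1} = {c}"
      using quad_count[OF v(1,3,4) T'(2)] by (auto simp: card_1_singleton_iff)
    then have "{c \<in> C. T \<subseteq> ?B c} = {c}" using T' T(1) by auto
    moreover have "{B \<in> ?B ` C. T \<subseteq> B} = ?B ` {c \<in> C. T \<subseteq> ?B c}" by blast
    ultimately show ?thesis by simp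
  qed
  have inter: "card (?B c \<inter> ?B e) = 3 \<or> card (?B c \<inter> ?B e) = 1" if "c \<in> C" "e \<in> C" "?B c \<noteq> ?B e" for c e
    using ip[OF that(1,2)] inner_via_card[OF that(1,2)] that(3) v by auto
  have "{card (B \<inter> B') | B B'. B \<in> ?B ` C \<and> B' \<in> ?B ` C \<and> B \<noteq> B'} = {3, 1}" (is "?L = _")
  proof
    show "?L \<subseteq> {3, 1}" using inter by blast
    have "C \<noteq> {}" using b_pos b by auto
    then obtain y where y: "y \<in> C" by blast
    \<comment> \<open>An intersection of size other than 7 certifies that the two blocks are
      distinct.\<close>
    have occurs: "n \<in> ?L" if "c \<in> C" "card (?B c \<inter> ?B y) = n" "n \<noteq> 7" for c n
    proof -
      have "?B c \<noteq> ?B y" using that card7[OF y] by auto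
      then show ?thesis using that y by blast
    qed
    obtain c where "c \<in> C" "card (?B c \<inter> ?B y) = 3"
      using both_values_occur(1)[OF v y] inner_via_card[OF _ y] v by auto
    then have "3 \<in> ?L" by (intro occurs) auto
    obtain c' where "c' \<in> C" "card (?B c' \<inter> ?B y) = 1"
      using both_values_occur(2)[OF v y] inner_via_card[OF _ y] v by auto
    then have "1 \<in> ?L" by (intro occurs) auto
    then show "{3, 1} \<subseteq> ?L" using \<open>3 \<in> ?L\<close> by blast
  qed
  then show ?thesis
    using card7 four fin d v by (auto simp: quasi_symmetric_design_def)
qed

end

context oriented_lines
begin

lemma isometric_Omega6:
  assumes sc: "sign_config \<Gamma> (\<Omega> - \<Gamma>) x q s d b p t" and v: "d = 6" "q = 3" "s = 0" "b = 10"
  shows "isometric \<Omega> Omega6"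
  unfolding Omega6_def
proof -
  have card: "CARD('n) = CARD(6)" using v by (simp add: d_def)
  then obtain \<pi> where \<pi>: "bij_betw \<pi> \<Gamma> (UNIV :: 6 set)"
    using finite_same_card_bij[OF fin_\<Gamma>, of "UNIV :: 6 set"] card_\<Gamma> by auto
  have inj: "inj_on \<pi> {M \<in> \<Gamma>. x L M = 1}" for L
    using \<pi> inj_on_subset[of \<pi> \<Gamma>] by (auto simp: bij_betw_def)
  show "isometric \<Omega> (design_lines 3 2 1 blocks6)"
  \<comment> \<open>Here \<Delta>\<open>\<^sub>1\<close> = 0 and \<Delta>\<open>\<^sub>2\<close> =
    4, so the squared length of a point vector is 6 * (4 - 1 + 6) = 54.\<close>
  proof (rule isometric_design_lines[OF card _ \<pi>, of 54])
    show "point_vec 3 2 1 i \<bullet> point_vec 3 2 1 j = (if i = j then 54 else 54 / q)" for i j :: 6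
      using point_vec_inner[of 2 3 2 1 i j] v by simp
    show "block_vec 3 2 1 B \<bullet> point_vec 3 2 1 i = (if i \<in> B then 54 / q else - (54 / q))"
      if "B \<in> blocks6" for B i
    proof -
      have "card B = 3" using blocks6 that by (auto simp: quasi_symmetric_design_def)
      then show ?thesis using block_vec_inner_point_vec[of 2 3 2 1 0 B i] v by simp
    qed
    show "\<pi> ` {M \<in> \<Gamma>. x L M = 1} \<in> blocks6 \<or> - \<pi> ` {M \<in> \<Gamma>. x L M = 1} \<in> blocks6"
      if "L \<in> \<Omega> - \<Gamma>" for L
      using blocks6_complement[of "\<pi> ` {M \<in> \<Gamma>. x L M = 1}"] card_image[OF inj, of L]
        sign_config.card_positive[OF sc that] v by simp
  qed (use card_blocks6 v in auto)
qed

lemma isometric_Omega7: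
  assumes sc: "sign_config \<Gamma> (\<Omega> - \<Gamma>) x q s d b p t" and v: "d = 7" "q = 3" "s = -3" "b = 21"
  shows "isometric \<Omega> Omega7"
  unfolding Omega7_def
proof -
  have card: "CARD('n) = CARD(7)" using v by (simp add: d_def)
  then obtain \<pi> where \<pi>: "bij_betw \<pi> \<Gamma> (UNIV :: 7 set)"
    using finite_same_card_bij[OF fin_\<Gamma>, of "UNIV :: 7 set"] card_\<Gamma> by auto
  have inj: "inj_on \<pi> {M \<in> \<Gamma>. x L M = 1}" for L
    using \<pi> inj_on_subset[of \<pi> \<Gamma>] by (auto simp: bij_betw_def)
  \<comment> \<open>The roots of \<Delta>\<open>\<^sub>2\<close> = 9/2 and
    \<Delta>\<open>\<^sub>1\<close> = 1/2 are irrational, but only their squares and their product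
    3/2 enter the inner products.\<close>
  obtain e r :: real where e: "e \<ge> 0" "e^2 = 9 / 2" and r: "r \<ge> 0" "r^2 = 1 / 2" and er: "e * r = 3 / 2"
  proof
    show "sqrt (9 / 2) ^ 2 = 9 / 2" "sqrt (1 / 2) ^ 2 = 1 / 2" by (rule real_sqrt_pow2, simp)+
    show "sqrt (9 / 2) * sqrt (1 / 2) = 3 / 2" by (simp add: real_sqrt_divide)
  qed simp_all
  show "isometric \<Omega> (design_lines 2 1 0 blocks7)"
  proof (rule isometric_design_lines[OF card _ \<pi>, of "147 / 2"])
    show "point_vec 2 1 0 i \<bullet> point_vec 2 1 0 j = (if i = j then 147 / 2 else 147 / 2 / q)" for i j :: 7
      using point_vec_inner[of e 2 1 0 i j] v e by simp
    show "block_vec 2 1 0 B \<bullet> point_vec 2 1 0 i = (if i \<in> B then 147 / 2 / q else - (147 / 2 / q))"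
      if "B \<in> blocks7" for B i
    proof -
      have "card B = 2" using that by (simp add: blocks7_def)
      then show ?thesis
        using block_vec_inner_point_vec[of e 2 1 0 r B i] v e r er by simp
    qed
    show "\<pi> ` {M \<in> \<Gamma>. x L M = 1} \<in> blocks7 \<or> - \<pi> ` {M \<in> \<Gamma>. x L M = 1} \<in> blocks7"
      if "L \<in> \<Omega> - \<Gamma>" for L
      using card_image[OF inj, of L] sign_config.card_positive[OF sc that] v by (simp add: blocks7_def)
  qed (use card_blocks7 v in auto)
qed

lemma isometric_Omega23:
  assumes sc: "sign_config \<Gamma> (\<Omega> - \<Gamma>) x q s d b p t" and v: "d = 23" "q = 5" "s = -9" "b = 253"
  shows "isometric \<Omega> Omega23"
  unfolding Omega23_def
proof -
  have card: "CARD('n) = CARD(23)" using v by (simp add: d_def)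
  then obtain \<pi>0 where \<pi>0: "bij_betw \<pi>0 \<Gamma> (UNIV :: 23 set)"
    using finite_same_card_bij[OF fin_\<Gamma>, of "UNIV :: 23 set"] card_\<Gamma> by auto
  let ?B = "\<lambda>L. {M \<in> \<Gamma>. x L M = 1}"
  have S: "quasi_symmetric_design 4 23 7 1 3 1 \<Gamma> (?B ` (\<Omega> - \<Gamma>))"
    using sign_config.steiner_system[OF sc v] .
  \<comment> \<open>The system found in \<Omega>, carried over to the index type, shows that the
    choice in \<open>blocks23\<close> is made from existing designs.\<close>
  then have "\<exists>\<B>. quasi_symmetric_design 4 23 7 1 3 1 (UNIV :: 23 set) \<B>"
    using design_transfer[OF \<pi>0] by blast
  then have blocks23: "quasi_symmetric_design 4 23 7 1 3 1 UNIV blocks23"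
    unfolding blocks23_def by (rule someI_ex)
  then obtain \<pi> where \<pi>: "bij_betw \<pi> \<Gamma> UNIV" "(`) \<pi> ` ?B ` (\<Omega> - \<Gamma>) = blocks23"
    using steiner_4_7_23_unique[OF S blocks23] by blast
  have sqrts: "sqrt 27 * sqrt 3 = 9" by (simp flip: real_sqrt_mult)
  show "isometric \<Omega> (design_lines 7 3 1 blocks23)"
  \<comment> \<open>With \<Delta>\<open>\<^sub>2\<close> = 27 and \<open>s1 - s2 = 2\<close> the
    squared length is 23 * (27 - 4 + 92) = 2645.\<close>
  proof (rule isometric_design_lines[OF card _ \<pi>(1), of 2645])
    show "point_vec 7 3 1 i \<bullet> point_vec 7 3 1 j = (if i = j then 2645 else 2645 / q)" for i j :: 23
      using point_vec_inner[of "sqrt 27" 7 3 1 i j] v by simp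
    show "block_vec 7 3 1 B \<bullet> point_vec 7 3 1 i = (if i \<in> B then 2645 / q else - (2645 / q))"
      if "B \<in> blocks23" for B i
    proof -
      have "card B = 7" using blocks23 that by (auto simp: quasi_symmetric_design_def)
      then show ?thesis
        using block_vec_inner_point_vec[of "sqrt 27" 7 3 1 "sqrt 3" B i] v
        unfolding sqrts by simp
    qed
    show "\<pi> ` ?B L \<in> blocks23 \<or> - \<pi> ` ?B L \<in> blocks23" if "L \<in> \<Omega> - \<Gamma>" for L
      using \<pi>(2) that by blast
    have "card blocks23 \<le> card (\<Omega> - \<Gamma>)"
      unfolding \<pi>(2)[symmetric] image_image using fin by (intro card_image_le) auto
    then show "real (card blocks23) \<le> b" by (simp add: b_def)
  qed simp
qed

text \<open>A row is not constantly -1 by \<open>no_const\<close> and has a nonpositive sum, which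
  leaves \<open>(1, -1)\<close> and its negative. So \<open>s = 0\<close>, and the formula for
  \<open>s^2\<close> gives \<open>q = 2\<close>.\<close>

lemma isometric_Omega2:
  assumes "CARD('n) = 2"
  shows "isometric \<Omega> Omega2"
proof -
  obtain M1 M2 where \<Gamma>: "\<Gamma> = {M1, M2}" "M1 \<noteq> M2"
    using card_\<Gamma> assms by (auto simp: card_2_iff)
  have d2: "d = 2" using assms by (simp add: d_def)
  have row: "x L M1 + x L M2 = 0 \<and> (x L M1 = 1 \<or> x L M1 = -1)" if L: "L \<in> \<Omega> - \<Gamma>" for L
  proof -
    have "x L M1 + x L M2 \<le> 0" using sum_x(1,3)[OF L] \<Gamma> by simp
    moreover have "x L M1 = 1 \<or> x L M2 = 1" using no_const[OF L] \<Gamma> q by (auto simp: x_def)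
    moreover have "x L M1 = 1 \<or> x L M1 = -1" "x L M2 = 1 \<or> x L M2 = -1" using x_sign[OF L] \<Gamma> by auto
    ultimately show ?thesis by auto
  qed
  have "b \<noteq> 0" using b_eq d2 by auto
  then obtain L0 where L0: "L0 \<in> \<Omega> - \<Gamma>" by (metis b_def card.empty equals0I of_nat_0)
  have "s = 0" using sum_x(1)[OF L0] row[OF L0] \<Gamma> by simp
  then have "(2 - q^2 + q) * (q - 1 + 2) = 0" using sum_x(2)[OF L0] d2 by simp
  then have "2 - q^2 + q = 0" using q by simp
  then have "(q - 2) * (q + 1) = 0" by (simp add: algebra_simps power2_eq_square)
  then have q2: "q = 2" using q by simp
  have "b = 1" using b_eq d2 q2 by simp
  \<comment> \<open>The directions at 0 and 60 degrees represent \<Gamma>; the third line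
    \<open>?y\<close> at 120 degrees has inner products -1/2 and 1/2 with them.\<close>
  let ?w = "\<lambda>L. if L = M1 then vector [1, 0] else vector [1 / 2, sqrt 3 / 2] :: real^2"
  let ?y = "vector [- 1 / 2, sqrt 3 / 2] :: real^2"
  define e where "e = (\<lambda>j. span {vector [cos (real j * pi / 3), sin (real j * pi / 3)] :: real^2})"
  have e: "e 0 = span {vector [1, 0]}" "e 1 = span {vector [1 / 2, sqrt 3 / 2]}" "e 2 = span {?y}"
    by (simp_all add: e_def cos_60 sin_60 cos_120 sin_120)
  have Omega2: "Omega2 = {e j | j. j < 6}" by (simp add: Omega2_def e_def)
  have period: "e (i + 3) = e i" for i
  proof -
    \<comment> \<open>Opposite vertices differ by a half turn, hence by the sign of the vector; so
      six vertices span at most three lines.\<close>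
    have neg: "vector [- a, - c] = (-1) *\<^sub>R (vector [a, c] :: real^2)" for a c
      by (simp add: vec_eq_iff forall_2)
    have shift: "real (i + 3) * pi / 3 = real i * pi / 3 + pi" by (simp add: field_simps)
    have "(-1 :: real) \<noteq> 0" by simp
    then show ?thesis
      unfolding e_def shift cos_periodic_pi sin_periodic_pi neg by (rule span_scaleR)
  qed
  have "e 3 = e 0" "e 4 = e 1" "e 5 = e 2" using period[of 0] period[of 1] period[of 2] by simp_all
  moreover have "j = 0 \<or> j = 1 \<or> j = 2 \<or> j = 3 \<or> j = 4 \<or> j = 5" if "j < 6" for j :: nat
    using that by auto
  ultimately have "e j \<in> {e 0, e 1, e 2}" if "j < 6" for j
    using that by (metis insert_iff)
  then have sub2: "Omega2 \<subseteq> {e 0, e 1, e 2}" unfolding Omega2 by blast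
  have "e 0 \<in> Omega2" "e 1 \<in> Omega2" and e2: "e 2 \<in> Omega2" unfolding Omega2 by force+
  show ?thesis
  proof (rule isometricI[where w = ?w and N = 1])
    show "?w L \<bullet> ?w M = 1 * (if L = M then 1 else 1 / q)" if "L \<in> \<Gamma>" "M \<in> \<Gamma>" for L M
      using that unfolding \<Gamma>(1)
      by (elim insertE emptyE) (simp_all add: \<Gamma>(2) \<Gamma>(2)[symmetric] q2 inner_vec_def sum_2)
    show "span {?w L} \<in> Omega2" if "L \<in> \<Gamma>" for L
      using \<open>e 0 \<in> Omega2\<close> \<open>e 1 \<in> Omega2\<close> unfolding e by simp
    show "\<exists>y \<sigma>. span {y} \<in> Omega2 \<and> (\<sigma> = 1 \<or> \<sigma> = -1) \<and> (\<forall>M\<in>\<Gamma>. y \<bullet> ?w M = \<sigma> * (1 / q) * x L M)"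
      if L: "L \<in> \<Omega> - \<Gamma>" for L
    proof (intro exI conjI)
      have "x L M1 = 1 \<and> x L M2 = -1 \<or> x L M1 = -1 \<and> x L M2 = 1" using row[OF L] by linarith
      then show "\<forall>M\<in>\<Gamma>. ?y \<bullet> ?w M = x L M2 * (1 / q) * x L M" "x L M2 = 1 \<or> x L M2 = -1"
        by (elim disjE conjE; simp add: \<Gamma> \<Gamma>(2)[symmetric] q2 inner_vec_def sum_2)+
      show "span {?y} \<in> Omega2" using e2 unfolding e .
    qed
    show "finite Omega2" using sub2 by (rule finite_subset) simp
    have "card Omega2 \<le> 3" using card_mono[OF _ sub2] by (simp add: card_insert_if split: if_splits)
    moreover have "card \<Omega> = 3"
      using card_Diff_subset[OF fin_\<Gamma> sub] card_mono[OF fin sub] card_\<Gamma> assms \<open>b = 1\<close> by (simp add: b_def)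
    ultimately show "card Omega2 \<le> card \<Omega>" by simp
  qed (simp_all add: assms)
qed

end

context oriented_lines
begin

text \<open>As in the plane, the signs can be enumerated: each remaining row has exactly one
  positive entry. So \<open>s = -1\<close>, and the formula for \<open>s^2\<close> becomes
  \<open>(q + 1) * (q^2 - 5) = 0\<close>.\<close>

lemma isometric_Omega3:
  assumes "CARD('n) = 3"
  shows "isometric \<Omega> Omega3"
proof -
  obtain M1 M2 M3 where \<Gamma>: "\<Gamma> = {M1, M2, M3}" "M1 \<noteq> M2" "M1 \<noteq> M3" "M2 \<noteq> M3"
    using card_\<Gamma> assms by (auto simp: card_3_iff)
  have d3: "d = 3" using assms by (simp add: d_def)
  have row: "(x L M1, x L M2, x L M3) \<in> {(1, -1, -1), (-1, 1, -1), (-1, -1, 1)}" if L: "L \<in> \<Omega> - \<Gamma>" for L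
  proof -
    have "x L M1 + x L M2 + x L M3 \<le> 0" using sum_x(1,3)[OF L] \<Gamma> by simp
    moreover have "x L M1 = 1 \<or> x L M2 = 1 \<or> x L M3 = 1" using no_const[OF L] \<Gamma> q by (auto simp: x_def)
    moreover have "x L M1 = 1 \<or> x L M1 = -1" "x L M2 = 1 \<or> x L M2 = -1" "x L M3 = 1 \<or> x L M3 = -1"
      using x_sign[OF L] \<Gamma> by auto
    ultimately show ?thesis by auto
  qed
  have "b \<noteq> 0" using b_eq d3 by auto
  then obtain L0 where L0: "L0 \<in> \<Omega> - \<Gamma>" by (metis b_def card.empty equals0I of_nat_0)
  have "s = -1" using sum_x(1)[OF L0] row[OF L0] \<Gamma> by auto
  then have "(3 - q^2 + q) * (q - 1 + 3) = 1" using sum_x(2)[OF L0] d3 by simp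
  then have "(q + 1) * (q^2 - 5) = 0" by algebra
  then have q5: "q^2 = 5" using q by simp
  then have q_sqrt: "q = sqrt 5" using q by (metis less_eq_real_def order.strict_trans real_sqrt_unique zero_less_one)
  have "b = 3" using b_eq d3 q5 by simp
  define \<phi> where "\<phi> = (1 + sqrt 5) / 2"
  have \<phi>: "\<phi> * \<phi> = \<phi> + 1" "\<phi> > 0" "\<phi> = (1 + q) / 2"
    by (simp_all add: \<phi>_def q_sqrt field_simps add_pos_pos)
  \<comment> \<open>The squared length \<phi>^2 + 1 of a vertex, written so that
    \<open>N / q\<close> is visibly \<phi>.\<close>
  define N where "N = q * \<phi>"
  have "q = 2 * \<phi> - 1" using \<phi>(3) by simp
  then have "N = (2 * \<phi> - 1) * \<phi>" by (simp only: N_def)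
  also have "\<dots> = 2 * (\<phi> * \<phi>) - \<phi>" by (simp add: algebra_simps)
  finally have N1: "N = \<phi> + 2" using \<phi>(1) by linarith
  have "N / q = \<phi>" using q by (simp add: N_def)
  moreover have "N > 0" unfolding N1 using \<phi>(2) by simp
  ultimately have N: "N = \<phi> + 2" "N / q = \<phi>" "N > 0" using N1 by blast+
  define v :: "real \<Rightarrow> real \<Rightarrow> nat \<Rightarrow> real^3" where
    "v = (\<lambda>a c i. if i = 0 then vector [0, a, c] else if i = 1 then vector [a, c, 0] else vector [c, 0, a])"
  have ico: "Omega3 = {span {v a c i} | a c i. a \<in> {1, -1} \<and> c \<in> {\<phi>, - \<phi>} \<and> i < 3}"
  proof -
    have "{v a c i | i. i < 3} = {vector [0, a, c], vector [a, c, 0], vector [c, 0, a]}" for a c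
    proof -
      have "{v a c i | i. i < 3} = v a c ` {i. i < 3}" by blast
      also have "{i :: nat. i < 3} = {0, 1, 2}" by auto
      finally show ?thesis by (simp add: v_def insert_commute)
    qed
    then have "icosahedron_vertices = (\<Union>a\<in>{1, -1}. \<Union>c\<in>{\<phi>, - \<phi>}. {v a c i | i. i < 3})"
      by (simp add: icosahedron_vertices_def Let_def \<phi>_def)
    also have "\<dots> = {v a c i | a c i. a \<in> {1, -1} \<and> c \<in> {\<phi>, - \<phi>} \<and> i < 3}"
      unfolding UNION_eq mem_Collect_eq by blast
    finally have vertices: "icosahedron_vertices =
      {v a c i | a c i. a \<in> {1, -1} \<and> c \<in> {\<phi>, - \<phi>} \<and> i < 3}" .
    show ?thesis unfolding Omega3_def vertices by (rule Collect_cong) blast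
  qed
  have neg: "v (- a) (- c) i = (-1) *\<^sub>R v a c i" for a c i
    by (simp add: v_def vec_eq_iff forall_3)
  let ?T = "(\<lambda>(c, i). span {v 1 c i}) ` ({\<phi>, - \<phi>} \<times> {..<3})"
  have sub3: "Omega3 \<subseteq> ?T"
  proof
    fix Z assume "Z \<in> Omega3"
    then obtain a c i where Z: "Z = span {v a c i}" "a = 1 \<or> a = -1" "c = \<phi> \<or> c = - \<phi>" "i < 3"
      unfolding ico by blast
    have "span {v (-1) c i} = span {v 1 (- c) i}"
      using neg[of 1 "- c" i] span_scaleR[of "-1" "v 1 (- c) i"] by simp
    then have "Z = span {v 1 c i} \<or> Z = span {v 1 (- c) i}" using Z(1,2) by metis
    moreover have "span {v 1 e i} \<in> ?T" if "e = \<phi> \<or> e = - \<phi>" for e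
      using that Z(4) by (intro image_eqI[of _ _ "(e, i)"]) auto
    ultimately show "Z \<in> ?T" using Z(3) by (metis minus_minus)
  qed
  have finT: "finite ?T" by simp
  have "card ?T \<le> card ({\<phi>, - \<phi>} \<times> {..<3 :: nat})" by (rule card_image_le) simp
  also have "\<dots> = 6" using \<phi>(2) by (simp add: card_cartesian_product)
  finally have card3: "finite Omega3" "card Omega3 \<le> 6"
    using finite_subset[OF sub3 finT] card_mono[OF finT sub3] by linarith+
  let ?i = "\<lambda>L. if L = M1 then 0 else if L = M2 then 1 else 2 :: nat"
  have inner: "v a c i \<bullet> v 1 \<phi> j =
      (if i = j then a + c * \<phi> else if j = (i + 1) mod 3 then a * \<phi> else c)" if "i < 3" "j < 3" for a c i j
  proof -
    have "i = 0 \<or> i = 1 \<or> i = 2" "j = 0 \<or> j = 1 \<or> j = 2" using that by auto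
    then show ?thesis by (elim disjE) (simp_all add: v_def inner_vec_def sum_3)
  qed
  show ?thesis
  proof (rule isometricI[where w = "\<lambda>L. v 1 \<phi> (?i L)" and N = N])
    show "v 1 \<phi> (?i L) \<bullet> v 1 \<phi> (?i M) = N * (if L = M then 1 else 1 / q)" if "L \<in> \<Gamma>" "M \<in> \<Gamma>" for L M
      using that unfolding \<Gamma>(1)
      by (elim insertE emptyE) (simp_all add: inner \<Gamma>(2-4) \<Gamma>(2-4)[symmetric] N(1) N(2)[unfolded N(1)] \<phi>(1))
    show "span {v 1 \<phi> (?i L)} \<in> Omega3" if "L \<in> \<Gamma>" for L
    proof -
      have "?i L < 3" by simp
      then show ?thesis unfolding ico by blast
    qed
    show "\<exists>y \<sigma>. span {y} \<in> Omega3 \<and> (\<sigma> = 1 \<or> \<sigma> = -1) \<and>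
        (\<forall>M\<in>\<Gamma>. y \<bullet> v 1 \<phi> (?i M) = \<sigma> * (N / q) * x L M)" if L: "L \<in> \<Omega> - \<Gamma>" for L
    proof -
      \<comment> \<open>By \<open>inner\<close>, the vector \<open>v 1 (- \<phi>) i\<close> has
        product \<phi> with the vertex of index \<open>(i + 1) mod 3\<close> and - \<phi> with the
        other two. The witness index is therefore the cyclic predecessor of the positive
        place.\<close>
      have mem: "span {v 1 (- \<phi>) i} \<in> Omega3" if "i < 3" for i using that unfolding ico by blast
      consider "x L M1 = 1" "x L M2 = -1" "x L M3 = -1" | "x L M1 = -1" "x L M2 = 1" "x L M3 = -1"
        | "x L M1 = -1" "x L M2 = -1" "x L M3 = 1" using row[OF L] by auto
      then show ?thesis
      proof cases
        case 1
        then show ?thesis using mem[of 2]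
          by (intro exI[of _ "v 1 (- \<phi>) 2"] exI[of _ 1])
            (simp add: inner \<Gamma> \<Gamma>(2-4)[symmetric] N(2) \<phi>(1))
      next
        case 2
        then show ?thesis using mem[of 0]
          by (intro exI[of _ "v 1 (- \<phi>) 0"] exI[of _ 1])
            (simp add: inner \<Gamma> \<Gamma>(2-4)[symmetric] N(2) \<phi>(1))
      next
        case 3
        then show ?thesis using mem[of 1]
          by (intro exI[of _ "v 1 (- \<phi>) 1"] exI[of _ 1])
            (simp add: inner \<Gamma> \<Gamma>(2-4)[symmetric] N(2) \<phi>(1))
      qed
    qed
    have "card \<Omega> = 6"
      using card_Diff_subset[OF fin_\<Gamma> sub] card_mono[OF fin sub] card_\<Gamma> assms \<open>b = 3\<close> by (simp add: b_def)
    then show "card Omega3 \<le> card \<Omega>" using card3 by simp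
  qed (use assms N card3 in simp_all)
qed

end

section \<open>Orienting the lines\<close>

lemma unit_vec:
  assumes "is_line L"
  shows "unit_vec L \<bullet> unit_vec L = 1" "span {unit_vec L} = L"
proof -
  obtain v where v: "v \<noteq> 0" "L = span {v}" using assms by (auto simp: is_line_def)
  then have "norm ((1 / norm v) *\<^sub>R v) = 1 \<and> span {(1 / norm v) *\<^sub>R v} = L"
    by (simp add: span_scaleR del: scaleR_one)
  then have "norm (unit_vec L) = 1 \<and> span {unit_vec L} = L"
    unfolding unit_vec_def by (rule someI)
  then show "unit_vec L \<bullet> unit_vec L = 1" "span {unit_vec L} = L"
    by (simp_all add: norm_eq_1)
qed

lemma card_le_Inc:
  assumes "finite \<Omega>" "\<Gamma> \<subseteq> \<Omega>" "incoherent \<Gamma>"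
  shows "card \<Gamma> \<le> Inc \<Omega>"
  unfolding Inc_def
proof (rule Max_ge)
  show "finite {card \<Gamma> | \<Gamma>. \<Gamma> \<subseteq> \<Omega> \<and> incoherent \<Gamma>}"
    by (rule finite_subset[of _ "card ` Pow \<Omega>"]) (use assms(1) in auto)
qed (use assms in blast)

text \<open>Orient the lines of \<Gamma> towards one of them, \<alpha>0. Positivity of the triple
  products containing \<alpha>0 then forces all other inner products within \<Gamma> to be positive.
  Each remaining line is oriented by the sign of its coordinate sum.\<close>

lemma orientation_exists:
  fixes \<Omega> \<Gamma> :: "(real^'n) set set"
  assumes \<kappa>: "0 < \<kappa>" "\<kappa> < 1" and eq: "equiangular \<kappa> \<Omega>" and rel: "saturates_relative_bound \<kappa> \<Omega>"
    and inc: "saturates_incoherence_bound \<Omega>" and \<Gamma>: "\<Gamma> \<subseteq> \<Omega>" "incoherent \<Gamma>" "card \<Gamma> = CARD('n)"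
  shows "\<exists>u. oriented_lines \<Omega> \<Gamma> u (1 / \<kappa>) \<and> (\<forall>K\<in>\<Omega>. \<forall>L\<in>\<Omega>. \<forall>M\<in>\<Omega>.
    triple_prod K L M = (u K \<bullet> u L) * (u K \<bullet> u M) * (u L \<bullet> u M))"
proof -
  define d where "d = real CARD('n)"
  have d: "d \<ge> 1" by (simp add: d_def Suc_leI)
  have \<kappa>d: "\<kappa>^2 * d < 1" and n: "real (card \<Omega>) = (d - \<kappa>^2 * d) / (1 - \<kappa>^2 * d)"
    using rel by (simp_all add: saturates_relative_bound_def Let_def d_def)
  have "\<kappa>^2 < 1" using \<kappa> by (simp add: power_less_one_iff)
  then have "d * (1 - \<kappa>^2) > 0" using d by (intro mult_pos_pos) auto
  then have "real (card \<Omega>) > 0" unfolding n using \<kappa>d by (simp add: algebra_simps)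
  \<comment> \<open>An infinite set would have \<open>card\<close> equal to 0.\<close>
  then have fin: "finite \<Omega>" by (metis card.infinite less_irrefl of_nat_0)
  have fin\<Gamma>: "finite \<Gamma>" using fin \<Gamma>(1) finite_subset by blast
  have "\<Gamma> \<noteq> {}" using \<Gamma>(3) by auto
  then obtain \<alpha>0 where \<alpha>0: "\<alpha>0 \<in> \<Gamma>" by blast
  let ?v = "unit_vec :: (real^'n) set \<Rightarrow> real^'n"
  have v: "?v L \<bullet> ?v L = 1" "span {?v L} = L" if "L \<in> \<Omega>" for L
    using unit_vec eq that by (auto simp: equiangular_def)
  have ang: "?v L \<bullet> ?v M = \<kappa> \<or> ?v L \<bullet> ?v M = - \<kappa>" if "L \<in> \<Omega>" "M \<in> \<Omega>" "L \<noteq> M" for L M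
    using eq that by (simp add: equiangular_def)
  define \<epsilon> where "\<epsilon> = (\<lambda>L. if L = \<alpha>0 \<or> ?v \<alpha>0 \<bullet> ?v L > 0 then 1 else -1 :: real)"
  define \<delta> where "\<delta> = (\<lambda>L. if L \<in> \<Gamma> then \<epsilon> L else if (\<Sum>M\<in>\<Gamma>. \<epsilon> M * (?v L \<bullet> ?v M)) \<le> 0 then 1 else -1)"
  define u where "u = (\<lambda>L. \<delta> L *\<^sub>R ?v L)"
  have \<delta>: "\<delta> L * \<delta> L = 1" "\<delta> L = 1 \<or> \<delta> L = -1" for L by (auto simp: \<delta>_def \<epsilon>_def)
  have u_ang: "u L \<bullet> u M = \<kappa> \<or> u L \<bullet> u M = - \<kappa>" if "L \<in> \<Omega>" "M \<in> \<Omega>" "L \<noteq> M" for L M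
    using ang[OF that] \<delta>(2)[of L] \<delta>(2)[of M] by (auto simp: u_def)
  have triple: "triple_prod K L M = (u K \<bullet> u L) * (u K \<bullet> u M) * (u L \<bullet> u M)" for K L M
  proof -
    have "(u K \<bullet> u L) * (u K \<bullet> u M) * (u L \<bullet> u M) =
      (\<delta> K * \<delta> K) * (\<delta> L * \<delta> L) * (\<delta> M * \<delta> M) * triple_prod K L M"
      by (simp add: u_def triple_prod_def)
    then show ?thesis by (simp add: \<delta>)
  qed
  have base: "u \<alpha>0 \<bullet> u M = \<kappa>" if "M \<in> \<Gamma>" "M \<noteq> \<alpha>0" for M
  proof -
    have "\<alpha>0 \<in> \<Omega>" "M \<in> \<Omega>" "\<alpha>0 \<noteq> M" using \<alpha>0 that \<Gamma>(1) by blast+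
    from ang[OF this] show ?thesis
      using \<alpha>0 that \<kappa> by (elim disjE) (simp_all add: u_def \<delta>_def \<epsilon>_def)
  qed
  have angle_\<Gamma>: "u L \<bullet> u M = \<kappa>" if LM: "L \<in> \<Gamma>" "M \<in> \<Gamma>" "L \<noteq> M" for L M
  proof (cases "L = \<alpha>0 \<or> M = \<alpha>0")
    case True
    then show ?thesis using base[of M] base[of L] LM by (metis inner_commute)
  next
    case False
    then have three: "distinct [\<alpha>0, L, M]" using LM(3)
      by (metis distinct_length_2_or_more distinct_singleton)
    have "card {\<alpha>0, L, M} \<le> card \<Gamma>" using fin\<Gamma> \<alpha>0 LM by (intro card_mono) auto
    then have "\<not> card \<Gamma> \<le> 2" using three by simp
    then have "triple_prod \<alpha>0 L M > 0"
      using \<Gamma>(2) \<alpha>0 LM three unfolding incoherent_def by blast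
    then have "\<kappa> * \<kappa> * (u L \<bullet> u M) > 0" using base LM False by (simp add: triple)
    then have "u L \<bullet> u M > 0" using \<kappa> by (simp add: zero_less_mult_iff)
    moreover have "L \<in> \<Omega>" "M \<in> \<Omega>" using LM \<Gamma>(1) by blast+
    ultimately show ?thesis using u_ang[of L M] LM(3) \<kappa> by linarith
  qed
  \<comment> \<open>Otherwise \<Gamma> with \<open>L\<close> added is incoherent, since a triple
    containing \<open>L\<close> has exactly two negative inner products; its size exceeds
    \<open>Inc \<Omega>\<close>.\<close>
  have no_const: "\<exists>M \<in> \<Gamma>. u L \<bullet> u M = \<kappa>" if L: "L \<in> \<Omega> - \<Gamma>" for L
  proof (rule ccontr)
    assume neg: "\<not> ?thesis"
    have minus: "u L \<bullet> u M = - \<kappa> \<and> u M \<bullet> u L = - \<kappa>" if "M \<in> \<Gamma>" for M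
    proof -
      have "L \<in> \<Omega>" "M \<in> \<Omega>" "L \<noteq> M" using L that \<Gamma>(1) by blast+
      then show ?thesis using u_ang[of L M] neg that by (auto simp: inner_commute)
    qed
    have pair: "u \<alpha> \<bullet> u \<beta> = (if \<alpha> = L \<or> \<beta> = L then - \<kappa> else \<kappa>)"
      if "\<alpha> \<in> insert L \<Gamma>" "\<beta> \<in> insert L \<Gamma>" "\<alpha> \<noteq> \<beta>" for \<alpha> \<beta>
      using that minus angle_\<Gamma> by (metis insertE)
    have "triple_prod \<alpha> \<beta> \<gamma> > 0"
      if "\<alpha> \<in> insert L \<Gamma>" "\<beta> \<in> insert L \<Gamma>" "\<gamma> \<in> insert L \<Gamma>" "distinct [\<alpha>, \<beta>, \<gamma>]" for \<alpha> \<beta> \<gamma>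
    proof -
      have ne: "\<alpha> \<noteq> \<beta>" "\<alpha> \<noteq> \<gamma>" "\<beta> \<noteq> \<gamma>" using that(4) by simp_all
      show ?thesis
        unfolding triple pair[OF that(1,2) ne(1)] pair[OF that(1,3) ne(2)] pair[OF that(2,3) ne(3)]
        using ne \<kappa>(1) by (cases "\<alpha> = L"; cases "\<beta> = L"; cases "\<gamma> = L"; simp)
    qed
    then have "incoherent (insert L \<Gamma>)" unfolding incoherent_def by blast
    then have "card (insert L \<Gamma>) \<le> Inc \<Omega>" using L \<Gamma>(1) fin by (intro card_le_Inc) auto
    then show False
      using L fin\<Gamma> \<Gamma>(3) inc by (simp add: saturates_incoherence_bound_def)
  qed
  have "oriented_lines \<Omega> \<Gamma> u (1 / \<kappa>)"
  proof
    show "1 / \<kappa> > 1" using \<kappa> by simp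
    show "real CARD('n) < (1 / \<kappa>)^2"
      using \<kappa>d \<kappa> by (simp add: d_def power_divide field_simps)
    have "real (card \<Omega>) * (1 - \<kappa>^2 * d) = d - \<kappa>^2 * d" using n \<kappa>d by simp
    then have "real (card \<Omega>) * (1 - \<kappa>^2 * d) / \<kappa>^2 = (d - \<kappa>^2 * d) / \<kappa>^2" by simp
    then show "real (card \<Omega>) * ((1 / \<kappa>)^2 - real CARD('n)) = real CARD('n) * ((1 / \<kappa>)^2 - 1)"
      using \<kappa> by (simp add: d_def power_divide field_simps)
    show "u L \<bullet> u L = 1" if "L \<in> \<Omega>" for L
      using v(1)[OF that] \<delta>(1)[of L] by (simp add: u_def flip: mult.assoc)
    show "span {u L} = L" if "L \<in> \<Omega>" for L
    proof -
      have "\<delta> L \<noteq> 0" using \<delta>(1)[of L] by auto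
      then show ?thesis using v(2)[OF that] by (simp add: u_def span_scaleR)
    qed
    show "(\<Sum>M\<in>\<Gamma>. u L \<bullet> u M) \<le> 0" if L: "L \<in> \<Omega> - \<Gamma>" for L
    proof -
      have "(\<Sum>M\<in>\<Gamma>. u L \<bullet> u M) = \<delta> L * (\<Sum>M\<in>\<Gamma>. \<epsilon> M * (?v L \<bullet> ?v M))"
        by (simp add: u_def sum_distrib_left \<delta>_def[of] mult_ac cong: sum.cong_simp)
      then show ?thesis using L by (simp add: \<delta>_def)
    qed
  qed (use fin \<Gamma> u_ang angle_\<Gamma> no_const in \<open>simp_all\<close>)
  then show ?thesis using triple by blast
qed

theorem theorem1p4:
  fixes \<Omega> \<Gamma> :: "(real^'n) set set" and \<kappa> :: real
  assumes "CARD('n) \<ge> 2"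
    and "0 < \<kappa>" and "\<kappa> < 1"
    and "equiangular \<kappa> \<Omega>"
    and "saturates_relative_bound \<kappa> \<Omega>"
    and "saturates_incoherence_bound \<Omega>"
    and "\<Gamma> \<subseteq> \<Omega>" and "incoherent \<Gamma>" and "card \<Gamma> = CARD('n)"
    and "CARD('n) \<ge> 4 \<Longrightarrow>
      \<exists>c. \<forall>\<alpha>\<in>\<Gamma>. \<forall>\<beta>\<in>\<Gamma>. \<forall>\<eta>\<in>\<Gamma>. \<forall>\<nu>\<in>\<Gamma>. distinct [\<alpha>, \<beta>, \<eta>, \<nu>] \<longrightarrow>
        card (S \<Omega> \<alpha> \<beta> \<inter> S \<Omega> \<eta> \<nu>) = c"
  shows "(CARD('n) = 2 \<and> isometric \<Omega> Omega2) \<or>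
         (CARD('n) = 3 \<and> isometric \<Omega> Omega3) \<or>
         (CARD('n) = 6 \<and> isometric \<Omega> Omega6) \<or>
         (CARD('n) = 7 \<and> isometric \<Omega> Omega7) \<or>
         (CARD('n) = 23 \<and> isometric \<Omega> Omega23)"
proof -
  obtain u where u: "oriented_lines \<Omega> \<Gamma> u (1 / \<kappa>)"
    and triple: "\<And>K L M. K \<in> \<Omega> \<Longrightarrow> L \<in> \<Omega> \<Longrightarrow> M \<in> \<Omega> \<Longrightarrow>
      triple_prod K L M = (u K \<bullet> u L) * (u K \<bullet> u M) * (u L \<bullet> u M)"
    using orientation_exists[OF assms(2-9)] by blast
  define q where "q = 1 / \<kappa>"
  interpret oriented_lines \<Omega> \<Gamma> u q using u by (simp add: q_def)
  consider "CARD('n) = 2" | "CARD('n) = 3" | "CARD('n) \<ge> 4" using assms(1) by linarith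
  then show ?thesis
  proof cases
    case 1
    then show ?thesis using isometric_Omega2 by blast
  next
    case 2
    then show ?thesis using isometric_Omega3 by blast
  next
    case 3
    then obtain c where c: "\<And>\<alpha> \<beta> \<eta> \<nu>. \<alpha> \<in> \<Gamma> \<Longrightarrow> \<beta> \<in> \<Gamma> \<Longrightarrow> \<eta> \<in> \<Gamma> \<Longrightarrow> \<nu> \<in> \<Gamma> \<Longrightarrow>
        distinct [\<alpha>, \<beta>, \<eta>, \<nu>] \<Longrightarrow> card (S \<Omega> \<alpha> \<beta> \<inter> S \<Omega> \<eta> \<nu>) = c"
      using assms(10) by blast
    have d4: "d \<ge> 4" using 3 by (simp add: d_def)
    have "\<exists>p t. sign_config \<Gamma> (\<Omega> - \<Gamma>) x q s d b p t"
      by (rule exI, rule exI, rule sign_config[of c, OF _ _ d4]) (rule triple c, assumption+)+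
    then obtain p t where sc: "sign_config \<Gamma> (\<Omega> - \<Gamma>) x q s d b p t" by blast
    consider "s = 0" | "s \<noteq> 0" by blast
    then show ?thesis
    proof cases
      case 1
      from sign_config.s_zero_case[OF sc this] have "d = 6" "q = 3" "b = 10" by simp_all
      then show ?thesis using isometric_Omega6[OF sc _ _ 1] by (simp add: d_def)
    next
      case 2
      from sign_config.q_values[OF sc this] show ?thesis
      proof (elim disjE conjE)
        assume "d = 7" "q = 3" "s = -3" "b = 21"
        from isometric_Omega7[OF sc this] \<open>d = 7\<close> show ?thesis by (simp add: d_def)
      next
        assume "d = 23" "q = 5" "s = -9" "b = 253"
        from isometric_Omega23[OF sc this] \<open>d = 23\<close> show ?thesis by (simp add: d_def)
      qed
    qed
  qed
qed

end
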